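(* For every $K>0$ and $b\in(0,1)$ there exist constants $C,c>0$ depending only on $K$ and $b$ such that the following holds. Let $A$ be an $n\times n$ random matrix whose entries $A_{ij}$ are independent and satisfy $\sum_{i,j=1}^n \mathbb{E} A_{ij}^2\le Kn^2$ and $\max_{i,j}\mathcal{L}(A_{ij},1)\le b$. Then $$\mathbb{P}\left\{\sigma_n(A)\le \frac{\varepsilon}{\sqrt n}\right\}\le C\varepsilon+2e^{-cn}\qquad\text{for all }\varepsilon\ge 0.$$
   Context: All random variables are real. For a real random variable $Z$ and $t\ge0$, the L\'evy concentration function is $\mathcal{L}(Z,t):=\sup_{u\in\mathbb{R}}\mathbb{P}\{|Z-u|<t\}$. $\sigma_n(A)=\min_{x\in \mathbb{S}^{n-1}}|Ax|$ is the smallest singular value of $A$, where $|\cdot|$ is the Euclidean norm and $\mathbb{S}^{n-1}$ the Euclidean unit sphere of $\mathbb{R}^n$. The entries are not assumed to be identically distributed or centered. *)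

theory Defs
  imports "HOL-Probability.Probability"
begin

definition levy_concentration :: "'w measure \<Rightarrow> ('w \<Rightarrow> real) \<Rightarrow> real \<Rightarrow> real" where
  "levy_concentration M Z t = (SUP u. measure M {\<omega> \<in> space M. \<bar>Z \<omega> - u\<bar> < t})"

text \<open>
  Vectors of $R^n$ and real $n \times n$ matrices are functions on \<open>nat\<close> of which only the
  values at indices below \<open>n\<close> matter; the dimension has to stay a term so that constants can be
  chosen uniformly in it. On \<open>{..<n}\<close>, the function \<^const>\<open>L2_set\<close> is the Euclidean norm.
\<close>

definition mat_vec :: "nat \<Rightarrow> (nat \<Rightarrow> nat \<Rightarrow> real) \<Rightarrow> (nat \<Rightarrow> real) \<Rightarrow> nat \<Rightarrow> real" where
  "mat_vec n A x = (\<lambda>i. \<Sum>j<n. A i j * x j)"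

text \<open>
  For \<open>n > 0\<close> the infimum is a minimum, since the unit sphere is compact and nonempty.
\<close>

definition sigma_min :: "nat \<Rightarrow> (nat \<Rightarrow> nat \<Rightarrow> real) \<Rightarrow> real" where
  "sigma_min n A =
    (INF x \<in> {x :: nat \<Rightarrow> real. L2_set x {..<n} = 1}. L2_set (mat_vec n A x) {..<n})"

lemma L2_set_scale: "L2_set (\<lambda>i. c * f i) S = \<bar>c\<bar> * L2_set f S"
  by (simp add: L2_set_def power_mult_distrib flip: sum_distrib_left) (simp add: real_sqrt_mult)

lemma mat_vec_scale: "mat_vec n A (\<lambda>i. c * x i) = (\<lambda>i. c * mat_vec n A x i)"
  by (simp add: mat_vec_def sum_distrib_left mult_ac)

lemma sigma_min_less_iff:
  assumes "n > 0"
  shows "sigma_min n A < t \<longleftrightarrow>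
    (\<exists>x. L2_set x {..<n} \<noteq> 0 \<and> L2_set (mat_vec n A x) {..<n} < t * L2_set x {..<n})"
    (is "_ \<longleftrightarrow> ?R")
proof -
  have "L2_set (\<lambda>i. if i = 0 then 1 else 0) {..<n} = 1"
    using assms by (simp add: L2_set_def if_distrib[where f = "\<lambda>x. x\<^sup>2"] cong: if_cong)
  then have ne: "{x :: nat \<Rightarrow> real. L2_set x {..<n} = 1} \<noteq> {}" by blast
  have bdd: "bdd_below ((\<lambda>x. L2_set (mat_vec n A x) {..<n}) ` {x. L2_set x {..<n} = 1})"
    by (rule bdd_belowI[of _ 0]) auto
  have "sigma_min n A < t \<longleftrightarrow> (\<exists>x. L2_set x {..<n} = 1 \<and> L2_set (mat_vec n A x) {..<n} < t)"
    unfolding sigma_min_def using cINF_less_iff[OF ne bdd] by simp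
  also have "\<dots> \<longleftrightarrow> ?R"
  proof
    assume ?R
    then obtain x where x: "L2_set x {..<n} \<noteq> 0"
      "L2_set (mat_vec n A x) {..<n} < t * L2_set x {..<n}" by blast
    then have pos: "L2_set x {..<n} > 0" using L2_set_nonneg[of x "{..<n}"] by linarith
    let ?c = "inverse (L2_set x {..<n})"
    have "L2_set (\<lambda>i. ?c * x i) {..<n} = 1"
      using pos by (subst L2_set_scale) simp
    moreover have "L2_set (mat_vec n A (\<lambda>i. ?c * x i)) {..<n} < t"
      using pos x(2) by (subst mat_vec_scale, subst L2_set_scale) (simp add: field_simps)
    ultimately show "\<exists>x. L2_set x {..<n} = 1 \<and> L2_set (mat_vec n A x) {..<n} < t" by blast
  next
    assume "\<exists>x. L2_set x {..<n} = 1 \<and> L2_set (mat_vec n A x) {..<n} < t"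
    then obtain x where "L2_set x {..<n} = 1" "L2_set (mat_vec n A x) {..<n} < t" by blast
    then show ?R by (intro exI[of _ x]) simp
  qed
  finally show ?thesis .
qed

lemma sigma_min_measurable:
  assumes "n > 0"
    and [measurable]: "\<And>i j. i < n \<Longrightarrow> j < n \<Longrightarrow> A i j \<in> borel_measurable M"
  shows "(\<lambda>\<omega>. sigma_min n (\<lambda>i j. A i j \<omega>)) \<in> borel_measurable M"
proof (subst borel_measurable_iff_less, intro allI)
  fix t :: real
  obtain D :: "(nat \<Rightarrow> real) set" where D: "countable D"
    "\<And>U. open U \<Longrightarrow> U \<noteq> {} \<Longrightarrow> \<exists>d\<in>D. d \<in> U"
    by (rule countable_dense_setE) blast
  let ?P = "\<lambda>B x. L2_set x {..<n} \<noteq> 0 \<and> L2_set (mat_vec n B x) {..<n} < t * L2_set x {..<n}"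
  have op: "open {x. ?P B x}" for B
    unfolding L2_set_def mat_vec_def
    by (intro open_Collect_conj open_Collect_neq open_Collect_less continuous_intros
        continuous_on_product_coordinates)
  have "(\<exists>x. ?P B x) \<longleftrightarrow> (\<exists>x\<in>D. ?P B x)" for B
    using D(2)[OF op[of B]] by auto
  then have "{\<omega> \<in> space M. sigma_min n (\<lambda>i j. A i j \<omega>) < t} =
      {\<omega> \<in> space M. \<exists>x\<in>D. ?P (\<lambda>i j. A i j \<omega>) x}"
    using sigma_min_less_iff[OF \<open>n > 0\<close>] by simp
  also have "\<dots> \<in> sets M"
    using D(1) unfolding L2_set_def mat_vec_def by measurable
  finally show "{\<omega> \<in> space M. sigma_min n (\<lambda>i j. A i j \<omega>) < t} \<in> sets M" .
qed

text \<open>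
  Only the joint law of the entries matters: constants that work for all random matrices on the
  sample space \<open>nat \<times> nat \<Rightarrow> real\<close> work on every sample space. Hence letting the sample space type be
  a type variable does not affect what the constants depend on.
\<close>

lemma sample_space_transfer:
  fixes K b C c :: real
  assumes canonical:
    "\<forall>n>0. \<forall>(M :: (nat \<times> nat \<Rightarrow> real) measure) A.
      prob_space M \<longrightarrow>
      prob_space.indep_vars M (\<lambda>_. borel) (\<lambda>(i, j). A i j) ({..<n} \<times> {..<n}) \<longrightarrow>
      (\<forall>i<n. \<forall>j<n. integrable M (\<lambda>\<omega>. (A i j \<omega>)\<^sup>2)) \<longrightarrow>
      (\<Sum>i<n. \<Sum>j<n. \<integral>\<omega>. (A i j \<omega>)\<^sup>2 \<partial>M) \<le> K * (real n)\<^sup>2 \<longrightarrow>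
      (\<forall>i<n. \<forall>j<n. levy_concentration M (A i j) 1 \<le> b) \<longrightarrow>
      (\<forall>\<epsilon>\<ge>0. measure M {\<omega> \<in> space M. sigma_min n (\<lambda>i j. A i j \<omega>) \<le> \<epsilon> / sqrt (real n)}
        \<le> C * \<epsilon> + 2 * exp (- c * real n))"
  shows
    "\<forall>n>0. \<forall>(M :: 'w measure) A.
      prob_space M \<longrightarrow>
      prob_space.indep_vars M (\<lambda>_. borel) (\<lambda>(i, j). A i j) ({..<n} \<times> {..<n}) \<longrightarrow>
      (\<forall>i<n. \<forall>j<n. integrable M (\<lambda>\<omega>. (A i j \<omega>)\<^sup>2)) \<longrightarrow>
      (\<Sum>i<n. \<Sum>j<n. \<integral>\<omega>. (A i j \<omega>)\<^sup>2 \<partial>M) \<le> K * (real n)\<^sup>2 \<longrightarrow>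
      (\<forall>i<n. \<forall>j<n. levy_concentration M (A i j) 1 \<le> b) \<longrightarrow>
      (\<forall>\<epsilon>\<ge>0. measure M {\<omega> \<in> space M. sigma_min n (\<lambda>i j. A i j \<omega>) \<le> \<epsilon> / sqrt (real n)}
        \<le> C * \<epsilon> + 2 * exp (- c * real n))"
proof (intro allI impI)
  fix n :: nat and M :: "'w measure" and A :: "nat \<Rightarrow> nat \<Rightarrow> 'w \<Rightarrow> real" and \<epsilon> :: real
  assume n: "n > 0" and M: "prob_space M"
    and ind: "prob_space.indep_vars M (\<lambda>_. borel) (\<lambda>(i, j). A i j) ({..<n} \<times> {..<n})"
    and int: "\<forall>i<n. \<forall>j<n. integrable M (\<lambda>\<omega>. (A i j \<omega>)\<^sup>2)"
    and sq: "(\<Sum>i<n. \<Sum>j<n. \<integral>\<omega>. (A i j \<omega>)\<^sup>2 \<partial>M) \<le> K * (real n)\<^sup>2"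
    and levy: "\<forall>i<n. \<forall>j<n. levy_concentration M (A i j) 1 \<le> b"
    and eps: "\<epsilon> \<ge> 0"
  interpret prob_space M by fact
  let ?I = "{..<n} \<times> {..<n}"
  define X where "X = (\<lambda>\<omega>. \<lambda>p\<in>?I. A (fst p) (snd p) \<omega>)"
  define N where "N = distr M (PiM ?I (\<lambda>_. borel :: real measure)) X"
  define B where "B = (\<lambda>i j (f :: nat \<times> nat \<Rightarrow> real). f (i, j))"
  have A_meas [measurable]: "A i j \<in> borel_measurable M" if "i < n" "j < n" for i j
    using ind that unfolding indep_vars_def by auto
  have X_meas [measurable]: "X \<in> M \<rightarrow>\<^sub>M PiM ?I (\<lambda>_. borel)"
    unfolding X_def by (rule measurable_restrict) auto
  have BX: "B i j (X \<omega>) = A i j \<omega>" if "i < n" "j < n" for i j \<omega>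
    using that by (simp add: B_def X_def)
  interpret N: prob_space N unfolding N_def by (rule prob_space_distr) fact
  have sets_N [measurable_cong]: "sets N = sets (PiM ?I (\<lambda>_. borel))" by (simp add: N_def)
  have space_N: "space N = space (PiM ?I (\<lambda>_. borel :: real measure))" by (simp add: N_def)
  have B_meas: "B i j \<in> borel_measurable (PiM ?I (\<lambda>_. borel))" if "i < n" "j < n" for i j
    unfolding B_def using that by (intro measurable_component_singleton) auto
  have XN: "X \<omega> \<in> space N" if "\<omega> \<in> space M" for \<omega>
    using measurable_space[OF X_meas that] by (simp add: space_N)
  have meas_N: "measure N {f \<in> space N. P f} = measure M {\<omega> \<in> space M. P (X \<omega>)}"
    if "{f \<in> space (PiM ?I (\<lambda>_. borel :: real measure)). P f} \<in> sets (PiM ?I (\<lambda>_. borel))" for P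
  proof -
    have "measure N {f \<in> space N. P f} = measure M (X -` {f \<in> space N. P f} \<inter> space M)"
      unfolding N_def using that by (subst measure_distr) auto
    also have "X -` {f \<in> space N. P f} \<inter> space M = {\<omega> \<in> space M. P (X \<omega>)}"
      using XN by auto
    finally show ?thesis .
  qed
  have ne: "?I \<noteq> {}" using n by auto
  have law: "N = PiM ?I (\<lambda>p. distr M borel (A (fst p) (snd p)))"
    using ind unfolding N_def X_def
    by (subst (asm) indep_vars_iff_distr_eq_PiM'[OF ne]) (auto simp: case_prod_unfold)
  have law1: "distr N borel (B i j) = distr M borel (A i j)" if "i < n" "j < n" for i j
    unfolding N_def using that B_meas[OF that]
    by (subst distr_distr) (auto intro!: distr_cong simp: BX)
  have indN: "N.indep_vars (\<lambda>_. borel) (\<lambda>(i, j). B i j) ?I"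
  proof (subst N.indep_vars_iff_distr_eq_PiM'[OF ne])
    show "(case p of (i, j) \<Rightarrow> B i j) \<in> borel_measurable N" if "p \<in> ?I" for p
      using that B_meas by (auto simp: N_def)
    have "distr N (PiM ?I (\<lambda>_. borel)) (\<lambda>f. \<lambda>p\<in>?I. (case p of (i, j) \<Rightarrow> B i j) f)
        = distr N N (\<lambda>f. f)"
      by (rule distr_cong)
        (auto simp: N_def B_def space_PiM PiE_def extensional_def fun_eq_iff restrict_def)
    also have "\<dots> = N" by simp
    also have "\<dots> = PiM ?I (\<lambda>p. distr N borel (case p of (i, j) \<Rightarrow> B i j))"
      unfolding law by (rule PiM_cong) (use law1 in \<open>auto simp: law\<close>)
    finally show "distr N (PiM ?I (\<lambda>_. borel)) (\<lambda>f. \<lambda>p\<in>?I. (case p of (i, j) \<Rightarrow> B i j) f)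
        = PiM ?I (\<lambda>p. distr N borel (case p of (i, j) \<Rightarrow> B i j))" .
  qed
  have intN: "integrable N (\<lambda>f. (B i j f)\<^sup>2)" if "i < n" "j < n" for i j
    unfolding N_def using that int B_meas[OF that]
    by (subst integrable_distr_eq) (auto simp: BX)
  have exN: "(\<integral>f. (B i j f)\<^sup>2 \<partial>N) = (\<integral>\<omega>. (A i j \<omega>)\<^sup>2 \<partial>M)" if "i < n" "j < n" for i j
    unfolding N_def using that B_meas[OF that]
    by (subst integral_distr) (auto simp: BX)
  have "(\<Sum>i<n. \<Sum>j<n. \<integral>f. (B i j f)\<^sup>2 \<partial>N) \<le> K * (real n)\<^sup>2"
    using sq by (simp add: exN)
  moreover have "levy_concentration N (B i j) 1 = levy_concentration M (A i j) 1"
    if "i < n" "j < n" for i j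
  proof -
    note [measurable] = B_meas[OF that]
    show ?thesis unfolding levy_concentration_def
      by (subst meas_N) (simp_all add: BX that)
  qed
  ultimately have "measure N {f \<in> space N. sigma_min n (\<lambda>i j. B i j f) \<le> \<epsilon> / sqrt (real n)}
      \<le> C * \<epsilon> + 2 * exp (- c * real n)"
    using canonical[rule_format, OF n N.prob_space_axioms indN] intN levy eps by auto
  moreover have "sigma_min n (\<lambda>i j. B i j (X \<omega>)) = sigma_min n (\<lambda>i j. A i j \<omega>)" for \<omega>
  proof -
    have "L2_set (mat_vec n (\<lambda>i j. B i j (X \<omega>)) x) {..<n} =
        L2_set (mat_vec n (\<lambda>i j. A i j \<omega>) x) {..<n}" for x
      unfolding mat_vec_def by (intro L2_set_cong) (auto simp: BX)
    then show ?thesis unfolding sigma_min_def by simp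
  qed
  moreover have "(\<lambda>f. sigma_min n (\<lambda>i j. B i j f)) \<in> borel_measurable (PiM ?I (\<lambda>_. borel))"
    by (rule sigma_min_measurable[OF n B_meas])
  ultimately show "measure M {\<omega> \<in> space M. sigma_min n (\<lambda>i j. A i j \<omega>) \<le> \<epsilon> / sqrt (real n)}
      \<le> C * \<epsilon> + 2 * exp (- c * real n)"
    by (subst (asm) meas_N) simp_all
qed

end

theory Submission
  imports Defs "HOL-Real_Asymp.Real_Asymp"
begin

text \<open>
  Let \<open>\<nu>\<close> be a unit vector orthogonal to all columns but the \<open>k\<close>-th, \<open>X\<close>. If \<open>\<bar>A x\<bar>\<close> is small for a unit vector \<open>x\<close>
  with many coordinates of order \<open>1 / sqrt n\<close>, then \<open>\<bar><X, \<nu>>\<bar>\<close> is small for many \<open>k\<close>, and \<open>\<nu>\<close> is independent of \<open>X\<close>.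
  So one has to exclude compressible \<open>x\<close> and \<open>\<nu>\<close>, and those \<open>\<nu>\<close> for which the characteristic function of
  \<open><X, \<nu>>\<close> is not small at some frequency below \<open>exp (c n)\<close>.

  Union bounds over nets are replaced by a comparison of volumes. If a kernel vector \<open>x\<close> exists, then half of
  the volume of a box around \<open>x\<close> consists of vectors \<open>y\<close> with \<open>A y\<close> small; the sides of the box are
  shortened along long columns, which with high probability costs little volume. By Fubini it suffices to
  multiply the volume of the set of exceptional \<open>y\<close> with the small ball probability of \<open>A y\<close>. If \<open>D\<close> is the first
  frequency at which the characteristic function of some row fails to be small at \<open>x\<close>, then all rows have good
  small ball estimates down to scale \<open>1 / D\<close>, whereas the vectors failing at a frequency near \<open>D\<close> fill only a fraction
  \<open>\<delta>\<^sup>n\<close> of the unit ball, with \<open>\<delta>\<close> arbitrarily small: for random \<open>y\<^sub>k\<close> the phases \<open>D y\<^sub>k x\<close> are equidistributed.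
\<close>

subsection \<open>A smoothing kernel\<close>

text \<open>With second moments only, the operator norm of \<open>A\<close> may exceed order
  \<open>sqrt n\<close>, and even the Hilbert-Schmidt norm may exceed order \<open>n\<close> with a
  probability that is not exponentially small. So \<open>A (y - x)\<close> has no usable uniform
  bound over a net. Averaging over a box removes both obstacles: the mean of the squared norm of
  \<open>A (y - x)\<close> involves only column norms and side lengths, and the loss of volume
  caused by long columns is governed by a product of \<open>n\<close> independent factors of mean
  near 1, for which first moments already give an exponential bound. The powers of \<open>D\<close>
  must balance. At scale \<open>1 / D\<close> a row contributes a probability of order
  \<open>1 / D\<close>, while dividing by the volume of a box of side of order
  \<open>1 / (D * sqrt n)\<close> costs order \<open>(D * sqrt n) ^ n\<close> up to constants. The
  powers of \<open>sqrt n\<close> are returned by the volume of the ball, the remaining constant to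
  the power \<open>n\<close> by the small volume of resonant vectors. Only boundedly many powers of
  \<open>D\<close> stay unpaid, from heavy rows, the removed row and the number of frequencies. They
  force \<open>D\<close> to stay below \<open>exp (c n)\<close> with a small
  \<open>c\<close>.\<close>

abbreviation unit_interval_measure :: "real measure" where
  "unit_interval_measure \<equiv> restrict_space lborel {0..1}"

lemma prob_space_unit_interval: "prob_space unit_interval_measure"
  by (rule prob_spaceI) (simp add: space_restrict_space emeasure_restrict_space)

lemma pi_square_le_10: "pi\<^sup>2 \<le> 10"
proof -
  have "pi \<le> 3.1416" using pi_approx by simp
  then have "pi * pi \<le> 3.1416 * 3.1416" by (intro mult_mono) auto
  then show ?thesis by (simp add: power2_eq_square)
qed

text \<open>
  Each summand is a Fejer kernel, whose transform is supported in \<open>[-1, 1]\<close>. A single one vanishes at the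
  nonzero multiples of \<open>2 pi\<close>; adding the translate by \<open>pi\<close> removes these zeros, so that the sum
  dominates a Gaussian and products of it control sums of squares.
\<close>

definition fejer_kernel :: "real \<Rightarrow> real" where
  "fejer_kernel z = (\<integral>s. 2 * (1 - s) * (cos (s * z) + cos (s * (z - pi))) \<partial>unit_interval_measure)"

lemma integral_unit_interval_FTC:
  fixes f :: "real \<Rightarrow> real"
  assumes "\<And>x. (g has_real_derivative f x) (at x)" "\<And>x. isCont f x"
  shows "(\<integral>s. f s \<partial>unit_interval_measure) = g 1 - g 0"
proof -
  have "(\<integral>s. f s \<partial>unit_interval_measure) = (\<integral>s. indicator {0..1} s *\<^sub>R f s \<partial>lborel)"
    by (subst integral_restrict_space) auto
  also have "\<dots> = g 1 - g 0"
    using integral_FTC_Icc_real[of 0 1 g f] assms by (simp add: mult.commute)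
  finally show ?thesis .
qed

lemma integrable_unit_interval:
  fixes f :: "real \<Rightarrow> real"
  assumes [measurable]: "f \<in> borel_measurable borel" and "\<And>s. 0 \<le> s \<Longrightarrow> s \<le> 1 \<Longrightarrow> \<bar>f s\<bar> \<le> C"
  shows "integrable unit_interval_measure f"
proof -
  interpret prob_space unit_interval_measure by (rule prob_space_unit_interval)
  show ?thesis
    by (rule integrable_const_bound[of _ C])
      (use assms(2) in \<open>auto simp: space_restrict_space measurable_restrict_space1\<close>)
qed

text \<open>Away from 0 this is the closed form \<open>2 * (1 - cos z) / z\<^sup>2\<close> of the
  transform of the tent function. With the factor \<open>z\<^sup>2\<close> on the left the identity
  also holds at 0, so two translates can be combined without cases.\<close>

lemma square_mult_tent_integral:
  "z\<^sup>2 * (\<integral>s. 2 * (1 - s) * cos (s * z) \<partial>unit_interval_measure) = 2 * (1 - cos z)"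
proof (cases "z = 0")
  case False
  have "(\<integral>s. 2 * (1 - s) * cos (s * z) \<partial>unit_interval_measure)
    = (2 * (1 - 1) * sin (1 * z) / z - 2 * cos (1 * z) / z\<^sup>2)
      - (2 * (1 - 0) * sin (0 * z) / z - 2 * cos (0 * z) / z\<^sup>2)"
    by (rule integral_unit_interval_FTC[where g = "\<lambda>s. 2 * (1 - s) * sin (s * z) / z - 2 * cos (s * z) / z\<^sup>2"])
      (use False in \<open>auto intro!: derivative_eq_intros continuous_intros simp: field_simps power2_eq_square\<close>)
  then show ?thesis using False by (simp add: field_simps)
qed simp

lemma tent_integral_nonneg:
  "0 \<le> (\<integral>s. 2 * (1 - s) * cos (s * z) \<partial>unit_interval_measure)" (is "0 \<le> ?I")
proof (cases "z = 0")
  case True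
  then show ?thesis
    by (intro Bochner_Integration.integral_nonneg) (auto simp: space_restrict_space)
next
  case False
  have "z\<^sup>2 * ?I \<ge> 0" unfolding square_mult_tent_integral by simp
  then show ?thesis using False by (simp add: zero_le_mult_iff)
qed

text \<open>Weighted by \<open>z\<^sup>2\<close> and \<open>(z - pi)\<^sup>2\<close>, the two
  summands add up to \<open>2 * (1 - cos z) + 2 * (1 + cos z) = 4\<close>. Hence their plain sum is
  at least 4 over any common bound \<open>m\<close> of the weights, and \<open>m\<close> can be
  taken quadratic in \<open>z\<close>.\<close>

lemma fejer_kernel_ge: "fejer_kernel z \<ge> exp (- z\<^sup>2) / 10"
proof -
  let ?f = "\<lambda>z. (\<integral>s. 2 * (1 - s) * cos (s * z) \<partial>unit_interval_measure)"
  have bnd: "\<bar>2 * (1 - s) * cos (s * w)\<bar> \<le> 2" if "0 \<le> s" "s \<le> 1" for s w :: real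
    using that mult_mono[of "2 * \<bar>1 - s\<bar>" 2 "\<bar>cos (s * w)\<bar>" 1] by (simp add: abs_mult)
  have k: "fejer_kernel z = ?f z + ?f (z - pi)"
    unfolding fejer_kernel_def distrib_left
    by (rule Bochner_Integration.integral_add) (rule integrable_unit_interval[where C = 2], simp, use bnd in blast)+
  define m where "m = 2 * z\<^sup>2 + 20"
  have "0 \<le> (z + pi)\<^sup>2" by simp
  then have m2: "(z - pi)\<^sup>2 \<le> m" unfolding m_def using pi_square_le_10 by (simp add: power2_eq_square algebra_simps)
  have m1: "z\<^sup>2 \<le> m" by (simp add: m_def)
  have "4 = z\<^sup>2 * ?f z + (z - pi)\<^sup>2 * ?f (z - pi)"
    unfolding square_mult_tent_integral by (simp add: cos_diff)
  also have "\<dots> \<le> m * ?f z + m * ?f (z - pi)"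
    by (intro add_mono mult_right_mono m1 m2 tent_integral_nonneg)
  also have "\<dots> = m * fejer_kernel z" by (simp add: k algebra_simps)
  finally have "4 / m \<le> fejer_kernel z" by (simp add: m_def pos_divide_le_eq mult.commute add_pos_nonneg add_nonneg_pos)
  moreover have "exp (- z\<^sup>2) / 10 \<le> 4 / m"
  proof -
    have "1 + z\<^sup>2 \<le> exp (z\<^sup>2)" by (rule exp_ge_add_one_self)
    then have "m \<le> 20 * exp (z\<^sup>2)" unfolding m_def using zero_le_power2[of z] by linarith
    then have "m \<le> 40 * exp (z\<^sup>2)" using exp_gt_zero[of "z\<^sup>2"] by linarith
    then show ?thesis
      by (simp add: m_def exp_minus field_simps add_pos_nonneg)
  qed
  ultimately show ?thesis by linarith
qed

lemma fejer_kernel_nonneg: "fejer_kernel z \<ge> 0"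
  using fejer_kernel_ge[of z] by (meson divide_nonneg_nonneg exp_ge_zero order_trans zero_le_numeral)

lemma fejer_kernel_le: "fejer_kernel z \<le> 4"
proof -
  interpret prob_space unit_interval_measure by (rule prob_space_unit_interval)
  have b: "\<bar>2 * (1 - s) * (cos (s * z) + cos (s * (z - pi)))\<bar> \<le> 4" if "0 \<le> s" "s \<le> 1" for s
  proof -
    have "\<bar>cos (s * z) + cos (s * (z - pi))\<bar> \<le> 2"
      using abs_cos_le_one[of "s * z"] abs_cos_le_one[of "s * (z - pi)"] by linarith
    then show ?thesis using that mult_mono[of "2 * \<bar>1 - s\<bar>" 2 "\<bar>cos (s * z) + cos (s * (z - pi))\<bar>" 2]
      by (auto simp: abs_mult)
  qed
  have "fejer_kernel z \<le> (\<integral>s. 4 \<partial>unit_interval_measure)"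
    unfolding fejer_kernel_def
  proof (rule Bochner_Integration.integral_mono)
    show "integrable unit_interval_measure (\<lambda>s. 2 * (1 - s) * (cos (s * z) + cos (s * (z - pi))))"
      by (rule integrable_unit_interval[where C = 4]) (simp, rule b)
    show "2 * (1 - s) * (cos (s * z) + cos (s * (z - pi))) \<le> 4" if "s \<in> space unit_interval_measure" for s
      using b[of s] that by (simp add: space_restrict_space)
  qed simp
  also have "\<dots> = 4" using prob_space by simp
  finally show ?thesis .
qed

lemma fejer_kernel_measurable [measurable]: "fejer_kernel \<in> borel_measurable borel"
proof -
  interpret prob_space unit_interval_measure by (rule prob_space_unit_interval)
  have m: "(\<lambda>s. s) \<in> unit_interval_measure \<rightarrow>\<^sub>M borel" by (simp add: measurable_restrict_space1)
  have 1: "snd \<in> borel \<Otimes>\<^sub>M unit_interval_measure \<rightarrow>\<^sub>M borel"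
    by (rule measurable_compose[OF measurable_snd m])
  have "(\<lambda>(z, s). 2 * (1 - s) * (cos (s * z) + cos (s * (z - pi)))) \<in> borel_measurable (borel \<Otimes>\<^sub>M unit_interval_measure)"
    unfolding case_prod_beta
    by (intro borel_measurable_times borel_measurable_add borel_measurable_diff borel_measurable_const
        1 measurable_fst measurable_compose[OF _ borel_measurable_cos])
  from borel_measurable_lebesgue_integral[OF this]
  show ?thesis by (simp add: fejer_kernel_def[abs_def])
qed

text \<open>The bound \<open>exp (- u) \<le> 1 / (1 + u)\<close> replaces the Gaussian by the
  derivative of an arctangent, at the price of a constant.\<close>

lemma integral_unit_interval_gaussian_le:
  assumes "c > 0"
  shows "(\<integral>s. exp (- c * s\<^sup>2) \<partial>unit_interval_measure) \<le> 2 / sqrt c"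
proof -
  have pos: "0 < 1 + c * s\<^sup>2" for s using assms by (simp add: add_pos_nonneg)
  have "(\<integral>s. exp (- c * s\<^sup>2) \<partial>unit_interval_measure) \<le> (\<integral>s. 1 / (1 + c * s\<^sup>2) \<partial>unit_interval_measure)"
  proof (rule integral_mono)
    show "integrable unit_interval_measure (\<lambda>s. exp (- c * s\<^sup>2))"
      by (rule integrable_unit_interval[where C = 1]) (use assms in auto)
    show "integrable unit_interval_measure (\<lambda>s. 1 / (1 + c * s\<^sup>2))"
      by (rule integrable_unit_interval[where C = 1]) (use assms pos in auto)
    show "exp (- c * s\<^sup>2) \<le> 1 / (1 + c * s\<^sup>2)" for s
      using exp_ge_add_one_self[of "c * s\<^sup>2"] pos[of s] by (simp add: exp_minus field_simps)
  qed
  also have "\<dots> = arctan (sqrt c * 1) / sqrt c - arctan (sqrt c * 0) / sqrt c"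
  proof (rule integral_unit_interval_FTC[where g = "\<lambda>s. arctan (sqrt c * s) / sqrt c"])
    fix s
    have "((\<lambda>s. arctan (sqrt c * s) / sqrt c) has_real_derivative
        inverse (1 + (sqrt c * s)\<^sup>2) * sqrt c / sqrt c) (at s)"
      by (intro DERIV_cdivide DERIV_chain2[where f = arctan] DERIV_arctan DERIV_cmult_Id)
    moreover have "inverse (1 + (sqrt c * s)\<^sup>2) * sqrt c / sqrt c = 1 / (1 + c * s\<^sup>2)"
      using assms by (simp add: power_mult_distrib inverse_eq_divide)
    ultimately show "((\<lambda>s. arctan (sqrt c * s) / sqrt c) has_real_derivative 1 / (1 + c * s\<^sup>2)) (at s)"
      by simp
    show "isCont (\<lambda>s. 1 / (1 + c * s\<^sup>2)) s"
      using pos[of s] by (intro continuous_intros) simp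
  qed
  also have "\<dots> \<le> 2 / sqrt c"
    using arctan_ubound[of "sqrt c"] pi_less_4 assms by (simp add: divide_right_mono)
  finally show ?thesis .
qed

text \<open>A cosine with a phase is the real part of a rotated character, and rotation preserves
  the modulus of the expectation. The phase is there for the translated summand of
  \<open>fejer_kernel\<close>.\<close>

lemma (in prob_space) expectation_cos_shift_le:
  assumes [measurable]: "random_variable borel Z"
  shows "\<bar>expectation (\<lambda>\<omega>. cos (t * Z \<omega> - c))\<bar> \<le> cmod (expectation (\<lambda>\<omega>. iexp (t * Z \<omega>)))"
proof -
  have int: "integrable M (\<lambda>\<omega>. iexp (t * Z \<omega>))" 
    by (rule integrable_const_bound[of _ 1]) auto
  have "expectation (\<lambda>\<omega>. cos (t * Z \<omega> - c)) = expectation (\<lambda>\<omega>. Re (cis (- c) * iexp (t * Z \<omega>)))"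
    by (intro Bochner_Integration.integral_cong refl) (simp add: cos_diff cis.ctr Re_exp Im_exp exp_eq_polar)
  also have "\<dots> = Re (cis (- c) * expectation (\<lambda>\<omega>. iexp (t * Z \<omega>)))"
    using int by (subst integral_Re) auto
  finally show ?thesis
    using abs_Re_le_cmod[of "cis (- c) * expectation (\<lambda>\<omega>. iexp (t * Z \<omega>))"] by (simp add: norm_mult)
qed

text \<open>Smoothing in the manner of Esseen: after Fubini only frequencies up to \<open>D\<close>
  occur, since the transform of the kernel has compact support. The first term has the order of a
  small ball probability at scale \<open>1 / D\<close>; \<open>\<beta>\<close> is a floor below
  which the characteristic function is not controlled.\<close>

lemma (in prob_space) expectation_fejer_kernel_le:
  assumes [measurable]: "random_variable borel Z" and "D > 0" "a > 0" "\<beta> \<ge> 0"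
    and char: "\<And>s. 0 \<le> s \<Longrightarrow> s \<le> D \<Longrightarrow> cmod ((\<integral>\<omega>. iexp (s * Z \<omega>) \<partial>M)) \<le> exp (- a * s\<^sup>2) + \<beta>"
  shows "(\<integral>\<omega>. fejer_kernel (D * Z \<omega>) \<partial>M) \<le> 8 / (sqrt a * D) + 4 * \<beta>"
proof -
  note ic = integrable_const_bound and ce = expectation_cos_shift_le[OF assms(1)]
  interpret U: prob_space unit_interval_measure by (rule prob_space_unit_interval)
  interpret pair_prob_space M unit_interval_measure ..
  let ?h = "\<lambda>\<omega> s. 2 * (1 - s) * (cos (s * (D * Z \<omega>)) + cos (s * (D * Z \<omega> - pi)))"
  have id_m [measurable]: "(\<lambda>s. s) \<in> unit_interval_measure \<rightarrow>\<^sub>M borel" by (simp add: measurable_restrict_space1)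
  have b: "\<bar>?h \<omega> s\<bar> \<le> 4" if "0 \<le> s" "s \<le> 1" for s \<omega>
  proof -
    have "\<bar>cos (s * (D * Z \<omega>)) + cos (s * (D * Z \<omega> - pi))\<bar> \<le> 2"
      using abs_cos_le_one[of "s * (D * Z \<omega>)"] abs_cos_le_one[of "s * (D * Z \<omega> - pi)"] by linarith
    then show ?thesis
      using that mult_mono[of "2 * \<bar>1 - s\<bar>" 2 "\<bar>cos (s * (D * Z \<omega>)) + cos (s * (D * Z \<omega> - pi))\<bar>" 2]
      by (auto simp: abs_mult)
  qed
  have hm: "(\<lambda>(\<omega>, s). ?h \<omega> s) \<in> borel_measurable (M \<Otimes>\<^sub>M unit_interval_measure)"
  proof -
    have 1: "snd \<in> M \<Otimes>\<^sub>M unit_interval_measure \<rightarrow>\<^sub>M borel"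
      by (rule measurable_compose[OF measurable_snd id_m])
    have 2: "(\<lambda>x. Z (fst x)) \<in> borel_measurable (M \<Otimes>\<^sub>M unit_interval_measure)" by measurable
    show ?thesis unfolding case_prod_beta
      by (intro borel_measurable_times borel_measurable_add borel_measurable_diff
          borel_measurable_const 1 2 measurable_compose[OF _ borel_measurable_cos])
  qed
  have int: "integrable (M \<Otimes>\<^sub>M unit_interval_measure) (\<lambda>(\<omega>, s). ?h \<omega> s)"
  proof (rule P.integrable_const_bound[of _ 4, OF AE_I2 hm])
    fix x assume "x \<in> space (M \<Otimes>\<^sub>M unit_interval_measure)"
    then show "norm (case x of (\<omega>, s) \<Rightarrow> ?h \<omega> s) \<le> 4"
      using b[of "snd x" "fst x"] by (auto simp: space_pair_measure space_restrict_space case_prod_beta)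
  qed
  have "(\<integral>\<omega>. fejer_kernel (D * Z \<omega>) \<partial>M) = (\<integral>s. (\<integral>\<omega>. ?h \<omega> s \<partial>M) \<partial>unit_interval_measure)"
    unfolding fejer_kernel_def by (rule Fubini_integral[OF int, symmetric])
  also have "\<dots> \<le> (\<integral>s. 4 * exp (- (a * D\<^sup>2) * s\<^sup>2) + 4 * \<beta> \<partial>unit_interval_measure)"
  proof (rule integral_mono)
    show "integrable unit_interval_measure (\<lambda>s. (\<integral>\<omega>. ?h \<omega> s \<partial>M))"
      by (rule integrable_snd[OF int])
    have "integrable unit_interval_measure (\<lambda>s. exp (- (a * D\<^sup>2) * s\<^sup>2))"
      by (rule integrable_unit_interval[where C = 1]) (use assms in auto)
    then show "integrable unit_interval_measure (\<lambda>s. 4 * exp (- (a * D\<^sup>2) * s\<^sup>2) + 4 * \<beta>)" by simp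
    fix s assume "s \<in> space unit_interval_measure"
    then have s: "0 \<le> s" "s \<le> 1" by (auto simp: space_restrict_space)
    have ci: "integrable M (\<lambda>\<omega>. cos ((s * D) * Z \<omega> - c))" for c
      by (rule ic[of _ 1]) auto
    have "(\<integral>\<omega>. ?h \<omega> s \<partial>M)
      = (\<integral>\<omega>. 2 * (1 - s) * (cos ((s * D) * Z \<omega> - 0) + cos ((s * D) * Z \<omega> - s * pi)) \<partial>M)"
      by (rule Bochner_Integration.integral_cong) (simp_all add: right_diff_distrib mult.assoc)
    also have "\<dots> = 2 * (1 - s) * ((\<integral>\<omega>. cos ((s * D) * Z \<omega> - 0) \<partial>M) + (\<integral>\<omega>. cos ((s * D) * Z \<omega> - s * pi) \<partial>M))"
      by (simp only: integral_mult_right_zero Bochner_Integration.integral_add[OF ci ci])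
    also have "\<dots> \<le> 2 * (1 - s) * (2 * (exp (- a * (s * D)\<^sup>2) + \<beta>))"
    proof -
      have "s * D \<le> D" using s assms(2) by (simp add: mult_left_le_one_le)
      then have "cmod ((\<integral>\<omega>. iexp ((s * D) * Z \<omega>) \<partial>M)) \<le> exp (- a * (s * D)\<^sup>2) + \<beta>"
        using s assms(2) by (intro char) auto
      then show ?thesis
        using ce[of "s * D" 0]
          ce[of "s * D" "s * pi"] s
        by (intro mult_left_mono) auto
    qed
    also have "\<dots> \<le> 2 * 1 * (2 * (exp (- a * (s * D)\<^sup>2) + \<beta>))"
      using s assms(4) by (intro mult_right_mono mult_left_mono) auto
    also have "2 * 1 * (2 * (exp (- a * (s * D)\<^sup>2) + \<beta>)) = 4 * exp (- (a * D\<^sup>2) * s\<^sup>2) + 4 * \<beta>"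
      by (simp add: power_mult_distrib)
    finally show "(\<integral>\<omega>. ?h \<omega> s \<partial>M) \<le> 4 * exp (- (a * D\<^sup>2) * s\<^sup>2) + 4 * \<beta>" .
  qed
  also have "\<dots> = 4 * (\<integral>s. exp (- (a * D\<^sup>2) * s\<^sup>2) \<partial>unit_interval_measure) + 4 * \<beta>"
  proof -
    have "integrable unit_interval_measure (\<lambda>s. exp (- (a * D\<^sup>2) * s\<^sup>2))"
      by (rule integrable_unit_interval[where C = 1]) (use assms in auto)
    then have "(\<integral>s. 4 * exp (- (a * D\<^sup>2) * s\<^sup>2) + 4 * \<beta> \<partial>unit_interval_measure)
      = 4 * (\<integral>s. exp (- (a * D\<^sup>2) * s\<^sup>2) \<partial>unit_interval_measure) + (\<integral>s. 4 * \<beta> \<partial>unit_interval_measure)"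
      by (subst Bochner_Integration.integral_add) (simp_all only: integrable_mult_right integral_mult_right_zero U.integrable_const)
    also have "(\<integral>s. 4 * \<beta> \<partial>unit_interval_measure) = 4 * \<beta>"
      by (simp only: lebesgue_integral_const U.prob_space scaleR_one)
    finally show ?thesis .
  qed
  also have "\<dots> \<le> 4 * (2 / sqrt (a * D\<^sup>2)) + 4 * \<beta>"
  proof -
    have "0 < a * D\<^sup>2" using assms(2,3) by simp
    from integral_unit_interval_gaussian_le[OF this] show ?thesis by linarith
  qed
  also have "sqrt (a * D\<^sup>2) = sqrt a * D" using assms by (simp add: real_sqrt_mult)
  finally show ?thesis by simp
qed

subsection \<open>Oscillation of a probability law\<close>

lemma sin_ge_cubic:
  assumes "0 \<le> (x::real)" shows "x - x ^ 3 / 6 \<le> sin x"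
proof (cases "x = 0")
  case False
  then obtain t where "sin x = (\<Sum>m<3. sin_coeff m * x ^ m) + (sin (t + 1/2 * real 3 * pi) / fact 3) * x ^ 3"
    using Maclaurin_sin_expansion[of x 3] by blast
  moreover have "(\<Sum>m<3. sin_coeff m * x ^ m) = x"
    by (simp add: numeral_3_eq_3 sin_coeff_def)
  moreover have "- (x ^ 3 / 6) \<le> (sin (t + 1/2 * real 3 * pi) / fact 3) * x ^ 3"
  proof -
    have "-1 * x ^ 3 \<le> sin (t + 1/2 * real 3 * pi) * x ^ 3"
      using assms by (intro mult_right_mono) auto
    then show ?thesis by (simp add: fact_numeral)
  qed
  ultimately show ?thesis by linarith
qed simp

lemma one_minus_cos: "1 - cos (x::real) = 2 * (sin (x / 2))\<^sup>2"
  using cos_double_sin[of "x / 2"] by simp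

lemma one_minus_cos_ge:
  assumes "\<bar>x\<bar> \<le> pi" shows "x\<^sup>2 / 6 \<le> 1 - cos x"
proof -
  define u where "u = \<bar>x\<bar> / 2"
  have u: "0 \<le> u" "u \<le> pi / 2" using assms by (auto simp: u_def)
  have "u\<^sup>2 \<le> (pi / 2)\<^sup>2" by (rule power_mono) (use u in auto)
  then have u2: "u\<^sup>2 \<le> 5 / 2" using pi_square_le_10 by (simp add: power_divide)
  \<comment> \<open>The constant 1/6 is just within reach:
    \<open>2 * (7 / 12)\<^sup>2 = 98 / 144\<close>, whereas \<open>x\<^sup>2 / 6\<close> is
    \<open>96 / 144 * u\<^sup>2\<close>.\<close>
  have "u * (7 / 12) \<le> u * (1 - u\<^sup>2 / 6)" using u u2 by (intro mult_left_mono) auto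
  also have "\<dots> = u - u ^ 3 / 6" by (simp add: power2_eq_square power3_eq_cube algebra_simps)
  also have "\<dots> \<le> sin u" by (rule sin_ge_cubic) (rule u)
  finally have "(u * (7 / 12))\<^sup>2 \<le> (sin u)\<^sup>2" using u by (intro power_mono) auto
  moreover have "1 - cos x = 2 * (sin u)\<^sup>2" unfolding u_def one_minus_cos[of x] by (simp add: abs_if)
  moreover have "x\<^sup>2 = 4 * u\<^sup>2" by (simp add: u_def power_divide)
  moreover have "(u * (7 / 12))\<^sup>2 = u\<^sup>2 * 49 / 144" by (simp add: power_mult_distrib power_divide)
  ultimately show ?thesis using zero_le_power2[of "sin u"] by linarith
qed

lemma one_minus_cos_le: "1 - cos (x::real) \<le> x\<^sup>2 / 2"
proof -
  have "\<bar>sin (x / 2)\<bar> \<le> \<bar>x / 2\<bar>" by (rule abs_sin_x_le_abs_x)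
  then have "(sin (x / 2))\<^sup>2 \<le> (x / 2)\<^sup>2" by (rule abs_le_square_iff[THEN iffD1])
  then show ?thesis by (simp add: one_minus_cos power_divide)
qed

text \<open>Up to a constant, the square root of \<open>1 - cos x\<close> is
  \<open>\<bar>sin (x / 2)\<bar>\<close>, which is subadditive. Squaring costs the factor 2.\<close>

lemma one_minus_cos_add_le: "1 - cos (x + y) \<le> 2 * (1 - cos x) + 2 * (1 - cos (y::real))"
proof -
  have "\<bar>sin (x / 2 + y / 2)\<bar> \<le> \<bar>sin (x / 2)\<bar> * \<bar>cos (y / 2)\<bar> + \<bar>cos (x / 2)\<bar> * \<bar>sin (y / 2)\<bar>"
    unfolding sin_add by (rule order_trans[OF abs_triangle_ineq]) (simp add: abs_mult)
  also have "\<dots> \<le> \<bar>sin (x / 2)\<bar> * 1 + 1 * \<bar>sin (y / 2)\<bar>"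
    by (intro add_mono mult_mono) auto
  finally have "\<bar>sin (x / 2 + y / 2)\<bar> \<le> \<bar>\<bar>sin (x / 2)\<bar> + \<bar>sin (y / 2)\<bar>\<bar>" by simp
  then have "(sin (x / 2 + y / 2))\<^sup>2 \<le> (\<bar>sin (x / 2)\<bar> + \<bar>sin (y / 2)\<bar>)\<^sup>2"
    by (rule abs_le_square_iff[THEN iffD1])
  also have "\<dots> \<le> 2 * (sin (x / 2))\<^sup>2 + 2 * (sin (y / 2))\<^sup>2"
    using zero_le_power2[of "\<bar>sin (x / 2)\<bar> - \<bar>sin (y / 2)\<bar>"] by (simp add: power2_eq_square algebra_simps)
  finally show ?thesis by (simp add: one_minus_cos add_divide_distrib)
qed

text \<open>A single frequency may hit a full period, but the average over frequencies in
  \<open>[0, 1]\<close> stays bounded below. Up to half a period the quadratic bound applies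
  throughout; beyond it the integral is \<open>1 - sin u / u\<close>, which is at least 2/3.\<close>

lemma tent_average_ge:
  "min 1 (u\<^sup>2) / 18 \<le> (\<integral>s. 1 - cos (s * u) \<partial>unit_interval_measure)"
proof (cases "\<bar>u\<bar> \<le> pi")
  case True
  have b: "\<bar>s * u\<bar> \<le> \<bar>u\<bar>" if "0 \<le> s" "s \<le> 1" for s
    using that by (simp add: abs_mult mult_left_le_one_le)
  have "min 1 (u\<^sup>2) / 18 \<le> (\<lambda>s. s ^ 3 * u\<^sup>2 / 18) 1 - (\<lambda>s. s ^ 3 * u\<^sup>2 / 18) 0"
    by simp
  also have "\<dots> = (\<integral>s. (s * u)\<^sup>2 / 6 \<partial>unit_interval_measure)"
    by (rule integral_unit_interval_FTC[symmetric])
      (auto intro!: derivative_eq_intros continuous_intros simp: power_mult_distrib)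
  also have "\<dots> \<le> (\<integral>s. 1 - cos (s * u) \<partial>unit_interval_measure)"
  proof (rule Bochner_Integration.integral_mono)
    show "integrable unit_interval_measure (\<lambda>s. (s * u)\<^sup>2 / 6)"
    proof (rule integrable_unit_interval[where C = "u\<^sup>2"])
      fix s :: real assume "0 \<le> s" "s \<le> 1"
      then have "(s * u)\<^sup>2 \<le> u\<^sup>2" using abs_le_square_iff[THEN iffD1, OF b] by simp
      moreover have "\<bar>(s * u)\<^sup>2 / 6\<bar> = (s * u)\<^sup>2 / 6" by simp
      moreover have "0 \<le> (s * u)\<^sup>2" by simp
      ultimately show "\<bar>(s * u)\<^sup>2 / 6\<bar> \<le> u\<^sup>2" by linarith
    qed simp
    show "integrable unit_interval_measure (\<lambda>s. 1 - cos (s * u))"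
    proof (rule integrable_unit_interval[where C = 2])
      show "\<bar>1 - cos (s * u)\<bar> \<le> 2" for s using abs_cos_le_one[of "s * u"] by linarith
    qed simp
    show "(s * u)\<^sup>2 / 6 \<le> 1 - cos (s * u)" if "s \<in> space unit_interval_measure" for s
      using that b[of s] True by (intro one_minus_cos_ge) (auto simp: space_restrict_space)
  qed
  finally show ?thesis .
next
  case False
  then have u: "\<bar>u\<bar> \<ge> 3" "u \<noteq> 0" using pi_gt3 by auto
  have "(\<integral>s. 1 - cos (s * u) \<partial>unit_interval_measure) = (1 - sin (1 * u) / u) - (0 - sin (0 * u) / u)"
    by (rule integral_unit_interval_FTC[where g = "\<lambda>s. s - sin (s * u) / u"])
      (use u in \<open>auto intro!: derivative_eq_intros continuous_intros\<close>)
  moreover have "sin u / u \<le> 1 / 3"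
  proof -
    have "sin u / u \<le> \<bar>sin u\<bar> / \<bar>u\<bar>" by (metis abs_divide abs_ge_self)
    also have "\<dots> \<le> 1 / 3" using u by (intro frac_le) auto
    finally show ?thesis .
  qed
  moreover have "min 1 (u\<^sup>2) / 18 \<le> 1 / 18" by simp
  ultimately show ?thesis by simp
qed

text \<open>For the law of the difference of two independent copies of \<open>Z\<close> this is one
  minus the squared modulus of the characteristic function of \<open>Z\<close>. Decay of
  characteristic functions thus becomes a lower bound on the integral of a nonnegative
  function.\<close>

definition osc :: "real measure \<Rightarrow> real \<Rightarrow> real" where
  "osc N \<theta> = (\<integral>x. 1 - cos (\<theta> * x) \<partial>N)"

section \<open>Bounds on the oscillation at a fixed and at an averaged frequency\<close>

context real_distribution
begin

lemma measurable_iff_borel: "f \<in> borel_measurable M \<longleftrightarrow> f \<in> borel_measurable borel"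
  using events_eq_borel measurable_cong_sets by blast

lemma abs_one_minus_cos_le: "\<bar>1 - cos (x::real)\<bar> \<le> 2"
  using abs_cos_le_one[of x] by linarith

lemma integrable_one_minus_cos: "integrable M (\<lambda>x. 1 - cos (\<theta> * x))"
  by (rule integrable_const_bound[of _ 2]) (auto simp: abs_one_minus_cos_le measurable_iff_borel)

lemma osc_nonneg: "0 \<le> osc M \<theta>"
  unfolding osc_def by (rule Bochner_Integration.integral_nonneg) simp

lemma osc_le_2: "osc M \<theta> \<le> 2"
proof -
  have "osc M \<theta> \<le> (\<integral>x. 2 \<partial>M)" unfolding osc_def
  proof (rule Bochner_Integration.integral_mono[OF integrable_one_minus_cos])
    show "1 - cos (\<theta> * x) \<le> 2" for x using abs_one_minus_cos_le[of "\<theta> * x"] by linarith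
  qed simp
  then show ?thesis using prob_space by simp
qed

lemma osc_measurable [measurable]: "osc M \<in> borel_measurable borel"
proof -
  have "(\<lambda>(\<theta>, x). 1 - cos (\<theta> * x)) \<in> borel_measurable (borel \<Otimes>\<^sub>M M)"
    by (simp cong: measurable_cong_sets sets_pair_measure_cong add: events_eq_borel)
  from borel_measurable_lebesgue_integral[OF this]
  show ?thesis by (simp add: osc_def[abs_def])
qed

lemma osc_add_le: "osc M (\<theta> + \<theta>') \<le> 2 * osc M \<theta> + 2 * osc M \<theta>'"
proof -
  have "osc M (\<theta> + \<theta>') \<le> (\<integral>x. 2 * (1 - cos (\<theta> * x)) + 2 * (1 - cos (\<theta>' * x)) \<partial>M)"
    unfolding osc_def
  proof (rule Bochner_Integration.integral_mono[OF integrable_one_minus_cos])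
    show "integrable M (\<lambda>x. 2 * (1 - cos (\<theta> * x)) + 2 * (1 - cos (\<theta>' * x)))"
      by (intro Bochner_Integration.integrable_add integrable_mult_right integrable_one_minus_cos)
    show "1 - cos ((\<theta> + \<theta>') * x) \<le> 2 * (1 - cos (\<theta> * x)) + 2 * (1 - cos (\<theta>' * x))" for x
      using one_minus_cos_add_le[of "\<theta> * x" "\<theta>' * x"] by (simp add: distrib_right)
  qed
  also have "\<dots> = 2 * osc M \<theta> + 2 * osc M \<theta>'"
    unfolding osc_def
    by (simp only: Bochner_Integration.integral_add integrable_mult_right integrable_one_minus_cos integral_mult_right_zero)
  finally show ?thesis .
qed

lemma osc_le_second_moment:
  assumes "integrable M (\<lambda>x. x\<^sup>2)"
  shows "osc M \<theta> \<le> \<theta>\<^sup>2 / 2 * (\<integral>x. x\<^sup>2 \<partial>M)"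
proof -
  have "osc M \<theta> \<le> (\<integral>x. \<theta>\<^sup>2 / 2 * x\<^sup>2 \<partial>M)"
    unfolding osc_def
  proof (rule Bochner_Integration.integral_mono[OF integrable_one_minus_cos])
    show "1 - cos (\<theta> * x) \<le> \<theta>\<^sup>2 / 2 * x\<^sup>2" for x
      using one_minus_cos_le[of "\<theta> * x"] by (simp add: power_mult_distrib)
  qed (use assms in simp)
  then show ?thesis by simp
qed

text \<open>While the phase stays within half a period, \<open>1 - cos\<close> has a pointwise
  quadratic lower bound, so mass between 1 and \<open>T\<close> controls the oscillation at the
  given frequency.\<close>

lemma osc_ge_det:
  assumes "p \<le> prob {x. 1 \<le> \<bar>x\<bar> \<and> \<bar>x\<bar> \<le> T}" and "\<bar>\<theta>\<bar> * T \<le> pi"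
  shows "p * \<theta>\<^sup>2 / 6 \<le> osc M \<theta>"
proof -
  let ?A = "{x. 1 \<le> \<bar>x\<bar> \<and> \<bar>x\<bar> \<le> T}"
  have A: "?A \<in> events" by (simp add: events_eq_borel)
  have "p * \<theta>\<^sup>2 / 6 \<le> prob ?A * (\<theta>\<^sup>2 / 6)" using mult_right_mono[OF assms(1), of "\<theta>\<^sup>2 / 6"] by simp
  also have "\<dots> = (\<integral>x. indicator ?A x * (\<theta>\<^sup>2 / 6) \<partial>M)" using A by simp
  also have "\<dots> \<le> osc M \<theta>"
    unfolding osc_def
  proof (rule Bochner_Integration.integral_mono[OF _ integrable_one_minus_cos])
    show "integrable M (\<lambda>x. indicator ?A x * (\<theta>\<^sup>2 / 6))"
      using A by (intro integrable_mult_left) (simp add: emeasure_eq_measure)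
    show "indicator ?A x * (\<theta>\<^sup>2 / 6) \<le> 1 - cos (\<theta> * x)" for x
    proof (cases "x \<in> ?A")
      case True
      have "\<bar>\<theta> * x\<bar> \<le> \<bar>\<theta>\<bar> * T" using True by (auto simp: abs_mult intro: mult_left_mono)
      then have "\<bar>\<theta> * x\<bar> \<le> pi" using assms(2) by linarith
      then have "(\<theta> * x)\<^sup>2 / 6 \<le> 1 - cos (\<theta> * x)" by (rule one_minus_cos_ge)
      moreover have "\<theta>\<^sup>2 * 1 \<le> \<theta>\<^sup>2 * x\<^sup>2"
        using True by (intro mult_left_mono) (auto simp: abs_le_square_iff[of 1, simplified])
      ultimately show ?thesis using True by (simp add: power_mult_distrib)
    qed auto
  qed
  finally show ?thesis .
qed

text \<open>Large values of \<open>x\<close> may wrap around the circle at a given frequency.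
  Averaging over the frequency bounds the contribution of each of them from below.\<close>

lemma osc_average_ge:
  assumes "p \<le> prob {x. 1 \<le> \<bar>x\<bar>}"
  shows "p * min 1 (y\<^sup>2) / 18 \<le> (\<integral>s. osc M (s * y) \<partial>unit_interval_measure)"
proof -
  interpret U: prob_space unit_interval_measure by (rule prob_space_unit_interval)
  interpret UM: pair_prob_space unit_interval_measure M ..
  let ?A = "{x. 1 \<le> \<bar>x\<bar>}"
  have A: "?A \<in> sets M" by (simp add: events_eq_borel)
  have m: "(\<lambda>(s, x). 1 - cos (s * y * x)) \<in> borel_measurable (unit_interval_measure \<Otimes>\<^sub>M M)"
  proof -
    have "(\<lambda>s. s) \<in> unit_interval_measure \<rightarrow>\<^sub>M borel" by (simp add: measurable_restrict_space1)
    then have 1: "fst \<in> unit_interval_measure \<Otimes>\<^sub>M M \<rightarrow>\<^sub>M borel"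
      by (rule measurable_compose[OF measurable_fst])
    have "(\<lambda>s. s) \<in> M \<rightarrow>\<^sub>M borel" by (simp add: measurable_iff_borel)
    then have 2: "snd \<in> unit_interval_measure \<Otimes>\<^sub>M M \<rightarrow>\<^sub>M borel"
      by (rule measurable_compose[OF measurable_snd])
    show ?thesis unfolding case_prod_beta
      by (intro borel_measurable_times borel_measurable_diff borel_measurable_const 1 2
          measurable_compose[OF _ borel_measurable_cos])
  qed
  have int: "integrable (unit_interval_measure \<Otimes>\<^sub>M M) (\<lambda>(s, x). 1 - cos (s * y * x))"
    by (rule UM.P.integrable_const_bound[of _ 2, OF AE_I2 m]) (auto simp: abs_one_minus_cos_le)
  have "p * min 1 (y\<^sup>2) / 18 \<le> prob ?A * (min 1 (y\<^sup>2) / 18)"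
    using mult_right_mono[OF assms, of "min 1 (y\<^sup>2) / 18"] by simp
  also have "\<dots> = (\<integral>x. indicator ?A x * (min 1 (y\<^sup>2) / 18) \<partial>M)" using A by simp
  also have "\<dots> \<le> (\<integral>x. (\<integral>s. 1 - cos (s * y * x) \<partial>unit_interval_measure) \<partial>M)"
  proof (rule Bochner_Integration.integral_mono)
    show "integrable M (\<lambda>x. indicator ?A x * (min 1 (y\<^sup>2) / 18))"
      using A by (intro integrable_mult_left) (simp add: emeasure_eq_measure)
    show "integrable M (\<lambda>x. \<integral>s. 1 - cos (s * y * x) \<partial>unit_interval_measure)"
      by (rule UM.integrable_snd[OF int])
    show "indicator ?A x * (min 1 (y\<^sup>2) / 18) \<le> (\<integral>s. 1 - cos (s * y * x) \<partial>unit_interval_measure)" for x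
    proof -
      have "indicator ?A x * (min 1 (y\<^sup>2) / 18) \<le> min 1 ((y * x)\<^sup>2) / 18"
      proof (cases "x \<in> ?A")
        case True
        have "y\<^sup>2 * 1 \<le> y\<^sup>2 * x\<^sup>2"
          using True by (intro mult_left_mono) (auto simp: abs_le_square_iff[of 1, simplified])
        then show ?thesis using True by (simp add: power_mult_distrib)
      qed auto
      also have "\<dots> \<le> (\<integral>s. 1 - cos (s * (y * x)) \<partial>unit_interval_measure)" by (rule tent_average_ge)
      finally show ?thesis by (simp add: mult.assoc)
    qed
  qed
  also have "\<dots> = (\<integral>s. osc M (s * y) \<partial>unit_interval_measure)"
    unfolding osc_def by (rule UM.Fubini_integral[OF int])
  finally show ?thesis .
qed

end

text \<open>The condition confines \<open>v * y\<close> to a neighbourhood of radius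
  \<open>w = sqrt (6 * r)\<close> of the multiples of a full period. At most
  \<open>v * l + 3\<close> of these matter, and each contributes length
  \<open>2 * w / v\<close>.\<close>

lemma emeasure_cos_near_one:
  fixes v r l :: real
  assumes "0 < v" "0 \<le> l" "0 < r"
  shows "emeasure lborel {y. \<bar>y\<bar> \<le> l \<and> 1 - cos (v * y) < r} \<le> ennreal (2 * sqrt (6 * r) * (l + 3 / v))"
proof -
  define w where "w = sqrt (6 * r)"
  have w: "w > 0" using assms by (simp add: w_def)
  define J where "J = \<lfloor>v * l / (2 * pi) + 1 / 2\<rfloor>"
  have J0: "0 \<le> J" unfolding J_def using assms by (simp add: le_floor_iff add_nonneg_nonneg)
  have JB: "real_of_int J \<le> v * l / (2 * pi) + 1 / 2" unfolding J_def by linarith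
  let ?U = "\<Union>j\<in>{-J..J}. {(2 * pi * real_of_int j - w) / v .. (2 * pi * real_of_int j + w) / v}"
  have "{y. \<bar>y\<bar> \<le> l \<and> 1 - cos (v * y) < r} \<subseteq> ?U"
  proof (rule subsetI)
    fix y assume "y \<in> {y. \<bar>y\<bar> \<le> l \<and> 1 - cos (v * y) < r}"
    then have y: "\<bar>y\<bar> \<le> l" "1 - cos (v * y) < r" by auto
    define j where "j = round (v * y / (2 * pi))"
    define z where "z = v * y - 2 * pi * real_of_int j"
    have "\<bar>real_of_int j - v * y / (2 * pi)\<bar> \<le> 1 / 2"
      unfolding j_def by (rule of_int_round_abs_le)
    then have a: "real_of_int j \<le> v * y / (2 * pi) + 1 / 2" "- real_of_int j \<le> - (v * y / (2 * pi)) + 1 / 2" by linarith+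
    have b: "v * y / (2 * pi) \<le> v * l / (2 * pi)" "- (v * y / (2 * pi)) \<le> v * l / (2 * pi)"
    proof -
      have "v * y \<le> v * l" "v * (- y) \<le> v * l" using y(1) assms(1) by (intro mult_left_mono; simp)+
      then have "v * y / (2 * pi) \<le> v * l / (2 * pi)" "v * (- y) / (2 * pi) \<le> v * l / (2 * pi)"
        by (intro divide_right_mono; simp)+
      then show "v * y / (2 * pi) \<le> v * l / (2 * pi)" "- (v * y / (2 * pi)) \<le> v * l / (2 * pi)" by simp_all
    qed
    have "j \<le> J" "- j \<le> J" unfolding J_def le_floor_iff using a b by simp_all
    then have jJ: "j \<in> {-J..J}" by auto
    have "\<bar>z\<bar> = 2 * pi * \<bar>real_of_int j - v * y / (2 * pi)\<bar>"
    proof -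
      have "z = - (2 * pi * (real_of_int j - v * y / (2 * pi)))" by (simp add: z_def field_simps)
      then show ?thesis by (simp only: abs_minus_cancel abs_mult) simp
    qed
    also have "\<dots> \<le> 2 * pi * (1 / 2)"
      by (intro mult_left_mono) (use \<open>\<bar>real_of_int j - v * y / (2 * pi)\<bar> \<le> 1 / 2\<close> in auto)
    finally have "z\<^sup>2 / 6 \<le> 1 - cos z" by (intro one_minus_cos_ge) simp
    moreover have "cos z = cos (v * y)"
      unfolding z_def using cos_int_2pin[of j] sin_int_2pin[of j] by (simp add: cos_diff mult_ac)
    ultimately have "z\<^sup>2 < 6 * r" using y(2) by simp
    then have "\<bar>z\<bar> < w" unfolding w_def using real_less_rsqrt by fastforce
    then have "y \<in> {(2 * pi * real_of_int j - w) / v .. (2 * pi * real_of_int j + w) / v}"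
      using assms(1) by (auto simp: z_def field_simps)
    then show "y \<in> ?U" using jJ by blast
  qed
  then have "emeasure lborel {y. \<bar>y\<bar> \<le> l \<and> 1 - cos (v * y) < r} \<le> emeasure lborel ?U"
    by (rule emeasure_mono) auto
  also have "\<dots> \<le> (\<Sum>j\<in>{-J..J}. emeasure lborel {(2 * pi * real_of_int j - w) / v .. (2 * pi * real_of_int j + w) / v})"
    by (rule emeasure_subadditive_finite) auto
  also have "\<dots> = (\<Sum>j\<in>{-J..J}. ennreal (2 * w / v))"
  proof (rule sum.cong[OF refl])
    fix j
    have "(2 * pi * real_of_int j - w) / v \<le> (2 * pi * real_of_int j + w) / v"
      using assms w by (intro divide_right_mono) auto
    then show "emeasure lborel {(2 * pi * real_of_int j - w) / v .. (2 * pi * real_of_int j + w) / v} = ennreal (2 * w / v)"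
      using assms by (simp add: field_simps diff_divide_distrib[symmetric])
  qed
  also have "\<dots> = ennreal ((2 * real_of_int J + 1) * (2 * w / v))"
    using J0 w assms by (subst sum_ennreal) (auto simp: of_nat_nat)
  also have "\<dots> \<le> ennreal (2 * w * (l + 3 / v))"
  proof (rule ennreal_leI)
    have "v * l / (2 * pi) \<le> v * l / 2" using pi_gt3 assms by (intro divide_left_mono) auto
    then have "2 * real_of_int J + 1 \<le> v * l + 3" using JB by linarith
    then have "(2 * real_of_int J + 1) * (2 * w / v) \<le> (v * l + 3) * (2 * w / v)"
      using w assms by (intro mult_right_mono) auto
    also have "\<dots> = 2 * w * (l + 3 / v)" using assms by (simp add: field_simps)
    finally show "(2 * real_of_int J + 1) * (2 * w / v) \<le> 2 * w * (l + 3 / v)" .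
  qed
  finally show ?thesis by (simp add: w_def)
qed

context real_distribution
begin

text \<open>This is the equidistribution of phases. If the oscillation at \<open>s * y\<close> is
  small, then by Markov's inequality mass at least \<open>p / 2\<close> beyond \<open>T\<close> has
  its phase near a full period. After exchanging the integrals it suffices that for each fixed
  \<open>x\<close> beyond \<open>T\<close> few \<open>y\<close> have this property.\<close>

lemma osc_small_volume:
  assumes p: "0 < p" "p \<le> prob {x. T < \<bar>x\<bar>}" and "0 < s" "0 < T" "0 \<le> l" "0 < r"
  shows "emeasure lborel {y. \<bar>y\<bar> \<le> l \<and> osc M (s * y) \<le> r * p / 2}
    \<le> ennreal (4 * sqrt (6 * r) / p * (l + 3 / (s * T)))"
proof -
  note bm = borel_measurable_nn_integral
  interpret LM: pair_sigma_finite lborel M ..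
  let ?G = "{y. \<bar>y\<bar> \<le> l \<and> osc M (s * y) \<le> r * p / 2}"
  let ?S = "\<lambda>x. {y. \<bar>y\<bar> \<le> l \<and> 1 - cos (s * \<bar>x\<bar> * y) < r}"
  have cosx: "cos (s * \<bar>x\<bar> * y) = cos (s * y * x)" for x y
    by (cases "x \<ge> 0") (auto simp: mult_ac)
  have Sx: "y \<in> ?S x \<longleftrightarrow> \<bar>y\<bar> \<le> l \<and> 1 - cos (s * y * x) < r" for x y
    by (simp add: cosx)
  have [measurable_cong]: "sets M = sets borel" by (rule events_eq_borel)
  have key: "indicator ?G y \<le> ennreal (2 / p) * (\<integral>\<^sup>+x. indicator {x. T < \<bar>x\<bar>} x * indicator (?S x) y \<partial>M)" for y
  proof (cases "y \<in> ?G")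
    case True
    let ?B = "{x. T < \<bar>x\<bar> \<and> 1 - cos (s * y * x) \<ge> r}" and ?C = "{x. T < \<bar>x\<bar> \<and> 1 - cos (s * y * x) < r}"
    have sB: "?B \<in> events" "?C \<in> events" unfolding events_eq_borel by measurable
    have "r * prob ?B = (\<integral>x. r * indicator ?B x \<partial>M)" using sB by simp
    also have "\<dots> \<le> osc M (s * y)"
      unfolding osc_def
    proof (rule Bochner_Integration.integral_mono[OF _ integrable_one_minus_cos])
      show "integrable M (\<lambda>x. r * indicator ?B x)" using sB by (simp add: emeasure_eq_measure)
      show "r * indicator ?B x \<le> 1 - cos (s * y * x)" for x by (cases "x \<in> ?B") auto
    qed
    also have "\<dots> \<le> r * (p / 2)" using True by simp
    finally have "prob ?B \<le> p / 2" using assms by simp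
    moreover have "prob {x. T < \<bar>x\<bar>} = prob ?B + prob ?C"
      by (subst finite_measure_Union[symmetric]) (use sB in \<open>auto intro!: arg_cong[where f = prob]\<close>)
    ultimately have "1 \<le> 2 / p * prob ?C" using p by (simp add: field_simps)
    then have "1 \<le> ennreal (2 / p * prob ?C)" using ennreal_leI by fastforce
    also have "\<dots> = ennreal (2 / p) * emeasure M ?C" 
      unfolding emeasure_eq_measure by (rule ennreal_mult) (use p in auto)
    also have "emeasure M ?C = (\<integral>\<^sup>+x. indicator ?C x \<partial>M)" using sB by simp
    also have "\<dots> = (\<integral>\<^sup>+x. indicator {x. T < \<bar>x\<bar>} x * indicator (?S x) y \<partial>M)"
      by (intro nn_integral_cong) (use True in \<open>auto simp: indicator_def cosx\<close>)
    finally show ?thesis by (simp only: indicator_simps(1)[OF True])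
  qed simp
  have m: "(\<lambda>(y, x). indicator {x. T < \<bar>x\<bar>} x * indicator (?S x) y :: ennreal) \<in> borel_measurable (lborel \<Otimes>\<^sub>M M)"
  proof -
    have "(\<lambda>(y, x). if T < \<bar>x\<bar> \<and> \<bar>y\<bar> \<le> l \<and> 1 - cos (s * y * x) < r then 1 else 0 :: ennreal) \<in> borel_measurable (borel \<Otimes>\<^sub>M borel)"
      by measurable
    moreover have "sets (lborel \<Otimes>\<^sub>M M) = sets (borel \<Otimes>\<^sub>M (borel :: real measure))"
      by (intro sets_pair_measure_cong) (auto simp: events_eq_borel)
    ultimately have "(\<lambda>(y, x). if T < \<bar>x\<bar> \<and> \<bar>y\<bar> \<le> l \<and> 1 - cos (s * y * x) < r then 1 else 0 :: ennreal) \<in> borel_measurable (lborel \<Otimes>\<^sub>M M)"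
      using measurable_cong_sets by blast
    also have "(\<lambda>(y, x). if T < \<bar>x\<bar> \<and> \<bar>y\<bar> \<le> l \<and> 1 - cos (s * y * x) < r then 1 else 0 :: ennreal)
      = (\<lambda>(y, x). indicator {x. T < \<bar>x\<bar>} x * indicator (?S x) y)"
      by (auto simp: fun_eq_iff indicator_def cosx)
    finally show ?thesis .
  qed
  have Gm: "?G \<in> sets lborel" by measurable
  have "emeasure lborel ?G = (\<integral>\<^sup>+y. indicator ?G y \<partial>lborel)" using Gm by simp
  also have "\<dots> \<le> (\<integral>\<^sup>+y. ennreal (2 / p) * (\<integral>\<^sup>+x. indicator {x. T < \<bar>x\<bar>} x * indicator (?S x) y \<partial>M) \<partial>lborel)"
    by (intro nn_integral_mono key)
  also have "\<dots> = ennreal (2 / p) * (\<integral>\<^sup>+y. (\<integral>\<^sup>+x. indicator {x. T < \<bar>x\<bar>} x * indicator (?S x) y \<partial>M) \<partial>lborel)"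
    using bm[OF m] by (intro nn_integral_cmult) simp
  also have "(\<integral>\<^sup>+y. (\<integral>\<^sup>+x. indicator {x. T < \<bar>x\<bar>} x * indicator (?S x) y \<partial>M) \<partial>lborel)
     = (\<integral>\<^sup>+x. (\<integral>\<^sup>+y. indicator {x. T < \<bar>x\<bar>} x * indicator (?S x) y \<partial>lborel) \<partial>M)"
    by (rule LM.Fubini'[OF m, symmetric])
  also have "\<dots> \<le> (\<integral>\<^sup>+x. ennreal (2 * sqrt (6 * r) * (l + 3 / (s * T))) \<partial>M)"
  proof (rule nn_integral_mono)
    fix x
    show "(\<integral>\<^sup>+y. indicator {x. T < \<bar>x\<bar>} x * indicator (?S x) y \<partial>lborel) \<le> ennreal (2 * sqrt (6 * r) * (l + 3 / (s * T)))"
    proof (cases "T < \<bar>x\<bar>")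
      case True
      have "?S x \<in> sets lborel" by measurable
      then have "(\<integral>\<^sup>+y. indicator {x. T < \<bar>x\<bar>} x * indicator (?S x) y \<partial>lborel) = emeasure lborel (?S x)"
        using True by simp
      also have "\<dots> \<le> ennreal (2 * sqrt (6 * r) * (l + 3 / (s * \<bar>x\<bar>)))"
        by (rule emeasure_cos_near_one) (use assms True in auto)
      also have "\<dots> \<le> ennreal (2 * sqrt (6 * r) * (l + 3 / (s * T)))"
        using assms True by (intro ennreal_leI mult_left_mono add_left_mono divide_left_mono) auto
      finally show ?thesis .
    qed simp
  qed
  also have "\<dots> = ennreal (2 * sqrt (6 * r) * (l + 3 / (s * T)))" using emeasure_space_1 by simp
  finally have "emeasure lborel ?G \<le> ennreal (2 / p) * ennreal (2 * sqrt (6 * r) * (l + 3 / (s * T)))"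
    by (simp add: mult_left_mono)
  also have "\<dots> = ennreal (4 * sqrt (6 * r) / p * (l + 3 / (s * T)))"
    using assms by (subst ennreal_mult[symmetric]) (auto simp: add_nonneg_nonneg)
  finally show ?thesis .
qed

end

subsection \<open>Boxes in Euclidean space\<close>

abbreviation lebesgue_on_nat :: "nat \<Rightarrow> (nat \<Rightarrow> real) measure" where
  "lebesgue_on_nat n \<equiv> PiM {..<n} (\<lambda>_. lborel)"

interpretation lborel_product: product_sigma_finite "\<lambda>_::nat. lborel :: real measure" ..

lemma sigma_finite_lebesgue_on_nat: "sigma_finite_measure (lebesgue_on_nat n)"
  by (rule lborel_product.sigma_finite) simp

lemma nn_integral_interval_square:
  fixes a c s x r :: real
  assumes "0 \<le> r" "0 \<le> s"
  shows "(\<integral>\<^sup>+y. indicator {x - r..x + r} y * ennreal ((c + a * (y - x))\<^sup>2 + s) \<partial>lborel)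
    \<le> ennreal (2 * r * (c\<^sup>2 + a\<^sup>2 * r\<^sup>2 + s))"
proof -
  let ?F = "\<lambda>y. c\<^sup>2 * y + c * a * (y - x)\<^sup>2 + a\<^sup>2 * (y - x) ^ 3 / 3 + s * y"
  have "(\<integral>\<^sup>+y. ennreal ((c + a * (y - x))\<^sup>2 + s) * indicator {x - r..x + r} y \<partial>lborel) = ennreal (?F (x + r) - ?F (x - r))"
  proof (rule nn_integral_FTC_Icc)
    show "DERIV ?F y :> (c + a * (y - x))\<^sup>2 + s" for y
    proof -
      have "DERIV ?F y :> c\<^sup>2 + c * a * (2 * (y - x)) + a\<^sup>2 * (3 * (y - x)\<^sup>2) / 3 + s"
        by (auto intro!: derivative_eq_intros)
      moreover have "c\<^sup>2 + c * a * (2 * (y - x)) + a\<^sup>2 * (3 * (y - x)\<^sup>2) / 3 + s = (c + a * (y - x))\<^sup>2 + s"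
        by (simp add: power2_eq_square field_simps)
      ultimately show ?thesis by simp
    qed
    show "0 \<le> (c + a * (y - x))\<^sup>2 + s" for y using assms by simp
  qed (use assms in auto)
  also have "\<dots> \<le> ennreal (2 * r * (c\<^sup>2 + a\<^sup>2 * r\<^sup>2 + s))"
  proof (rule ennreal_leI)
    have "?F (x + r) - ?F (x - r) = 2 * r * (c\<^sup>2 + a\<^sup>2 * r\<^sup>2 / 3 + s)"
      by (simp add: power2_eq_square power3_eq_cube algebra_simps)
    also have "\<dots> \<le> 2 * r * (c\<^sup>2 + a\<^sup>2 * r\<^sup>2 + s)"
      using assms by (intro mult_left_mono) auto
    finally show "?F (x + r) - ?F (x - r) \<le> 2 * r * (c\<^sup>2 + a\<^sup>2 * r\<^sup>2 + s)" .
  qed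
  finally show ?thesis by (simp add: mult.commute)
qed

text \<open>On a symmetric box the deviations \<open>y k - x k\<close> have mean 0 and are
  uncorrelated, so their squares add up without cross terms; the variance
  \<open>(r k)\<^sup>2 / 3\<close> is rounded up. The free offset \<open>c\<close> absorbs the
  coordinate that is held fixed in the induction step.\<close>

lemma nn_integral_box_square:
  fixes a x r :: "nat \<Rightarrow> real" and c s :: real
  assumes "finite J" "\<And>k. k \<in> J \<Longrightarrow> 0 \<le> r k" "0 \<le> s"
  shows "(\<integral>\<^sup>+y. (\<Prod>k\<in>J. indicator {x k - r k..x k + r k} (y k)) * ennreal ((c + (\<Sum>k\<in>J. a k * (y k - x k)))\<^sup>2 + s) \<partial>PiM J (\<lambda>_. lborel))
    \<le> ennreal ((\<Prod>k\<in>J. 2 * r k) * (c\<^sup>2 + (\<Sum>k\<in>J. (a k)\<^sup>2 * (r k)\<^sup>2) + s))"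
  using assms
proof (induction J arbitrary: c s rule: finite_induct)
  case empty
  show ?case by (simp add: PiM_empty nn_integral_count_space_finite)
next
  case (insert i J)
  let ?I = "\<lambda>k t. indicator {x k - r k..x k + r k} t :: ennreal"
  have "(\<integral>\<^sup>+y. (\<Prod>k\<in>insert i J. ?I k (y k)) * ennreal ((c + (\<Sum>k\<in>insert i J. a k * (y k - x k)))\<^sup>2 + s) \<partial>PiM (insert i J) (\<lambda>_. lborel))
    = (\<integral>\<^sup>+t. (\<integral>\<^sup>+y. (\<Prod>k\<in>insert i J. ?I k ((y(i := t)) k)) * ennreal ((c + (\<Sum>k\<in>insert i J. a k * ((y(i := t)) k - x k)))\<^sup>2 + s) \<partial>PiM J (\<lambda>_. lborel)) \<partial>lborel)"
    using insert by (intro lborel_product.product_nn_integral_insert_rev) auto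
  also have "\<dots> = (\<integral>\<^sup>+t. ?I i t * (\<integral>\<^sup>+y. (\<Prod>k\<in>J. ?I k (y k)) * ennreal (((c + a i * (t - x i)) + (\<Sum>k\<in>J. a k * (y k - x k)))\<^sup>2 + s) \<partial>PiM J (\<lambda>_. lborel)) \<partial>lborel)"
  proof (rule nn_integral_cong)
    fix t
    have 1: "(\<Prod>k\<in>J. ?I k ((y(i := t)) k)) = (\<Prod>k\<in>J. ?I k (y k))" for y
      by (rule prod.cong) (use insert in auto)
    have 2: "(\<Sum>k\<in>J. a k * ((y(i := t)) k - x k)) = (\<Sum>k\<in>J. a k * (y k - x k))" for y
      by (rule sum.cong) (use insert in auto)
    have "(\<integral>\<^sup>+y. (\<Prod>k\<in>insert i J. ?I k ((y(i := t)) k)) * ennreal ((c + (\<Sum>k\<in>insert i J. a k * ((y(i := t)) k - x k)))\<^sup>2 + s) \<partial>PiM J (\<lambda>_. lborel))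
      = (\<integral>\<^sup>+y. ?I i t * ((\<Prod>k\<in>J. ?I k (y k)) * ennreal (((c + a i * (t - x i)) + (\<Sum>k\<in>J. a k * (y k - x k)))\<^sup>2 + s)) \<partial>PiM J (\<lambda>_. lborel))"
      by (rule nn_integral_cong) (use insert 1 2 in \<open>simp add: mult.assoc add.assoc\<close>)
    also have "\<dots> = ?I i t * (\<integral>\<^sup>+y. (\<Prod>k\<in>J. ?I k (y k)) * ennreal (((c + a i * (t - x i)) + (\<Sum>k\<in>J. a k * (y k - x k)))\<^sup>2 + s) \<partial>PiM J (\<lambda>_. lborel))"
      using insert by (intro nn_integral_cmult) simp
    finally show "(\<integral>\<^sup>+y. (\<Prod>k\<in>insert i J. ?I k ((y(i := t)) k)) * ennreal ((c + (\<Sum>k\<in>insert i J. a k * ((y(i := t)) k - x k)))\<^sup>2 + s) \<partial>PiM J (\<lambda>_. lborel))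
      = ?I i t * (\<integral>\<^sup>+y. (\<Prod>k\<in>J. ?I k (y k)) * ennreal (((c + a i * (t - x i)) + (\<Sum>k\<in>J. a k * (y k - x k)))\<^sup>2 + s) \<partial>PiM J (\<lambda>_. lborel))" .
  qed
  also have "\<dots> \<le> (\<integral>\<^sup>+t. ?I i t * ennreal ((\<Prod>k\<in>J. 2 * r k) * ((c + a i * (t - x i))\<^sup>2 + (\<Sum>k\<in>J. (a k)\<^sup>2 * (r k)\<^sup>2) + s)) \<partial>lborel)"
    using insert by (intro nn_integral_mono mult_left_mono insert.IH) auto
  also have "\<dots> = (\<integral>\<^sup>+t. ennreal (\<Prod>k\<in>J. 2 * r k) * (?I i t * ennreal ((c + a i * (t - x i))\<^sup>2 + ((\<Sum>k\<in>J. (a k)\<^sup>2 * (r k)\<^sup>2) + s))) \<partial>lborel)"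
    using insert by (intro nn_integral_cong) (simp add: ennreal_mult prod_nonneg sum_nonneg mult_ac add.assoc)
  also have "\<dots> = ennreal (\<Prod>k\<in>J. 2 * r k) * (\<integral>\<^sup>+t. ?I i t * ennreal ((c + a i * (t - x i))\<^sup>2 + ((\<Sum>k\<in>J. (a k)\<^sup>2 * (r k)\<^sup>2) + s)) \<partial>lborel)"
    by (intro nn_integral_cmult) simp
  also have "\<dots> \<le> ennreal (\<Prod>k\<in>J. 2 * r k) * ennreal (2 * r i * (c\<^sup>2 + (a i)\<^sup>2 * (r i)\<^sup>2 + ((\<Sum>k\<in>J. (a k)\<^sup>2 * (r k)\<^sup>2) + s)))"
    using insert by (intro mult_left_mono nn_integral_interval_square) (auto intro!: add_nonneg_nonneg sum_nonneg)
  also have "\<dots> = ennreal ((\<Prod>k\<in>insert i J. 2 * r k) * (c\<^sup>2 + (\<Sum>k\<in>insert i J. (a k)\<^sup>2 * (r k)\<^sup>2) + s))"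
  proof (subst ennreal_mult[symmetric])
    show "0 \<le> (\<Prod>k\<in>J. 2 * r k)" using insert by (intro prod_nonneg) auto
    show "0 \<le> 2 * r i * (c\<^sup>2 + (a i)\<^sup>2 * (r i)\<^sup>2 + ((\<Sum>k\<in>J. (a k)\<^sup>2 * (r k)\<^sup>2) + s))"
      using insert by (intro mult_nonneg_nonneg add_nonneg_nonneg sum_nonneg) auto
    show "ennreal ((\<Prod>k\<in>J. 2 * r k) * (2 * r i * (c\<^sup>2 + (a i)\<^sup>2 * (r i)\<^sup>2 + ((\<Sum>k\<in>J. (a k)\<^sup>2 * (r k)\<^sup>2) + s))))
      = ennreal ((\<Prod>k\<in>insert i J. 2 * r k) * (c\<^sup>2 + (\<Sum>k\<in>insert i J. (a k)\<^sup>2 * (r k)\<^sup>2) + s))"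
      unfolding prod.insert[OF insert(1,2)] sum.insert[OF insert(1,2)] by (simp only: mult_ac add_ac)
  qed
  finally show ?case .
qed

lemma emeasure_box:
  assumes "\<And>k. k < n \<Longrightarrow> 0 \<le> r k"
  shows "emeasure (lebesgue_on_nat n) {y\<in>space (lebesgue_on_nat n). \<forall>k<n. \<bar>y k - x k\<bar> \<le> r k} = ennreal (\<Prod>k<n. 2 * r k)"
proof -
  have "{y\<in>space (lebesgue_on_nat n). \<forall>k<n. \<bar>y k - x k\<bar> \<le> r k} = PiE {..<n} (\<lambda>k. {x k - r k..x k + r k})"
    by (auto simp: space_PiM PiE_def Pi_def abs_le_iff)
  also have "emeasure (lebesgue_on_nat n) \<dots> = (\<Prod>k<n. emeasure lborel {x k - r k..x k + r k})"
    by (rule lborel_product.emeasure_PiM) auto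
  also have "\<dots> = (\<Prod>k<n. ennreal (2 * r k))"
    by (rule prod.cong) (use assms in auto)
  also have "\<dots> = ennreal (\<Prod>k<n. 2 * r k)" using assms by (intro prod_ennreal) auto
  finally show ?thesis .
qed

text \<open>Markov's inequality for the mean over the box. What enters is a weighted Hilbert-Schmidt
  norm, which second moments of entries can control, unlike the operator norm.\<close>

lemma half_box_near:
  fixes A :: "nat \<Rightarrow> nat \<Rightarrow> real"
  assumes r: "\<And>k. k < n \<Longrightarrow> 0 \<le> r k" and I: "finite I" and S: "0 < S"
    "(\<Sum>i\<in>I. \<Sum>k<n. (A i k)\<^sup>2 * (r k)\<^sup>2) \<le> S"
  shows "ennreal ((\<Prod>k<n. 2 * r k) / 2) \<le> emeasure (lebesgue_on_nat n)
    {y\<in>space (lebesgue_on_nat n). (\<forall>k<n. \<bar>y k - x k\<bar> \<le> r k) \<and> (\<Sum>i\<in>I. (\<Sum>k<n. A i k * (y k - x k))\<^sup>2) \<le> 2 * S}"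
    (is "_ \<le> emeasure ?L ?G")
proof -
  let ?B = "{y\<in>space ?L. \<forall>k<n. \<bar>y k - x k\<bar> \<le> r k}"
  let ?V = "\<Prod>k<n. 2 * r k"
  let ?I = "\<lambda>y. \<Prod>k<n. indicator {x k - r k..x k + r k} (y k) :: ennreal"
  define Q where "Q y = (\<Sum>i\<in>I. (\<Sum>k<n. A i k * (y k - x k))\<^sup>2)" for y
  have V: "0 \<le> ?V" using r by (intro prod_nonneg) auto
  have ind: "indicator ?B y = ?I y" if "y \<in> space ?L" for y
  proof (cases "y \<in> ?B")
    case True
    then have "indicator {x k - r k..x k + r k} (y k) = (1::ennreal)" if "k < n" for k
      using that by (auto simp: abs_le_iff indicator_def)
    then show ?thesis using True by simp
  next
    case False
    then obtain k where "k < n" "\<not> \<bar>y k - x k\<bar> \<le> r k" using \<open>y \<in> space ?L\<close> by blast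
    then have "indicator {x k - r k..x k + r k} (y k) = (0::ennreal)"
      by (auto simp: abs_le_iff indicator_def algebra_simps)
    then show ?thesis using False \<open>k < n\<close> by (auto simp: indicator_def prod_zero_iff)
  qed
  have Qm [measurable]: "Q \<in> borel_measurable ?L" unfolding Q_def by measurable
  have Bm [measurable]: "?B \<in> sets ?L" by measurable
  have "(\<integral>\<^sup>+y. ennreal (Q y) * indicator ?B y \<partial>?L) = (\<integral>\<^sup>+y. (\<Sum>i\<in>I. ?I y * ennreal ((0 + (\<Sum>k<n. A i k * (y k - x k)))\<^sup>2 + 0)) \<partial>?L)"
    by (intro nn_integral_cong) (simp add: ind Q_def sum_nonneg sum_distrib_left mult.commute flip: sum_ennreal)
  also have "\<dots> = (\<Sum>i\<in>I. (\<integral>\<^sup>+y. ?I y * ennreal ((0 + (\<Sum>k<n. A i k * (y k - x k)))\<^sup>2 + 0) \<partial>?L))"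
    by (intro nn_integral_sum) measurable
  also have "\<dots> \<le> (\<Sum>i\<in>I. ennreal (?V * (0\<^sup>2 + (\<Sum>k<n. (A i k)\<^sup>2 * (r k)\<^sup>2) + 0)))"
    by (intro sum_mono nn_integral_box_square) (use r in auto)
  also have "\<dots> = ennreal (\<Sum>i\<in>I. ?V * (\<Sum>k<n. (A i k)\<^sup>2 * (r k)\<^sup>2))"
    using V by (subst sum_ennreal) (auto intro!: mult_nonneg_nonneg sum_nonneg)
  also have "\<dots> \<le> ennreal (?V * S)"
    unfolding sum_distrib_left[symmetric] using V S by (intro ennreal_leI mult_left_mono) auto
  finally have 1: "(\<integral>\<^sup>+y. ennreal (Q y) * indicator ?B y \<partial>?L) \<le> ennreal (?V * S)" .
  let ?C = "{y\<in>?B. 2 * S < Q y}"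
  have Cm: "?C \<in> sets ?L" by measurable
  have "ennreal (2 * S) * emeasure ?L ?C = (\<integral>\<^sup>+y. ennreal (2 * S) * indicator ?C y \<partial>?L)"
    using Cm by (simp add: nn_integral_cmult_indicator)
  also have "\<dots> \<le> (\<integral>\<^sup>+y. ennreal (Q y) * indicator ?B y \<partial>?L)"
    by (intro nn_integral_mono) (auto simp: indicator_def intro!: ennreal_leI)
  finally have "ennreal (2 * S) * emeasure ?L ?C \<le> ennreal (?V * S)" using 1 by simp
  then have "ennreal (2 * S) * emeasure ?L ?C \<le> ennreal (2 * S) * ennreal (?V / 2)"
    using S V by (simp add: ennreal_mult'[symmetric] mult_ac)
  then have C: "emeasure ?L ?C \<le> ennreal (?V / 2)"
    using S by (subst (asm) ennreal_mult_le_mult_iff) auto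
  have "ennreal ?V = emeasure ?L ?B" by (rule emeasure_box[OF r, symmetric])
  also have "?B = ?G \<union> ?C" by (auto simp: Q_def)
  also have "emeasure ?L (?G \<union> ?C) \<le> emeasure ?L ?G + emeasure ?L ?C"
    by (rule emeasure_subadditive) (use Cm Qm in \<open>auto simp: Q_def[symmetric]\<close>)
  also have "\<dots> \<le> emeasure ?L ?G + ennreal (?V / 2)" using C by (rule add_left_mono)
  finally have "ennreal (?V / 2) + ennreal (?V / 2) \<le> emeasure ?L ?G + ennreal (?V / 2)"
    using V by (simp add: ennreal_plus[symmetric] del: ennreal_plus)
  then show ?thesis by (simp add: ennreal_add_left_cancel_le add.commute)
qed

subsection \<open>Random matrices and volume comparison\<close>

text \<open>Submatrices are selected inside the locale by sets \<open>I\<close> of rows, so that the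
  full matrix and the matrix with one row removed are covered by the same statements.\<close>

locale random_square_matrix = prob_space M for M :: "'w measure" +
  fixes n :: nat and B :: "nat \<Rightarrow> nat \<Rightarrow> 'w \<Rightarrow> real" and K :: real
  assumes n_pos: "0 < n" and K_pos: "0 < K"
    and indep: "indep_vars (\<lambda>_. borel) (\<lambda>(i, j). B i j) ({..<n} \<times> {..<n})"
    and square_integrable: "\<And>i j. i < n \<Longrightarrow> j < n \<Longrightarrow> integrable M (\<lambda>\<omega>. (B i j \<omega>)\<^sup>2)"
    and hilbert_schmidt: "(\<Sum>i<n. \<Sum>j<n. \<integral>\<omega>. (B i j \<omega>)\<^sup>2 \<partial>M) \<le> K * (real n)\<^sup>2"
begin

section \<open>Independence of blocks, and the lengths of columns\<close>

lemma entry_measurable: "i < n \<Longrightarrow> j < n \<Longrightarrow> random_variable borel (B i j)"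
  using indep unfolding indep_vars_def by auto

text \<open>Independence of rows, of columns and of the entries within a row all reduce to this
  form.\<close>

lemma block_indep:
  assumes "disjoint_family_on S L" "\<And>l. l \<in> L \<Longrightarrow> S l \<subseteq> {..<n} \<times> {..<n}"
    and "\<And>l. l \<in> L \<Longrightarrow> g l \<in> borel_measurable (PiM (S l) (\<lambda>_. borel :: real measure))"
  shows "indep_vars (\<lambda>_. borel :: real measure) (\<lambda>l \<omega>. g l (\<lambda>p\<in>S l. B (fst p) (snd p) \<omega>)) L"
proof -
  have "indep_vars (\<lambda>l. PiM (S l) (\<lambda>_. borel)) (\<lambda>l \<omega>. restrict (\<lambda>p. (\<lambda>(i, j). B i j) p \<omega>) (S l)) L"
    by (rule indep_vars_restrict[OF indep]) (use assms in auto)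
  from indep_vars_compose2[OF this, of g "\<lambda>_. borel"] show ?thesis
    using assms(3) by (simp add: case_prod_beta)
qed

lemma row_indep:
  assumes "I \<subseteq> {..<n}" and g: "\<And>i. g i \<in> borel_measurable borel"
  shows "indep_vars (\<lambda>_. borel) (\<lambda>i \<omega>. g i (\<Sum>k<n. B i k \<omega> * y k) :: real) I"
proof -
  have "indep_vars (\<lambda>_. borel) (\<lambda>i \<omega>. (\<lambda>f. g i (\<Sum>k<n. f (i, k) * y k)) (\<lambda>p\<in>{i} \<times> {..<n}. B (fst p) (snd p) \<omega>)) I"
  proof (rule block_indep)
    fix i assume "i \<in> I"
    show "(\<lambda>f. g i (\<Sum>k<n. f (i, k) * y k)) \<in> borel_measurable (PiM ({i} \<times> {..<n}) (\<lambda>_. borel :: real measure))"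
      by (intro measurable_compose[OF _ g] borel_measurable_sum borel_measurable_times
          borel_measurable_const measurable_component_singleton) auto
  qed (use assms in \<open>auto simp: disjoint_family_on_def\<close>)
  then show ?thesis by simp
qed

lemma row_entries_indep:
  assumes "i < n"
  shows "indep_vars (\<lambda>_. borel) (\<lambda>k \<omega>. B i k \<omega> * y k) {..<n}"
proof -
  have "indep_vars (\<lambda>_. borel) (\<lambda>k \<omega>. (\<lambda>f. f (i, k) * y k) (\<lambda>p\<in>{(i, k)}. B (fst p) (snd p) \<omega>)) {..<n}"
  proof (rule block_indep)
    fix k
    show "(\<lambda>f. f (i, k) * y k) \<in> borel_measurable (PiM {(i, k)} (\<lambda>_. borel :: real measure))"
      by (intro borel_measurable_times borel_measurable_const measurable_component_singleton) auto
  qed (use assms in \<open>auto simp: disjoint_family_on_def\<close>)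
  then show ?thesis by simp
qed

text \<open>The summand \<open>K * n\<close> keeps the weight positive, so that it can be divided
  by, and only doubles the bound on the total weight.\<close>

definition col_weight :: "nat set \<Rightarrow> nat \<Rightarrow> real" where
  "col_weight I k = (\<Sum>i\<in>I. \<integral>\<omega>. (B i k \<omega>)\<^sup>2 \<partial>M) + K * n"

lemma col_weight_pos: "0 < col_weight I k"
  unfolding col_weight_def using n_pos K_pos
  by (intro add_nonneg_pos sum_nonneg Bochner_Integration.integral_nonneg) auto

lemma sum_col_weight_le:
  assumes "I \<subseteq> {..<n}" shows "(\<Sum>k<n. col_weight I k) \<le> 2 * K * (real n)\<^sup>2"
proof -
  have "(\<Sum>k<n. \<Sum>i\<in>I. \<integral>\<omega>. (B i k \<omega>)\<^sup>2 \<partial>M) = (\<Sum>i\<in>I. \<Sum>k<n. \<integral>\<omega>. (B i k \<omega>)\<^sup>2 \<partial>M)"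
    by (rule sum.swap)
  also have "\<dots> \<le> (\<Sum>i<n. \<Sum>k<n. \<integral>\<omega>. (B i k \<omega>)\<^sup>2 \<partial>M)"
    using assms by (intro sum_mono2 sum_nonneg Bochner_Integration.integral_nonneg) auto
  finally show ?thesis
    using hilbert_schmidt by (simp add: col_weight_def sum.distrib power2_eq_square mult_ac)
qed

text \<open>Dividing the side along column \<open>k\<close> by the square root of this ratio caps
  the contribution of that column to the perturbation. The maximum with 1 ensures that a box is only
  ever shortened.\<close>

definition col_ratio :: "nat set \<Rightarrow> real \<Rightarrow> nat \<Rightarrow> 'w \<Rightarrow> real" where
  "col_ratio I R k \<omega> = max 1 ((\<Sum>i\<in>I. (B i k \<omega>)\<^sup>2) / (R\<^sup>2 * col_weight I k))"

lemma col_ratio_measurable: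
  "I \<subseteq> {..<n} \<Longrightarrow> k < n \<Longrightarrow> random_variable borel (col_ratio I R k)"
  unfolding col_ratio_def
  by (intro borel_measurable_max borel_measurable_const borel_measurable_divide borel_measurable_sum
      borel_measurable_power entry_measurable) auto

text \<open>The columns are independent, so the expectation of the product factorises into means of
  at most \<open>1 + 1 / R\<^sup>2\<close>. Markov's inequality for a product of \<open>n\<close>
  factors is exponentially strong although only first moments of the factors are used.\<close>

lemma prob_col_ratio_large:
  assumes I: "I \<subseteq> {..<n}" and R: "0 < R" and \<kappa>: "0 < \<kappa>"
  shows "prob {\<omega>\<in>space M. \<kappa> ^ (2 * n) \<le> (\<Prod>k<n. col_ratio I R k \<omega>)} \<le> ((1 + 1 / R\<^sup>2) / \<kappa>\<^sup>2) ^ n"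
proof -
  note [measurable] = col_ratio_measurable[OF I]
  have fI: "finite I" using I finite_subset by blast
  have ind: "indep_vars (\<lambda>_. borel) (col_ratio I R) {..<n}"
  proof -
    have "indep_vars (\<lambda>_. borel) (\<lambda>k \<omega>. (\<lambda>f. max 1 ((\<Sum>i\<in>I. (f (i, k))\<^sup>2) / (R\<^sup>2 * col_weight I k))) (\<lambda>p\<in>I \<times> {k}. B (fst p) (snd p) \<omega>)) {..<n}"
    proof (rule block_indep)
      fix k
      show "(\<lambda>f. max 1 ((\<Sum>i\<in>I. (f (i, k))\<^sup>2) / (R\<^sup>2 * col_weight I k))) \<in> borel_measurable (PiM (I \<times> {k}) (\<lambda>_. borel :: real measure))"
        by (intro borel_measurable_max borel_measurable_const borel_measurable_divide borel_measurable_sum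
            borel_measurable_power measurable_component_singleton) auto
    qed (use I in \<open>auto simp: disjoint_family_on_def\<close>)
    then show ?thesis by (simp add: col_ratio_def[abs_def])
  qed
  have ind': "indep_vars (\<lambda>_. borel) (\<lambda>k \<omega>. ennreal (col_ratio I R k \<omega>)) {..<n}"
    by (rule indep_vars_compose2[OF ind]) auto
  have one: "(\<integral>\<^sup>+\<omega>. ennreal (col_ratio I R k \<omega>) \<partial>M) \<le> ennreal (1 + 1 / R\<^sup>2)" if k: "k < n" for k
  proof -
    let ?d = "R\<^sup>2 * col_weight I k"
    have d: "0 < ?d" using R col_weight_pos by simp
    have int: "integrable M (\<lambda>\<omega>. (\<Sum>i\<in>I. (B i k \<omega>)\<^sup>2) / ?d)"
      using k I by (intro Bochner_Integration.integrable_divide Bochner_Integration.integrable_sum square_integrable) auto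
    have q: "0 \<le> (\<Sum>i\<in>I. (B i k \<omega>)\<^sup>2) / ?d" for \<omega>
      by (rule divide_nonneg_pos[OF sum_nonneg d]) simp
    have "(\<integral>\<^sup>+\<omega>. ennreal (col_ratio I R k \<omega>) \<partial>M) \<le> (\<integral>\<^sup>+\<omega>. ennreal (1 + (\<Sum>i\<in>I. (B i k \<omega>)\<^sup>2) / ?d) \<partial>M)"
      using q by (intro nn_integral_mono ennreal_leI) (simp add: col_ratio_def del: zero_le_divide_iff)
    also have "\<dots> = ennreal (\<integral>\<omega>. 1 + (\<Sum>i\<in>I. (B i k \<omega>)\<^sup>2) / ?d \<partial>M)"
    proof (rule nn_integral_eq_integral)
      show "integrable M (\<lambda>\<omega>. 1 + (\<Sum>i\<in>I. (B i k \<omega>)\<^sup>2) / ?d)" using int by simp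
      show "AE \<omega> in M. 0 \<le> 1 + (\<Sum>i\<in>I. (B i k \<omega>)\<^sup>2) / ?d"
        by (intro AE_I2 add_nonneg_nonneg q) auto
    qed
    also have "(\<integral>\<omega>. 1 + (\<Sum>i\<in>I. (B i k \<omega>)\<^sup>2) / ?d \<partial>M) = 1 + (\<Sum>i\<in>I. \<integral>\<omega>. (B i k \<omega>)\<^sup>2 \<partial>M) / ?d"
    proof -
      have "(\<integral>\<omega>. (\<Sum>i\<in>I. (B i k \<omega>)\<^sup>2) \<partial>M) = (\<Sum>i\<in>I. \<integral>\<omega>. (B i k \<omega>)\<^sup>2 \<partial>M)"
        using k I by (intro Bochner_Integration.integral_sum square_integrable) auto
      then show ?thesis using int by (simp add: prob_space)
    qed
    also have "\<dots> \<le> 1 + col_weight I k / ?d"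
      using d n_pos K_pos by (intro add_left_mono divide_right_mono) (auto simp: col_weight_def)
    also have "\<dots> = 1 + 1 / R\<^sup>2" using col_weight_pos[of I k] by simp
    finally show ?thesis by (simp add: ennreal_leI)
  qed
  have nn: "0 \<le> col_ratio I R k \<omega>" for k \<omega> unfolding col_ratio_def by simp
  let ?P = "\<lambda>\<omega>. \<Prod>k<n. col_ratio I R k \<omega>"
  have "(\<integral>\<^sup>+\<omega>. ennreal (?P \<omega>) \<partial>M) = (\<integral>\<^sup>+\<omega>. (\<Prod>k<n. ennreal (col_ratio I R k \<omega>)) \<partial>M)"
    using nn by (simp add: prod_ennreal)
  also have "\<dots> = (\<Prod>k<n. \<integral>\<^sup>+\<omega>. ennreal (col_ratio I R k \<omega>) \<partial>M)"
    by (rule indep_vars_nn_integral[OF _ ind']) auto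
  also have "\<dots> \<le> (\<Prod>k<n. ennreal (1 + 1 / R\<^sup>2))"
    by (rule prod_mono_ennreal) (use one in auto)
  also have "\<dots> = ennreal ((1 + 1 / R\<^sup>2) ^ n)"
    unfolding prod_constant card_lessThan by (rule ennreal_power) simp
  finally have E: "(\<integral>\<^sup>+\<omega>. ennreal (?P \<omega>) \<partial>M) \<le> ennreal ((1 + 1 / R\<^sup>2) ^ n)" .
  have Pm: "?P \<in> borel_measurable M" by measurable
  let ?A = "{\<omega>\<in>space M. \<kappa> ^ (2 * n) \<le> ?P \<omega>}"
  let ?A' = "{\<omega>\<in>space M. 1 \<le> ennreal (1 / \<kappa> ^ (2 * n)) * ennreal (?P \<omega>)}"
  have "?A \<subseteq> ?A'"
  proof
    fix \<omega> assume "\<omega> \<in> ?A"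
    then have A: "\<kappa> ^ (2 * n) \<le> ?P \<omega>" "\<omega> \<in> space M" by auto
    then have "1 \<le> 1 / \<kappa> ^ (2 * n) * ?P \<omega>" using \<kappa> by (simp add: le_divide_eq)
    then have "ennreal 1 \<le> ennreal (1 / \<kappa> ^ (2 * n) * ?P \<omega>)" by (rule ennreal_leI)
    also have "\<dots> = ennreal (1 / \<kappa> ^ (2 * n)) * ennreal (?P \<omega>)" by (rule ennreal_mult') (use \<kappa> in simp)
    finally show "\<omega> \<in> ?A'" using A by (simp only: ennreal_1 mem_Collect_eq simp_thms)
  qed
  moreover have "?A' \<in> sets M" using Pm by measurable
  ultimately have "emeasure M ?A \<le> emeasure M ?A'" by (rule emeasure_mono)
  also have "\<dots> \<le> ennreal (1 / \<kappa> ^ (2 * n)) * (\<integral>\<^sup>+\<omega>. ennreal (?P \<omega>) * indicator (space M) \<omega> \<partial>M)"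
    using Pm by (intro nn_integral_Markov_inequality) auto
  also have "(\<integral>\<^sup>+\<omega>. ennreal (?P \<omega>) * indicator (space M) \<omega> \<partial>M) = (\<integral>\<^sup>+\<omega>. ennreal (?P \<omega>) \<partial>M)"
    by (intro nn_integral_cong) auto
  also have "ennreal (1 / \<kappa> ^ (2 * n)) * (\<integral>\<^sup>+\<omega>. ennreal (?P \<omega>) \<partial>M) \<le> ennreal (1 / \<kappa> ^ (2 * n)) * ennreal ((1 + 1 / R\<^sup>2) ^ n)"
    by (intro mult_left_mono E) auto
  also have "\<dots> = ennreal (((1 + 1 / R\<^sup>2) / \<kappa>\<^sup>2) ^ n)"
    using \<kappa> by (simp add: ennreal_mult'[symmetric] power_divide power_mult)
  finally show ?thesis using \<kappa> by (simp add: emeasure_eq_measure)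
qed

end

lemma L2_set_le_iff: "0 \<le> t \<Longrightarrow> L2_set f A \<le> t \<longleftrightarrow> (\<Sum>i\<in>A. (f i)\<^sup>2) \<le> t\<^sup>2"
  unfolding L2_set_def by (metis real_sqrt_le_iff real_sqrt_unique sum_nonneg zero_le_power2 real_sqrt_pow2 real_sqrt_abs abs_of_nonneg)

lemma mat_vec_add: "mat_vec n A (\<lambda>j. x j + y j) i = mat_vec n A x i + mat_vec n A y i"
  by (simp add: mat_vec_def algebra_simps sum.distrib)

section \<open>Volume comparison in place of a net\<close>

context random_square_matrix
begin

lemma residual_measurable:
  assumes "I \<subseteq> {..<n}"
  shows "(\<lambda>(\<omega>, y). L2_set (mat_vec n (\<lambda>i j. B i j \<omega>) y) I) \<in> borel_measurable (M \<Otimes>\<^sub>M lebesgue_on_nat n)"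
proof -
  have 1: "(\<lambda>z. B i k (fst z)) \<in> borel_measurable (M \<Otimes>\<^sub>M lebesgue_on_nat n)" if "i < n" "k < n" for i k
    using measurable_compose[OF measurable_fst entry_measurable[OF that]] .
  have 2: "(\<lambda>z. snd z k) \<in> borel_measurable (M \<Otimes>\<^sub>M lebesgue_on_nat n)" if "k < n" for k
  proof -
    have "(\<lambda>y. y k) \<in> borel_measurable (lebesgue_on_nat n)"
      using measurable_component_singleton[of k "{..<n}" "\<lambda>_. lborel"] that by simp
    from measurable_compose[OF measurable_snd this] show ?thesis .
  qed
  show ?thesis
    unfolding case_prod_beta L2_set_def mat_vec_def
    using assms by (intro borel_measurable_sqrt borel_measurable_sum borel_measurable_power borel_measurable_times 1 2
      measurable_compose[OF _ borel_measurable_sqrt]) auto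
qed

text \<open>
  Instead of a union bound over a net, compare volumes: if a vector \<open>x\<close> with small \<open>B x\<close> exists,
  then a definite proportion of the box around \<open>x\<close>, whose sides are shortened along the long columns of
  \<open>B\<close>, consists of vectors \<open>y\<close> for which \<open>B y\<close> is small as well.
\<close>

lemma volume_union_bound:
  assumes I: "I \<subseteq> {..<n}" and R: "0 < R" and \<kappa>: "0 < \<kappa>" and h: "0 < h" and t: "0 \<le> t"
    and W: "W \<in> sets (lebesgue_on_nat n)" "emeasure (lebesgue_on_nat n) W \<le> ennreal w" and w: "0 \<le> w" and p0: "0 \<le> p"
    and p: "\<And>y. y \<in> W \<Longrightarrow> prob {\<omega>\<in>space M. L2_set (mat_vec n (\<lambda>i j. B i j \<omega>) y) I \<le> t + 2 * h * R * sqrt K * n} \<le> p"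
  obtains E where "E \<in> events" "prob E \<le> ((1 + 1 / R\<^sup>2) / \<kappa>\<^sup>2) ^ n + 2 * p * w * (\<kappa> / (2 * h)) ^ n"
    "\<And>\<omega> x. \<omega> \<in> space M - E \<Longrightarrow> L2_set (mat_vec n (\<lambda>i j. B i j \<omega>) x) I \<le> t \<Longrightarrow>
      (\<And>y. y \<in> space (lebesgue_on_nat n) \<Longrightarrow> (\<forall>k<n. \<bar>y k - x k\<bar> \<le> h) \<Longrightarrow> y \<in> W) \<Longrightarrow> False"
proof -
  note bm = borel_measurable_nn_integral and emm = emeasure_eq_measure
  have fI: "finite I" using I finite_subset by blast
  let ?L = "lebesgue_on_nat n"
  interpret L: sigma_finite_measure ?L by (rule sigma_finite_lebesgue_on_nat)
  interpret MP: pair_sigma_finite M ?L ..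
  define T where "T = t + 2 * h * R * sqrt K * n"
  have T: "0 \<le> T" unfolding T_def using t h R K_pos by simp
  \<comment> \<open>Half of the volume that is left to the shortened box when the column ratios
    multiply to less than \<open>\<kappa> ^ (2 * n)\<close>: the square roots of the ratios then
    cost at most \<open>\<kappa> ^ n\<close>.\<close>
  define \<theta> where "\<theta> = (2 * h / \<kappa>) ^ n / 2"
  have \<theta>: "0 < \<theta>" using h \<kappa> by (simp add: \<theta>_def)
  let ?Q = "\<lambda>\<omega> y. L2_set (mat_vec n (\<lambda>i j. B i j \<omega>) y) I"
  define f where "f \<omega> y = (indicator W y * indicator {..T} (?Q \<omega> y) :: ennreal)" for \<omega> y
  have f_m: "case_prod f \<in> borel_measurable (M \<Otimes>\<^sub>M ?L)"
  proof -
    have "(\<lambda>z. indicator W (snd z) :: ennreal) \<in> borel_measurable (M \<Otimes>\<^sub>M ?L)"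
      using W(1) by measurable
    moreover have "(\<lambda>z. indicator {..T} (?Q (fst z) (snd z)) :: ennreal) \<in> borel_measurable (M \<Otimes>\<^sub>M ?L)"
      using residual_measurable[OF I] unfolding case_prod_beta
      by (rule measurable_compose) measurable
    ultimately show ?thesis unfolding f_def[abs_def] case_prod_beta by (rule borel_measurable_times_ennreal)
  qed
  \<comment> \<open>The volume of those \<open>y\<close> in \<open>W\<close> at which the residual
    is small. By Fubini its mean is at most \<open>p * w\<close>, so by Markov's inequality it
    rarely reaches \<open>\<theta>\<close>.\<close>
  define F where "F \<omega> = (\<integral>\<^sup>+y. f \<omega> y \<partial>?L)" for \<omega>
  have F_m: "F \<in> borel_measurable M"
    unfolding F_def[abs_def] by (rule L.borel_measurable_nn_integral[OF f_m])
  define E1 where "E1 = {\<omega>\<in>space M. \<kappa> ^ (2 * n) \<le> (\<Prod>k<n. col_ratio I R k \<omega>)}"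
  define E2 where "E2 = {\<omega>\<in>space M. 1 \<le> ennreal (1 / \<theta>) * F \<omega>}"
  have E1: "E1 \<in> sets M" unfolding E1_def using col_ratio_measurable[OF I] by measurable
  have E2: "E2 \<in> sets M" unfolding E2_def using F_m by measurable
  have pw: "p * w / \<theta> = 2 * p * w * (\<kappa> / (2 * h)) ^ n"
    using h \<kappa> by (simp add: \<theta>_def power_divide field_simps)
  have "emeasure M E2 \<le> ennreal (1 / \<theta>) * (\<integral>\<^sup>+\<omega>. F \<omega> * indicator (space M) \<omega> \<partial>M)"
    unfolding E2_def using F_m by (intro nn_integral_Markov_inequality) auto
  also have "(\<integral>\<^sup>+\<omega>. F \<omega> * indicator (space M) \<omega> \<partial>M) = (\<integral>\<^sup>+\<omega>. F \<omega> \<partial>M)"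
    by (intro nn_integral_cong) auto
  also have "\<dots> = (\<integral>\<^sup>+y. (\<integral>\<^sup>+\<omega>. f \<omega> y \<partial>M) \<partial>?L)"
    unfolding F_def by (rule MP.Fubini'[OF f_m, symmetric])
  also have "\<dots> \<le> (\<integral>\<^sup>+y. ennreal p * indicator W y \<partial>?L)"
  proof (rule nn_integral_mono)
    fix y assume y: "y \<in> space ?L"
    show "(\<integral>\<^sup>+\<omega>. f \<omega> y \<partial>M) \<le> ennreal p * indicator W y"
    proof (cases "y \<in> W")
      case True
      have s: "{\<omega>\<in>space M. ?Q \<omega> y \<le> T} \<in> sets M"
      proof -
        have "(\<lambda>\<omega>. ?Q \<omega> y) \<in> borel_measurable M"
          using measurable_compose[OF measurable_Pair2'[OF y] residual_measurable[OF I]] by simp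
        then show ?thesis by measurable
      qed
      have "(\<integral>\<^sup>+\<omega>. f \<omega> y \<partial>M) = (\<integral>\<^sup>+\<omega>. indicator {\<omega>\<in>space M. ?Q \<omega> y \<le> T} \<omega> \<partial>M)"
        by (intro nn_integral_cong) (use True in \<open>auto simp: f_def indicator_def\<close>)
      also have "\<dots> = emeasure M {\<omega>\<in>space M. ?Q \<omega> y \<le> T}" using s by simp
      also have "\<dots> \<le> ennreal p" using p[OF True] by (simp add: emm T_def ennreal_leI)
      finally show ?thesis using True by simp
    qed (simp add: f_def)
  qed
  also have "\<dots> = ennreal p * emeasure ?L W" using W by (simp add: nn_integral_cmult_indicator)
  also have "\<dots> \<le> ennreal p * ennreal w" using W by (intro mult_left_mono) auto
  finally have "emeasure M E2 \<le> ennreal (1 / \<theta>) * (ennreal p * ennreal w)" by (simp add: mult_left_mono)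
  also have "\<dots> = ennreal (p * w / \<theta>)" using p0 w \<theta> by (simp add: ennreal_mult'[symmetric])
  finally have p2: "measure M E2 \<le> 2 * p * w * (\<kappa> / (2 * h)) ^ n"
    unfolding emm pw using p0 w h \<kappa> by (subst (asm) ennreal_le_iff) auto
  have p1: "measure M E1 \<le> ((1 + 1 / R\<^sup>2) / \<kappa>\<^sup>2) ^ n"
    unfolding E1_def by (rule prob_col_ratio_large[OF I R \<kappa>])
  show thesis
  proof (rule that[of "E1 \<union> E2"])
    show "E1 \<union> E2 \<in> sets M" using E1 E2 by auto
    show "measure M (E1 \<union> E2) \<le> ((1 + 1 / R\<^sup>2) / \<kappa>\<^sup>2) ^ n + 2 * p * w * (\<kappa> / (2 * h)) ^ n"
      using measure_Un_le[OF E1 E2] p1 p2 by linarith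
    fix \<omega> x
    assume \<omega>: "\<omega> \<in> space M - (E1 \<union> E2)" and x: "?Q \<omega> x \<le> t"
      and cube: "\<And>y. y \<in> space ?L \<Longrightarrow> (\<forall>k<n. \<bar>y k - x k\<bar> \<le> h) \<Longrightarrow> y \<in> W"
    define A where "A = (\<lambda>i j. B i j \<omega>)"
    define c where "c k = col_ratio I R k \<omega>" for k
    define r where "r k = h / sqrt (c k)" for k
    \<comment> \<open>With sides \<open>h / sqrt (c k)\<close> each column contributes at most
      \<open>R\<^sup>2 * h\<^sup>2\<close> times its weight, and the weights sum to at most
      \<open>2 * K * n\<^sup>2\<close>. The allowance \<open>2 * h * R * sqrt K * n\<close> is
      \<open>sqrt (2 * S)\<close>.\<close>
    define S where "S = 2 * K * R\<^sup>2 * h\<^sup>2 * (real n)\<^sup>2"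
    have c1: "1 \<le> c k" for k unfolding c_def col_ratio_def by simp
    have prodc: "(\<Prod>k<n. c k) < \<kappa> ^ (2 * n)" using \<omega> unfolding E1_def c_def by auto
    have r: "0 \<le> r k" "r k \<le> h" for k
      using h c1[of k] by (auto simp: r_def divide_le_eq mult_left_le)
    have S: "0 < S" unfolding S_def using K_pos R h n_pos by simp
    have "(\<Sum>i\<in>I. \<Sum>k<n. (A i k)\<^sup>2 * (r k)\<^sup>2) = (\<Sum>k<n. (\<Sum>i\<in>I. (A i k)\<^sup>2) * (r k)\<^sup>2)"
      by (subst sum.swap) (simp add: sum_distrib_right)
    also have "\<dots> \<le> (\<Sum>k<n. R\<^sup>2 * col_weight I k * h\<^sup>2)"
    proof (rule sum_mono)
      fix k
      have d: "0 < R\<^sup>2 * col_weight I k" using R col_weight_pos by simp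
      have "(\<Sum>i\<in>I. (A i k)\<^sup>2) / (R\<^sup>2 * col_weight I k) \<le> c k"
        unfolding c_def col_ratio_def A_def by simp
      then have "(\<Sum>i\<in>I. (A i k)\<^sup>2) \<le> c k * (R\<^sup>2 * col_weight I k)" using d by (simp add: pos_divide_le_eq)
      moreover have "(r k)\<^sup>2 = h\<^sup>2 / c k" using c1[of k] by (simp add: r_def power_divide)
      moreover have "0 \<le> h\<^sup>2 / c k" using c1[of k] by simp
      ultimately have "(\<Sum>i\<in>I. (A i k)\<^sup>2) * (r k)\<^sup>2 \<le> c k * (R\<^sup>2 * col_weight I k) * (h\<^sup>2 / c k)"
        by (simp only: mult_right_mono)
      also have "\<dots> = R\<^sup>2 * col_weight I k * h\<^sup>2" using c1[of k] by simp
      finally show "(\<Sum>i\<in>I. (A i k)\<^sup>2) * (r k)\<^sup>2 \<le> R\<^sup>2 * col_weight I k * h\<^sup>2" .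
    qed
    also have "\<dots> = R\<^sup>2 * h\<^sup>2 * (\<Sum>k<n. col_weight I k)" by (simp add: sum_distrib_left mult_ac)
    also have "\<dots> \<le> R\<^sup>2 * h\<^sup>2 * (2 * K * (real n)\<^sup>2)" by (intro mult_left_mono sum_col_weight_le I) auto
    finally have AS: "(\<Sum>i\<in>I. \<Sum>k<n. (A i k)\<^sup>2 * (r k)\<^sup>2) \<le> S" by (simp add: S_def mult_ac)
    let ?G = "{y\<in>space ?L. (\<forall>k<n. \<bar>y k - x k\<bar> \<le> r k) \<and> (\<Sum>i\<in>I. (\<Sum>k<n. A i k * (y k - x k))\<^sup>2) \<le> 2 * S}"
    have G: "?G \<in> sets ?L" by measurable
    have "\<theta> \<le> (\<Prod>k<n. 2 * r k) / 2"
    proof -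
      have "sqrt (\<Prod>k<n. c k) \<le> sqrt (\<kappa> ^ (2 * n))" using prodc by simp
      also have "\<dots> = \<kappa> ^ n" using \<kappa> by (simp add: power_mult power2_eq_square[symmetric] mult.commute[of 2] real_sqrt_unique)
      finally have sc: "sqrt (\<Prod>k<n. c k) \<le> \<kappa> ^ n" .
      have pc: "0 < (\<Prod>k<n. c k)" using c1 by (intro prod_pos) (auto intro: less_le_trans[OF zero_less_one])
      have sq: "(\<Prod>k<m. sqrt (c k)) = sqrt (\<Prod>k<m. c k)" for m
        by (induction m) (auto simp: real_sqrt_mult)
      have "(\<Prod>k<n. 2 * r k) = (\<Prod>k<n. 2 * h) / (\<Prod>k<n. sqrt (c k))"
        unfolding r_def by (subst prod_dividef[symmetric]) simp
      also have "\<dots> = (2 * h) ^ n / sqrt (\<Prod>k<n. c k)" by (simp add: sq)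
      also have "\<dots> \<ge> (2 * h) ^ n / \<kappa> ^ n"
        using sc pc h \<kappa> by (intro divide_left_mono) auto
      finally show ?thesis by (simp add: \<theta>_def power_divide)
    qed
    then have "ennreal \<theta> \<le> ennreal ((\<Prod>k<n. 2 * r k) / 2)" by (rule ennreal_leI)
    also have "\<dots> \<le> emeasure ?L ?G" by (rule half_box_near[OF r(1) fI S AS])
    also have "\<dots> = (\<integral>\<^sup>+y. indicator ?G y \<partial>?L)" using G by simp
    also have "\<dots> \<le> F \<omega>"
      unfolding F_def
    proof (intro nn_integral_mono)
      fix y assume y: "y \<in> space ?L"
      show "indicator ?G y \<le> f \<omega> y"
      proof (cases "y \<in> ?G")
        case True
        have yW: "y \<in> W"
        proof (rule cube[OF y], intro allI impI)
          fix k assume "k < n"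
          then show "\<bar>y k - x k\<bar> \<le> h" using True r(2)[of k] by force
        qed
        have "?Q \<omega> y = L2_set (\<lambda>i. mat_vec n A x i + mat_vec n A (\<lambda>k. y k - x k) i) I"
          unfolding mat_vec_add[symmetric] A_def[symmetric] by simp
        also have "\<dots> \<le> ?Q \<omega> x + L2_set (mat_vec n A (\<lambda>k. y k - x k)) I"
          unfolding A_def by (rule L2_set_triangle_ineq)
        also have "L2_set (mat_vec n A (\<lambda>k. y k - x k)) I \<le> sqrt (2 * S)"
          unfolding L2_set_def mat_vec_def using True by (intro real_sqrt_le_mono) auto
        also have "sqrt (2 * S) = 2 * h * R * sqrt K * n"
        proof -
          have "2 * S = (2 * h * R * sqrt K * n)\<^sup>2"
            using K_pos by (simp add: S_def power_mult_distrib)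
          then show ?thesis using h R K_pos by simp
        qed
        also have "?Q \<omega> x + 2 * h * R * sqrt K * n \<le> T" using x by (simp add: T_def)
        finally have "?Q \<omega> y \<le> T" by simp
        then have "f \<omega> y = 1" using yW by (simp add: f_def)
        then show ?thesis by (simp only: indicator_simps(1)[OF True] order_refl)
      qed simp
    qed
    finally have "ennreal (1 / \<theta>) * ennreal \<theta> \<le> ennreal (1 / \<theta>) * F \<omega>" by (intro mult_left_mono) auto
    then have "1 \<le> ennreal (1 / \<theta>) * F \<omega>" using \<theta> by (simp add: ennreal_mult'[symmetric])
    then show False using \<omega> unfolding E2_def by auto
  qed
qed

end

subsection \<open>Symmetrised entries and small ball probabilities\<close>

context prob_space
begin

text \<open>Symmetrisation discards the unknown centres of the entries, which do not affect the
  moduli of characteristic functions.\<close>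

definition sym_law :: "('a \<Rightarrow> real) \<Rightarrow> real measure" where
  "sym_law Z = distr (M \<Otimes>\<^sub>M M) borel (\<lambda>(\<omega>, \<omega>'). Z \<omega> - Z \<omega>')"

lemma pair_prob_space_self: "pair_prob_space M M" ..

lemma prob_space_pair_self: "prob_space (M \<Otimes>\<^sub>M M)"
  using pair_prob_space_self unfolding pair_prob_space_def
  by (metis pair_prob_space.axioms(1) pair_prob_space_self prob_space_pair prob_space_axioms)

lemma diff_measurable:
  assumes [measurable]: "random_variable borel Z"
  shows "(\<lambda>(\<omega>, \<omega>'). Z \<omega> - Z \<omega>' :: real) \<in> borel_measurable (M \<Otimes>\<^sub>M M)"
  by measurable

lemma real_distribution_sym_law:
  assumes "random_variable borel Z" shows "real_distribution (sym_law Z)"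
proof -
  interpret P: prob_space "M \<Otimes>\<^sub>M M" by (rule prob_space_pair_self)
  show ?thesis unfolding sym_law_def by (rule P.real_distribution_distr[OF diff_measurable[OF assms]])
qed

lemma integrable_cos_sin:
  fixes Z :: "'a \<Rightarrow> real"
  assumes [measurable]: "random_variable borel Z"
  shows "integrable M (\<lambda>\<omega>. cos (\<theta> * Z \<omega>))" "integrable M (\<lambda>\<omega>. sin (\<theta> * Z \<omega>))"
proof -
  show "integrable M (\<lambda>\<omega>. cos (\<theta> * Z \<omega>))" by (rule integrable_const_bound[of _ 1]) auto
  show "integrable M (\<lambda>\<omega>. sin (\<theta> * Z \<omega>))" by (rule integrable_const_bound[of _ 1]) auto
qed

lemma norm_char_square:
  assumes Z: "random_variable borel Z"
  shows "(cmod (expectation (\<lambda>\<omega>. iexp (\<theta> * Z \<omega>))))\<^sup>2 = 1 - osc (sym_law Z) \<theta>"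
proof -
  note [measurable] = Z
  note ic = integrable_const_bound and ps = prob_space and ii = integrable_iexp
  let ?c = "\<lambda>\<omega>. cos (\<theta> * Z \<omega>)" and ?s = "\<lambda>\<omega>. sin (\<theta> * Z \<omega>)"
  note ci = integrable_cos_sin(1)[OF Z, of \<theta>] and si = integrable_cos_sin(2)[OF Z, of \<theta>]
  interpret P: pair_prob_space M M by (rule pair_prob_space_self)
  have int: "integrable (M \<Otimes>\<^sub>M M) (\<lambda>(\<omega>, \<omega>'). 1 - cos (\<theta> * (Z \<omega> - Z \<omega>')))"
  proof (rule P.P.integrable_const_bound[of _ 2])
    show "AE x in M \<Otimes>\<^sub>M M. norm (case x of (\<omega>, \<omega>') \<Rightarrow> 1 - cos (\<theta> * (Z \<omega> - Z \<omega>'))) \<le> 2"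
    proof (rule AE_I2)
      fix x
      show "norm (case x of (\<omega>, \<omega>') \<Rightarrow> 1 - cos (\<theta> * (Z \<omega> - Z \<omega>'))) \<le> 2"
        using abs_cos_le_one[of "\<theta> * (Z (fst x) - Z (snd x))"] by (simp add: case_prod_beta)
    qed
  qed measurable
  have "osc (sym_law Z) \<theta> = (\<integral>x. 1 - cos (\<theta> * (case x of (\<omega>, \<omega>') \<Rightarrow> Z \<omega> - Z \<omega>')) \<partial>(M \<Otimes>\<^sub>M M))"
    unfolding osc_def sym_law_def by (rule integral_distr) measurable
  also have "\<dots> = (\<integral>x. (case x of (\<omega>, \<omega>') \<Rightarrow> 1 - cos (\<theta> * (Z \<omega> - Z \<omega>'))) \<partial>(M \<Otimes>\<^sub>M M))"
    by (simp add: case_prod_beta)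
  also have "\<dots> = (\<integral>\<omega>. (\<integral>\<omega>'. 1 - cos (\<theta> * (Z \<omega> - Z \<omega>')) \<partial>M) \<partial>M)"
    using P.integral_fst'[OF int] by simp
  also have "\<dots> = (\<integral>\<omega>. 1 - (?c \<omega> * (\<integral>\<omega>'. ?c \<omega>' \<partial>M) + ?s \<omega> * (\<integral>\<omega>'. ?s \<omega>' \<partial>M)) \<partial>M)"
  proof (rule Bochner_Integration.integral_cong[OF refl])
    fix \<omega>
    have "(\<integral>\<omega>'. 1 - cos (\<theta> * (Z \<omega> - Z \<omega>')) \<partial>M) = (\<integral>\<omega>'. 1 - (?c \<omega> * ?c \<omega>' + ?s \<omega> * ?s \<omega>') \<partial>M)"
      by (simp add: right_diff_distrib cos_diff)
    also have "\<dots> = (\<integral>\<omega>'. 1 \<partial>M) - (\<integral>\<omega>'. ?c \<omega> * ?c \<omega>' + ?s \<omega> * ?s \<omega>' \<partial>M)"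
      using ci si by (intro Bochner_Integration.integral_diff) auto
    also have "(\<integral>\<omega>'. ?c \<omega> * ?c \<omega>' + ?s \<omega> * ?s \<omega>' \<partial>M) = ?c \<omega> * (\<integral>\<omega>'. ?c \<omega>' \<partial>M) + ?s \<omega> * (\<integral>\<omega>'. ?s \<omega>' \<partial>M)"
      using ci si by (subst Bochner_Integration.integral_add) auto
    finally show "(\<integral>\<omega>'. 1 - cos (\<theta> * (Z \<omega> - Z \<omega>')) \<partial>M) = 1 - (?c \<omega> * (\<integral>\<omega>'. ?c \<omega>' \<partial>M) + ?s \<omega> * (\<integral>\<omega>'. ?s \<omega>' \<partial>M))"
      using ps by simp
  qed
  also have "\<dots> = (\<integral>\<omega>. 1 \<partial>M) - (\<integral>\<omega>. ?c \<omega> * (\<integral>\<omega>'. ?c \<omega>' \<partial>M) + ?s \<omega> * (\<integral>\<omega>'. ?s \<omega>' \<partial>M) \<partial>M)"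
    using ci si by (intro Bochner_Integration.integral_diff) auto
  also have "(\<integral>\<omega>. ?c \<omega> * (\<integral>\<omega>'. ?c \<omega>' \<partial>M) + ?s \<omega> * (\<integral>\<omega>'. ?s \<omega>' \<partial>M) \<partial>M) = (\<integral>\<omega>. ?c \<omega> \<partial>M)\<^sup>2 + (\<integral>\<omega>. ?s \<omega> \<partial>M)\<^sup>2"
    using ci si by (subst Bochner_Integration.integral_add) (auto simp: power2_eq_square)
  finally have "osc (sym_law Z) \<theta> = 1 - ((\<integral>\<omega>. ?c \<omega> \<partial>M)\<^sup>2 + (\<integral>\<omega>. ?s \<omega> \<partial>M)\<^sup>2)"
    using ps by simp
  moreover have "Re (\<integral>\<omega>. iexp (\<theta> * Z \<omega>) \<partial>M) = (\<integral>\<omega>. ?c \<omega> \<partial>M)" "Im (\<integral>\<omega>. iexp (\<theta> * Z \<omega>) \<partial>M) = (\<integral>\<omega>. ?s \<omega> \<partial>M)"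
  proof -
    have i: "integrable M (\<lambda>\<omega>. iexp (\<theta> * Z \<omega>))"
      by (rule ic[of _ 1]) auto
    show "Re (\<integral>\<omega>. iexp (\<theta> * Z \<omega>) \<partial>M) = (\<integral>\<omega>. ?c \<omega> \<partial>M)"
      by (subst integral_Re[OF i, symmetric]) (simp add: Re_exp)
    show "Im (\<integral>\<omega>. iexp (\<theta> * Z \<omega>) \<partial>M) = (\<integral>\<omega>. ?s \<omega> \<partial>M)"
      by (subst integral_Im[OF i, symmetric]) (simp add: Im_exp)
  qed
  ultimately show ?thesis by (simp add: cmod_power2)
qed

lemma norm_char_le:
  assumes Z: "random_variable borel Z"
  shows "cmod (expectation (\<lambda>\<omega>. iexp (\<theta> * Z \<omega>))) \<le> exp (- osc (sym_law Z) \<theta> / 2)"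
proof -
  have "(cmod (expectation (\<lambda>\<omega>. iexp (\<theta> * Z \<omega>))))\<^sup>2 \<le> exp (- osc (sym_law Z) \<theta>)"
    unfolding norm_char_square[OF Z] using exp_ge_add_one_self[of "- osc (sym_law Z) \<theta>"] by simp
  also have "\<dots> = (exp (- osc (sym_law Z) \<theta> / 2))\<^sup>2"
    by (simp add: exp_double[symmetric])
  finally show ?thesis by (rule power2_le_imp_le) simp
qed

text \<open>Condition on the second copy: whatever value it takes, the first copy lies within
  distance 1 of it with probability at most \<open>b\<close>.\<close>

lemma sym_law_far:
  assumes Z: "random_variable borel Z" and levy: "levy_concentration M Z 1 \<le> b"
  shows "1 - b \<le> measure (sym_law Z) {x. 1 \<le> \<bar>x\<bar>}"
proof -
  note [measurable] = Z
  note emm = emeasure_eq_measure and bdd = bdd_aboveI2 and p1 = prob_le_1 and es1 = emeasure_space_1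
  interpret N: real_distribution "sym_law Z" by (rule real_distribution_sym_law[OF Z])
  have b: "measure M {\<omega>\<in>space M. \<bar>Z \<omega> - u\<bar> < 1} \<le> b" for u
  proof -
    have "measure M {\<omega>\<in>space M. \<bar>Z \<omega> - u\<bar> < 1} \<le> levy_concentration M Z 1"
      unfolding levy_concentration_def by (rule cSUP_upper) (auto intro!: bdd_aboveI2[where M = 1] p1)
    then show ?thesis using levy by simp
  qed
  have b0: "0 \<le> b" using b[of 0] measure_nonneg order_trans by blast
  interpret P: pair_prob_space M M by (rule pair_prob_space_self)
  let ?A = "{x \<in> space (M \<Otimes>\<^sub>M M). \<bar>Z (fst x) - Z (snd x)\<bar> < 1}"
  have A: "?A \<in> sets (M \<Otimes>\<^sub>M M)" by measurable
  have "measure (sym_law Z) {x. \<bar>x\<bar> < 1} = measure (M \<Otimes>\<^sub>M M) ?A"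
    unfolding sym_law_def by (subst measure_distr) (auto intro!: arg_cong[where f = "measure _"] simp: case_prod_beta)
  also have "ennreal \<dots> = (\<integral>\<^sup>+y. emeasure M ((\<lambda>x. (x, y)) -` ?A) \<partial>M)"
    using P.emeasure_pair_measure_alt2[OF A] by (simp add: P.P.emeasure_eq_measure)
  also have "\<dots> \<le> (\<integral>\<^sup>+y. ennreal b \<partial>M)"
  proof (rule nn_integral_mono)
    fix y assume "y \<in> space M"
    then have "(\<lambda>x. (x, y)) -` ?A = {\<omega>\<in>space M. \<bar>Z \<omega> - Z y\<bar> < 1}" by (auto simp: space_pair_measure)
    then show "emeasure M ((\<lambda>x. (x, y)) -` ?A) \<le> ennreal b"
      using b[of "Z y"] by (simp add: emm ennreal_leI)
  qed
  also have "\<dots> = ennreal b" by (simp add: es1)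
  finally have "measure (sym_law Z) {x. \<bar>x\<bar> < 1} \<le> b" using b0 by simp
  moreover have "measure (sym_law Z) (space (sym_law Z) - {x. \<bar>x\<bar> < 1}) = 1 - measure (sym_law Z) {x. \<bar>x\<bar> < 1}"
    by (rule N.prob_compl) (simp add: N.events_eq_borel)
  moreover have "space (sym_law Z) - {x. \<bar>x\<bar> < 1} = {x. 1 \<le> \<bar>x\<bar>}" by auto
  ultimately show ?thesis by simp
qed

lemma sym_law_second_moment:
  assumes Z: "random_variable borel Z" and Z2: "integrable M (\<lambda>\<omega>. (Z \<omega>)\<^sup>2)"
  shows "integrable (sym_law Z) (\<lambda>x. x\<^sup>2)" "(\<integral>x. x\<^sup>2 \<partial>sym_law Z) \<le> 4 * expectation (\<lambda>\<omega>. (Z \<omega>)\<^sup>2)"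
proof -
  note [measurable] = Z
  note es1 = emeasure_space_1 and ps = prob_space
  interpret P: pair_prob_space M M by (rule pair_prob_space_self)
  have i1: "integrable (M \<Otimes>\<^sub>M M) (\<lambda>x. (Z (fst x))\<^sup>2)"
  proof -
    have "distr (M \<Otimes>\<^sub>M M) M fst = M" by (rule distr_pair_fst) unfold_locales
    then have "integrable (distr (M \<Otimes>\<^sub>M M) M fst) (\<lambda>\<omega>. (Z \<omega>)\<^sup>2)" using Z2 by simp
    then show ?thesis by (subst (asm) integrable_distr_eq) auto
  qed
  have e1: "(\<integral>x. (Z (fst x))\<^sup>2 \<partial>(M \<Otimes>\<^sub>M M)) = (\<integral>\<omega>. (Z \<omega>)\<^sup>2 \<partial>M)"
  proof -
    have "distr (M \<Otimes>\<^sub>M M) M fst = M" by (rule distr_pair_fst) unfold_locales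
    then have "(\<integral>\<omega>. (Z \<omega>)\<^sup>2 \<partial>M) = (\<integral>\<omega>. (Z \<omega>)\<^sup>2 \<partial>distr (M \<Otimes>\<^sub>M M) M fst)" by simp
    also have "\<dots> = (\<integral>x. (Z (fst x))\<^sup>2 \<partial>(M \<Otimes>\<^sub>M M))" by (rule integral_distr) auto
    finally show ?thesis by simp
  qed
  have sw: "distr (M \<Otimes>\<^sub>M M) (M \<Otimes>\<^sub>M M) (\<lambda>(x, y). (y, x)) = M \<Otimes>\<^sub>M M" by (rule P.distr_pair_swap[symmetric])
  have i2: "integrable (M \<Otimes>\<^sub>M M) (\<lambda>x. (Z (snd x))\<^sup>2)"
    using P.integrable_product_swap[OF i1] by (simp add: case_prod_beta')
  have e2: "(\<integral>x. (Z (snd x))\<^sup>2 \<partial>(M \<Otimes>\<^sub>M M)) = (\<integral>\<omega>. (Z \<omega>)\<^sup>2 \<partial>M)"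
    using P.integral_product_swap[of "\<lambda>x. (Z (fst x))\<^sup>2"] e1 by (simp add: case_prod_beta')
  have le: "(Z (fst x) - Z (snd x))\<^sup>2 \<le> 2 * (Z (fst x))\<^sup>2 + 2 * (Z (snd x))\<^sup>2" for x
    using zero_le_power2[of "Z (fst x) + Z (snd x)"] by (simp add: power2_eq_square algebra_simps)
  have i3: "integrable (M \<Otimes>\<^sub>M M) (\<lambda>x. (Z (fst x) - Z (snd x))\<^sup>2)"
  proof (rule Bochner_Integration.integrable_bound[of _ "\<lambda>x. 2 * (Z (fst x))\<^sup>2 + 2 * (Z (snd x))\<^sup>2"])
    show "integrable (M \<Otimes>\<^sub>M M) (\<lambda>x. 2 * (Z (fst x))\<^sup>2 + 2 * (Z (snd x))\<^sup>2)" using i1 i2 by auto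
    show "AE x in M \<Otimes>\<^sub>M M. norm ((Z (fst x) - Z (snd x))\<^sup>2) \<le> norm (2 * (Z (fst x))\<^sup>2 + 2 * (Z (snd x))\<^sup>2)"
      using le by (intro AE_I2) (auto intro: order_trans[OF _ abs_ge_self])
  qed measurable
  show "integrable (sym_law Z) (\<lambda>x. x\<^sup>2)"
    unfolding sym_law_def using i3 by (subst integrable_distr_eq) (auto simp: case_prod_beta)
  have "(\<integral>x. x\<^sup>2 \<partial>sym_law Z) = (\<integral>x. (Z (fst x) - Z (snd x))\<^sup>2 \<partial>(M \<Otimes>\<^sub>M M))"
    unfolding sym_law_def by (subst integral_distr) (auto simp: case_prod_beta)
  also have "\<dots> \<le> (\<integral>x. 2 * (Z (fst x))\<^sup>2 + 2 * (Z (snd x))\<^sup>2 \<partial>(M \<Otimes>\<^sub>M M))"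
    using i1 i2 le by (intro Bochner_Integration.integral_mono i3) auto
  also have "\<dots> = 2 * (\<integral>x. (Z (fst x))\<^sup>2 \<partial>(M \<Otimes>\<^sub>M M)) + 2 * (\<integral>x. (Z (snd x))\<^sup>2 \<partial>(M \<Otimes>\<^sub>M M))"
    using i1 i2 by (subst Bochner_Integration.integral_add) auto
  finally show "(\<integral>x. x\<^sup>2 \<partial>sym_law Z) \<le> 4 * (\<integral>\<omega>. (Z \<omega>)\<^sup>2 \<partial>M)" by (simp add: e1 e2)
qed

end

section \<open>Small ball probabilities of one row and of the residual\<close>

locale anticoncentrated_matrix = random_square_matrix +
  fixes b :: real
  assumes b: "0 < b" "b < 1"
    and levy: "\<And>i j. i < n \<Longrightarrow> j < n \<Longrightarrow> levy_concentration M (B i j) 1 \<le> b"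
begin

abbreviation law :: "nat \<Rightarrow> nat \<Rightarrow> real measure" where
  "law i k \<equiv> sym_law (B i k)"

lemma real_distribution_law: "i < n \<Longrightarrow> k < n \<Longrightarrow> real_distribution (law i k)"
  by (intro real_distribution_sym_law entry_measurable)

text \<open>Half of this quantity bounds from below the negative logarithm of the modulus, at
  frequency \<open>s\<close>, of the characteristic function of the scalar product of row
  \<open>i\<close> with \<open>y\<close>.\<close>

definition row_osc :: "nat \<Rightarrow> (nat \<Rightarrow> real) \<Rightarrow> real \<Rightarrow> real" where
  "row_osc i y s = (\<Sum>k<n. osc (law i k) (s * y k))"

lemma row_osc_nonneg: "i < n \<Longrightarrow> 0 \<le> row_osc i y s"
  unfolding row_osc_def by (intro sum_nonneg real_distribution.osc_nonneg real_distribution_law) auto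

lemma row_sum_measurable: "i < n \<Longrightarrow> random_variable borel (\<lambda>\<omega>. \<Sum>k<n. B i k \<omega> * y k)"
  by (intro borel_measurable_sum borel_measurable_times entry_measurable borel_measurable_const) auto

lemma row_char_le:
  assumes i: "i < n"
  shows "cmod (expectation (\<lambda>\<omega>. iexp (s * (\<Sum>k<n. B i k \<omega> * y k)))) \<le> exp (- row_osc i y s / 2)"
proof -
  have m: "random_variable borel (\<lambda>\<omega>. B i k \<omega> * y k)" if "k < n" for k
    using entry_measurable[OF i that] by measurable
  have c: "char (distr M borel X) t = expectation (\<lambda>\<omega>. iexp (t * X \<omega>))" if [measurable]: "random_variable borel X" for X t
    unfolding char_def by (rule integral_distr) measurable
  have "expectation (\<lambda>\<omega>. iexp (s * (\<Sum>k<n. B i k \<omega> * y k))) = (\<Prod>k<n. char (distr M borel (\<lambda>\<omega>. B i k \<omega> * y k)) s)"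
    using char_distr_sum[OF row_entries_indep[OF i, of y], of s] c[OF row_sum_measurable[OF i, of y]] by simp
  also have "cmod \<dots> = (\<Prod>k<n. cmod (char (distr M borel (\<lambda>\<omega>. B i k \<omega> * y k)) s))"
    by (simp add: prod_norm)
  also have "\<dots> \<le> (\<Prod>k<n. exp (- osc (law i k) (s * y k) / 2))"
  proof (rule prod_mono, rule conjI)
    fix k assume k: "k \<in> {..<n}"
    have "char (distr M borel (\<lambda>\<omega>. B i k \<omega> * y k)) s = expectation (\<lambda>\<omega>. iexp ((s * y k) * B i k \<omega>))"
      using c[OF m[of k]] k by (simp add: mult_ac)
    then show "cmod (char (distr M borel (\<lambda>\<omega>. B i k \<omega> * y k)) s) \<le> exp (- osc (law i k) (s * y k) / 2)"
      using norm_char_le[OF entry_measurable[OF i, of k], of "s * y k"] k by simp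
  qed simp
  also have "\<dots> = exp (- row_osc i y s / 2)"
    by (simp add: exp_sum[symmetric] row_osc_def sum_negf sum_divide_distrib)
  finally show ?thesis .
qed

text \<open>Tensorisation: on the event, the product over the rows of the Gaussians
  \<open>exp (- (D * Z)\<^sup>2)\<close> is at least \<open>exp (- (D\<^sup>2 * \<tau>))\<close>.
  Each Gaussian is dominated by ten times the kernel, the rows are independent, and the expectation
  of the kernel is bounded through the characteristic function.\<close>

lemma prob_residual_le:
  assumes J: "J \<subseteq> {..<n}" and D: "0 < D" and a: "0 < a" and \<beta>: "0 \<le> \<beta>"
    and osc: "\<And>i s. i \<in> J \<Longrightarrow> 0 \<le> s \<Longrightarrow> s \<le> D \<Longrightarrow> exp (- row_osc i y s / 2) \<le> exp (- a * s\<^sup>2) + \<beta>"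
  shows "prob {\<omega>\<in>space M. (\<Sum>i\<in>J. (\<Sum>k<n. B i k \<omega> * y k)\<^sup>2) \<le> \<tau>}
    \<le> exp (D\<^sup>2 * \<tau>) * (10 * (8 / (sqrt a * D) + 4 * \<beta>)) ^ card J"
proof -
  have fJ: "finite J" using J finite_subset by blast
  let ?Z = "\<lambda>i \<omega>. \<Sum>k<n. B i k \<omega> * y k"
  have Zm: "random_variable borel (?Z i)" if "i \<in> J" for i using row_sum_measurable J that by blast
  let ?X = "\<lambda>i \<omega>. fejer_kernel (D * ?Z i \<omega>)"
  have ki: "integrable M (?X i)" if "i \<in> J" for i
    by (rule integrable_const_bound[of _ 4])
      (use fejer_kernel_nonneg fejer_kernel_le Zm[OF that] in auto)
  have ind: "indep_vars (\<lambda>_. borel) ?X J"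
    by (rule row_indep[OF J, of "\<lambda>_ z. fejer_kernel (D * z)"]) measurable
  let ?A = "{\<omega>\<in>space M. (\<Sum>i\<in>J. (?Z i \<omega>)\<^sup>2) \<le> \<tau>}"
  have Am: "?A \<in> sets M"
  proof -
    have "(\<lambda>\<omega>. \<Sum>i\<in>J. (?Z i \<omega>)\<^sup>2) \<in> borel_measurable M" by (rule borel_measurable_sum) (rule borel_measurable_power[OF Zm])
    then show ?thesis by measurable
  qed
  have "prob ?A = expectation (indicator ?A)" using Am by simp
  also have "\<dots> \<le> expectation (\<lambda>\<omega>. exp (D\<^sup>2 * \<tau>) * 10 ^ card J * (\<Prod>i\<in>J. ?X i \<omega>))"
  proof (rule Bochner_Integration.integral_mono)
    show "integrable M (indicator ?A :: _ \<Rightarrow> real)" using Am by (simp add: emeasure_eq_measure)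
    show "integrable M (\<lambda>\<omega>. exp (D\<^sup>2 * \<tau>) * 10 ^ card J * (\<Prod>i\<in>J. ?X i \<omega>))"
      using indep_vars_integrable[OF fJ ind ki] by (intro integrable_mult_right) auto
    fix \<omega>
    have nn: "0 \<le> exp (D\<^sup>2 * \<tau>) * 10 ^ card J * (\<Prod>i\<in>J. ?X i \<omega>)"
      by (intro mult_nonneg_nonneg prod_nonneg fejer_kernel_nonneg) auto
    show "indicator ?A \<omega> \<le> exp (D\<^sup>2 * \<tau>) * 10 ^ card J * (\<Prod>i\<in>J. ?X i \<omega>)"
    proof (cases "\<omega> \<in> ?A")
      case True
      then have "D\<^sup>2 * (\<Sum>i\<in>J. (?Z i \<omega>)\<^sup>2) \<le> D\<^sup>2 * \<tau>" by (intro mult_left_mono) auto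
      moreover have "(\<Sum>i\<in>J. - (D * ?Z i \<omega>)\<^sup>2) = - (D\<^sup>2 * (\<Sum>i\<in>J. (?Z i \<omega>)\<^sup>2))"
        by (simp only: power_mult_distrib sum_negf sum_distrib_left[symmetric])
      ultimately have "1 \<le> exp (D\<^sup>2 * \<tau> + (\<Sum>i\<in>J. - (D * ?Z i \<omega>)\<^sup>2))" by simp
      also have "\<dots> = exp (D\<^sup>2 * \<tau>) * 10 ^ card J * (\<Prod>i\<in>J. exp (- (D * ?Z i \<omega>)\<^sup>2) / 10)"
        using fJ by (simp add: exp_add exp_sum prod_dividef)
      also have "\<dots> \<le> exp (D\<^sup>2 * \<tau>) * 10 ^ card J * (\<Prod>i\<in>J. ?X i \<omega>)"
        by (intro mult_left_mono prod_mono conjI fejer_kernel_ge) auto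
      finally show ?thesis using True by simp
    qed (use nn in simp)
  qed
  also have "\<dots> = exp (D\<^sup>2 * \<tau>) * 10 ^ card J * (\<Prod>i\<in>J. expectation (?X i))"
    by (simp only: integral_mult_right_zero indep_vars_lebesgue_integral[OF fJ ind ki])
  also have "\<dots> \<le> exp (D\<^sup>2 * \<tau>) * 10 ^ card J * (\<Prod>i\<in>J. 8 / (sqrt a * D) + 4 * \<beta>)"
  proof (intro mult_left_mono prod_mono conjI)
    fix i assume i: "i \<in> J"
    then have i': "i < n" using J by auto
    show "0 \<le> expectation (?X i)" by (intro Bochner_Integration.integral_nonneg fejer_kernel_nonneg)
    show "expectation (?X i) \<le> 8 / (sqrt a * D) + 4 * \<beta>"
    proof (rule expectation_fejer_kernel_le[OF Zm[OF i] D a \<beta>])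
      fix s assume "0 \<le> s" "s \<le> D"
      then show "cmod (expectation (\<lambda>\<omega>. iexp (s * ?Z i \<omega>))) \<le> exp (- a * s\<^sup>2) + \<beta>"
        using row_char_le[OF i', of s y] osc[OF i, of s] by linarith
    qed
  qed auto
  also have "\<dots> = exp (D\<^sup>2 * \<tau>) * (10 * (8 / (sqrt a * D) + 4 * \<beta>)) ^ card J"
    by (simp only: prod_constant power_mult_distrib mult.assoc)
  finally show ?thesis .
qed

text \<open>The exponent is half of the oscillation \<open>(1 - b) / 288\<close> that every row
  reaches at some frequency in \<open>[0, 1]\<close>. Here \<open>288 = 18 * 4 * 4\<close>: the
  constant of the averaged oscillation, and two losses of 4 because the squared norm of
  \<open>y\<close> is only known to lie between 1/4 and 4.\<close>

definition row_decay :: real where "row_decay = exp (- (1 - b) / 576)"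

lemma row_decay: "0 < row_decay" "row_decay < 1"
  using b by (auto simp: row_decay_def)

text \<open>The mean of \<open>row_osc i y\<close> over frequencies in \<open>[0, 1]\<close> is
  bounded below, hence so is some value. The vector may have any structure; in return the frequency
  is not explicit and the gain is only a constant.\<close>

lemma exists_row_char_le:
  assumes i: "i < n" and y: "1 / 4 \<le> (\<Sum>k<n. (y k)\<^sup>2)" "(\<Sum>k<n. (y k)\<^sup>2) \<le> 4"
  shows "\<exists>s. 0 \<le> s \<and> s \<le> 1 \<and> (1 - b) / 288 \<le> row_osc i y s"
proof (rule ccontr)
  assume neg: "\<not> ?thesis"
  interpret U: prob_space unit_interval_measure by (rule prob_space_unit_interval)
  have I: "integrable unit_interval_measure (\<lambda>s. osc (law i k) (s * y k))" if "k < n" for k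
  proof -
    interpret N: real_distribution "law i k" by (rule real_distribution_law[OF i that])
    show ?thesis
    proof (rule integrable_unit_interval[where C = 2])
      show "\<bar>osc (law i k) (s * y k)\<bar> \<le> 2" for s using N.osc_nonneg[of "s * y k"] N.osc_le_2[of "s * y k"] by simp
    qed measurable
  qed
  have int: "integrable unit_interval_measure (row_osc i y)"
    unfolding row_osc_def[abs_def] using I by (intro Bochner_Integration.integrable_sum) auto
  have "(1 - b) / 288 \<le> (\<Sum>k<n. (1 - b) * min 1 ((y k)\<^sup>2) / 18)"
  proof -
    have "(y k)\<^sup>2 / 4 \<le> min 1 ((y k)\<^sup>2)" if "k < n" for k
    proof -
      have "(y k)\<^sup>2 \<le> (\<Sum>k<n. (y k)\<^sup>2)" by (rule member_le_sum) (use that in auto)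
      then show ?thesis using y by simp
    qed
    then have "(\<Sum>k<n. (1 - b) * ((y k)\<^sup>2 / 4) / 18) \<le> (\<Sum>k<n. (1 - b) * min 1 ((y k)\<^sup>2) / 18)"
      using b by (intro sum_mono divide_right_mono mult_left_mono) auto
    moreover have "(\<Sum>k<n. (1 - b) * ((y k)\<^sup>2 / 4) / 18) = (1 - b) / 72 * (\<Sum>k<n. (y k)\<^sup>2)"
      by (simp add: sum_distrib_left)
    moreover have "(1 - b) / 72 * (1 / 4) \<le> (1 - b) / 72 * (\<Sum>k<n. (y k)\<^sup>2)"
      using y b by (intro mult_left_mono) auto
    ultimately show ?thesis by simp
  qed
  also have "\<dots> \<le> (\<Sum>k<n. \<integral>s. osc (law i k) (s * y k) \<partial>unit_interval_measure)"
  proof (rule sum_mono)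
    fix k assume "k \<in> {..<n}"
    then interpret N: real_distribution "law i k" using i by (intro real_distribution_law) auto
    show "(1 - b) * min 1 ((y k)\<^sup>2) / 18 \<le> (\<integral>s. osc (law i k) (s * y k) \<partial>unit_interval_measure)"
      using \<open>k \<in> {..<n}\<close> i by (intro N.osc_average_ge sym_law_far entry_measurable levy) auto
  qed
  also have "\<dots> = (\<integral>s. row_osc i y s \<partial>unit_interval_measure)"
    unfolding row_osc_def using I by (subst Bochner_Integration.integral_sum) auto
  finally have "(1 - b) / 288 \<le> (\<integral>s. row_osc i y s \<partial>unit_interval_measure)" .
  also have "\<dots> < (1 - b) / 288"
  proof (rule U.expectation_less[OF int])
    show "AE s in unit_interval_measure. row_osc i y s < (1 - b) / 288"
    proof (rule AE_I2)
      fix s assume "s \<in> space unit_interval_measure"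
      then have "0 \<le> s" "s \<le> 1" by (auto simp: space_restrict_space)
      then show "row_osc i y s < (1 - b) / 288" using neg by (meson not_le)
    qed
  qed
  finally show False by simp
qed

text \<open>On the event the cosine of the phase is at least \<open>(1 + row_decay) / 2\<close>,
  elsewhere it is at least -1, whereas its mean is at most \<open>row_decay\<close>. Solving for the
  probability gives a bound below 1.\<close>

lemma prob_row_small_le:
  assumes i: "i < n" and y: "1 / 4 \<le> (\<Sum>k<n. (y k)\<^sup>2)" "(\<Sum>k<n. (y k)\<^sup>2) \<le> 4"
  shows "prob {\<omega>\<in>space M. \<bar>\<Sum>k<n. B i k \<omega> * y k\<bar> \<le> sqrt (1 - row_decay)} \<le> 2 * (1 + row_decay) / (3 + row_decay)"
proof -
  let ?Z = "\<lambda>\<omega>. \<Sum>k<n. B i k \<omega> * y k"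
  note [measurable] = row_sum_measurable[OF i, of y]
  let ?A = "{\<omega>\<in>space M. \<bar>?Z \<omega>\<bar> \<le> sqrt (1 - row_decay)}"
  have A: "?A \<in> sets M" by measurable
  obtain s where s: "0 \<le> s" "s \<le> 1" "(1 - b) / 288 \<le> row_osc i y s"
    using exists_row_char_le[OF i y] by blast
  have ce: "(3 + row_decay) / 2 * indicator ?A \<omega> - 1 \<le> cos (s * ?Z \<omega> - 0)" for \<omega>
  proof (cases "\<omega> \<in> ?A")
    case True
    have "\<bar>s * ?Z \<omega>\<bar> \<le> sqrt (1 - row_decay)"
      using True s by (auto simp: abs_mult intro: order_trans[OF mult_left_le_one_le])
    then have "(s * ?Z \<omega>)\<^sup>2 \<le> 1 - row_decay"
      using row_decay by (metis abs_le_square_iff abs_of_nonneg diff_ge_0_iff_ge less_imp_le real_sqrt_ge_0_iff real_sqrt_pow2)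
    then have "(3 + row_decay) / 2 * 1 - 1 \<le> cos (s * ?Z \<omega>)"
      using one_minus_cos_le[of "s * ?Z \<omega>"] by argo
    moreover have "indicator ?A \<omega> = (1::real)" using True by (rule indicator_simps(1))
    ultimately show ?thesis by (simp only: diff_zero)
  next
    case False
    have "- 1 \<le> cos (s * ?Z \<omega>)" by (rule cos_ge_minus_one)
    then show ?thesis using False by simp
  qed
  have "(3 + row_decay) / 2 * prob ?A - 1 = expectation (\<lambda>\<omega>. (3 + row_decay) / 2 * indicator ?A \<omega> - 1)"
    using A by (simp add: prob_space emeasure_eq_measure)
  also have "\<dots> \<le> expectation (\<lambda>\<omega>. cos (s * ?Z \<omega> - 0))"
    by (intro Bochner_Integration.integral_mono ce integrable_const_bound[of "\<lambda>\<omega>. cos (s * ?Z \<omega> - 0)" 1])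
      (use A in \<open>auto simp: emeasure_eq_measure\<close>)
  also have "\<dots> \<le> cmod (expectation (\<lambda>\<omega>. iexp (s * ?Z \<omega>)))"
    using expectation_cos_shift_le[OF row_sum_measurable[OF i, of y], of s 0] by simp
  also have "\<dots> \<le> exp (- row_osc i y s / 2)" by (rule row_char_le[OF i])
  also have "\<dots> \<le> row_decay" unfolding row_decay_def using s(3) by simp
  finally show ?thesis using row_decay by (simp add: field_simps)
qed

text \<open>Exponential Markov inequality with parameter \<open>\<mu>\<close>, and independence of
  the rows. Each row gains a fixed factor \<open>q\<close>, for unstructured vectors as well as for
  sparse ones.\<close>

lemma prob_residual_small_le:
  fixes \<tau> c :: real
  assumes J: "J \<subseteq> {..<n}" and y: "1 / 4 \<le> (\<Sum>k<n. (y k)\<^sup>2)" "(\<Sum>k<n. (y k)\<^sup>2) \<le> 4"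
    and \<mu>: "0 < \<mu>" and c: "\<tau> \<le> c * real (card J)"
    and q: "exp (\<mu> * c) * (2 * (1 + row_decay) / (3 + row_decay) + (1 - 2 * (1 + row_decay) / (3 + row_decay)) * exp (- \<mu> * (1 - row_decay))) \<le> q"
  shows "prob {\<omega>\<in>space M. (\<Sum>i\<in>J. (\<Sum>k<n. B i k \<omega> * y k)\<^sup>2) \<le> \<tau>} \<le> q ^ card J"
proof -
  have fJ: "finite J" using J finite_subset by blast
  let ?Z = "\<lambda>i \<omega>. \<Sum>k<n. B i k \<omega> * y k"
  have Zm: "random_variable borel (?Z i)" if "i \<in> J" for i using row_sum_measurable J that by blast
  let ?X = "\<lambda>i \<omega>. exp (- \<mu> * (?Z i \<omega>)\<^sup>2)"
  define q0 where "q0 = 2 * (1 + row_decay) / (3 + row_decay)"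
  define e where "e = exp (- \<mu> * (1 - row_decay))"
  have e: "0 < e" "e < 1" using \<mu> row_decay by (auto simp: e_def)
  have ki: "integrable M (?X i)" if "i \<in> J" for i
    by (rule integrable_const_bound[of _ 1]) (use Zm[OF that] \<mu> in auto)
  have ind: "indep_vars (\<lambda>_. borel) ?X J"
    by (rule row_indep[OF J, of "\<lambda>_ z. exp (- \<mu> * z\<^sup>2)"]) measurable
  let ?A = "{\<omega>\<in>space M. (\<Sum>i\<in>J. (?Z i \<omega>)\<^sup>2) \<le> \<tau>}"
  have Am: "?A \<in> sets M"
  proof -
    have "(\<lambda>\<omega>. \<Sum>i\<in>J. (?Z i \<omega>)\<^sup>2) \<in> borel_measurable M" by (rule borel_measurable_sum) (rule borel_measurable_power[OF Zm])
    then show ?thesis by measurable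
  qed
  have "prob ?A = expectation (indicator ?A)" using Am by simp
  also have "\<dots> \<le> expectation (\<lambda>\<omega>. exp (\<mu> * c) ^ card J * (\<Prod>i\<in>J. ?X i \<omega>))"
  proof (rule Bochner_Integration.integral_mono)
    show "integrable M (indicator ?A :: _ \<Rightarrow> real)" using Am by (simp add: emeasure_eq_measure)
    show "integrable M (\<lambda>\<omega>. exp (\<mu> * c) ^ card J * (\<Prod>i\<in>J. ?X i \<omega>))"
      using indep_vars_integrable[OF fJ ind ki] by (intro integrable_mult_right) auto
    fix \<omega>
    have eq: "exp (\<mu> * c) ^ card J * (\<Prod>i\<in>J. ?X i \<omega>) = exp (\<mu> * (c * card J - (\<Sum>i\<in>J. (?Z i \<omega>)\<^sup>2)))"
      using fJ by (simp add: exp_sum[symmetric] exp_of_nat_mult[symmetric] exp_add[symmetric] sum_negf sum_distrib_left algebra_simps)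
    show "indicator ?A \<omega> \<le> exp (\<mu> * c) ^ card J * (\<Prod>i\<in>J. ?X i \<omega>)"
    proof (cases "\<omega> \<in> ?A")
      case True
      then show ?thesis unfolding eq using c \<mu> by simp
    next
      case False
      show ?thesis unfolding eq using False by simp
    qed
  qed
  also have "\<dots> = exp (\<mu> * c) ^ card J * (\<Prod>i\<in>J. expectation (?X i))"
    by (simp only: integral_mult_right_zero indep_vars_lebesgue_integral[OF fJ ind ki])
  also have "\<dots> \<le> exp (\<mu> * c) ^ card J * (\<Prod>i\<in>J. q0 + (1 - q0) * e)"
  proof (intro mult_left_mono prod_mono conjI)
    fix i assume i: "i \<in> J"
    then have i': "i < n" using J by auto
    show "0 \<le> expectation (?X i)" by (intro Bochner_Integration.integral_nonneg) auto
    let ?S = "{\<omega>\<in>space M. \<bar>?Z i \<omega>\<bar> \<le> sqrt (1 - row_decay)}"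
    have S: "?S \<in> sets M" using Zm[OF i] by measurable
    have "expectation (?X i) \<le> expectation (\<lambda>\<omega>. e + (1 - e) * indicator ?S \<omega>)"
    proof (rule Bochner_Integration.integral_mono[OF ki[OF i]])
      show "integrable M (\<lambda>\<omega>. e + (1 - e) * indicator ?S \<omega>)" using S by (simp add: emeasure_eq_measure)
      fix \<omega> assume \<omega>: "\<omega> \<in> space M"
      show "?X i \<omega> \<le> e + (1 - e) * indicator ?S \<omega>"
      proof (cases "\<omega> \<in> ?S")
        case True
        then show ?thesis using \<mu> by simp
      next
        case False
        then have "sqrt (1 - row_decay) \<le> \<bar>?Z i \<omega>\<bar>" using \<omega> by auto
        then have "(sqrt (1 - row_decay))\<^sup>2 \<le> \<bar>?Z i \<omega>\<bar>\<^sup>2" using row_decay by (intro power_mono) auto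
        then have "1 - row_decay \<le> (?Z i \<omega>)\<^sup>2" using row_decay by simp
        then have "?X i \<omega> \<le> e" unfolding e_def using \<mu> by simp
        then show ?thesis using False by simp
      qed
    qed
    also have "\<dots> = e + (1 - e) * prob ?S" using S by (simp add: prob_space emeasure_eq_measure)
    also have "\<dots> \<le> e + (1 - e) * q0"
      unfolding q0_def using e by (intro add_left_mono mult_left_mono prob_row_small_le i' y) auto
    finally show "expectation (?X i) \<le> q0 + (1 - q0) * e" by (simp add: algebra_simps)
  qed auto
  also have "\<dots> = (exp (\<mu> * c) * (q0 + (1 - q0) * e)) ^ card J"
    by (simp add: power_mult_distrib)
  also have "\<dots> \<le> q ^ card J"
  proof (rule power_mono)
    show "exp (\<mu> * c) * (q0 + (1 - q0) * e) \<le> q" using q by (simp add: q0_def e_def)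
    have "0 \<le> q0" "q0 \<le> 1" using row_decay by (auto simp: q0_def field_simps)
    then show "0 \<le> exp (\<mu> * c) * (q0 + (1 - q0) * e)" using e by (intro mult_nonneg_nonneg add_nonneg_nonneg) auto
  qed
  finally show ?thesis .
qed

end

subsection \<open>Compressible vectors\<close>

lemma nn_integral_normal_density:
  assumes "0 < \<sigma>" shows "(\<integral>\<^sup>+x. ennreal (normal_density \<mu> \<sigma> x) \<partial>lborel) = 1"
  using assms by (subst nn_integral_eq_integral) (auto intro!: AE_I2 integrable_normal_density simp: integral_normal_density)

text \<open>A volume is bounded as a probability would be by an exponential moment: a product
  majorant decouples the coordinates.\<close>

lemma emeasure_le_prod_nn_integral:
  fixes g :: "nat \<Rightarrow> real \<Rightarrow> ennreal"
  assumes "W \<in> sets (lebesgue_on_nat n)" and g: "\<And>k. g k \<in> borel_measurable borel"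
    and "\<And>y. y \<in> W \<Longrightarrow> 1 \<le> C * (\<Prod>k<n. g k (y k))" and "\<And>k. k < n \<Longrightarrow> (\<integral>\<^sup>+z. g k z \<partial>lborel) \<le> G"
  shows "emeasure (lebesgue_on_nat n) W \<le> C * G ^ n"
proof -
  have "emeasure (lebesgue_on_nat n) W = (\<integral>\<^sup>+y. indicator W y \<partial>lebesgue_on_nat n)"
    using assms(1) by simp
  also have "\<dots> \<le> (\<integral>\<^sup>+y. C * (\<Prod>k<n. g k (y k)) \<partial>lebesgue_on_nat n)"
    by (intro nn_integral_mono) (use assms(3) in \<open>auto simp: indicator_def\<close>)
  also have "\<dots> = C * (\<integral>\<^sup>+y. (\<Prod>k<n. g k (y k)) \<partial>lebesgue_on_nat n)"
  proof (rule nn_integral_cmult)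
    show "(\<lambda>y. \<Prod>k<n. g k (y k)) \<in> borel_measurable (lebesgue_on_nat n)"
    proof (rule borel_measurable_prod_ennreal)
      fix k assume "k \<in> {..<n}"
      then have "(\<lambda>y. y k) \<in> lebesgue_on_nat n \<rightarrow>\<^sub>M borel"
        using measurable_component_singleton[of k "{..<n}" "\<lambda>_. lborel"] by simp
      then show "(\<lambda>y. g k (y k)) \<in> borel_measurable (lebesgue_on_nat n)" using g by (rule measurable_compose)
    qed
  qed
  also have "(\<integral>\<^sup>+y. (\<Prod>k<n. g k (y k)) \<partial>lebesgue_on_nat n) = (\<Prod>k<n. \<integral>\<^sup>+z. g k z \<partial>lborel)"
    by (rule lborel_product.product_nn_integral_prod) (use g in auto)
  also have "\<dots> \<le> (\<Prod>k<n. G)" by (intro prod_mono_ennreal) (use assms(4) in auto)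
  finally show ?thesis by (simp add: mult_left_mono)
qed

lemma component_borel: "k < n \<Longrightarrow> (\<lambda>y. y k) \<in> borel_measurable (lebesgue_on_nat n)"
  using measurable_component_singleton[of k "{..<n}" "\<lambda>_. lborel"] by simp

lemma L2_set_perturb:
  fixes x y :: "nat \<Rightarrow> real"
  assumes "L2_set x {..<n} = 1" "\<And>k. k < n \<Longrightarrow> \<bar>y k - x k\<bar> \<le> c / sqrt n" "0 \<le> c" "c \<le> 1 / 2" "0 < n"
  shows "1 / 4 \<le> (\<Sum>k<n. (y k)\<^sup>2)" "(\<Sum>k<n. (y k)\<^sup>2) \<le> 4"
proof -
  have d: "L2_set (\<lambda>k. y k - x k) {..<n} \<le> 1 / 2"
  proof -
    have "L2_set (\<lambda>k. y k - x k) {..<n} = L2_set (\<lambda>k. \<bar>y k - x k\<bar>) {..<n}" by (simp add: L2_set_def)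
    also have "\<dots> \<le> L2_set (\<lambda>k. c / sqrt n) {..<n}"
      by (rule L2_set_mono) (use assms in auto)
    also have "\<dots> = c" using assms by (simp add: L2_set_def power_divide)
    finally show ?thesis using assms by simp
  qed
  have "L2_set (\<lambda>k. x k + (y k - x k)) {..<n} \<le> L2_set x {..<n} + L2_set (\<lambda>k. y k - x k) {..<n}"
    by (rule L2_set_triangle_ineq)
  then have u: "L2_set y {..<n} \<le> 2" using d assms(1) by simp
  have "L2_set (\<lambda>k. y k + (x k - y k)) {..<n} \<le> L2_set y {..<n} + L2_set (\<lambda>k. x k - y k) {..<n}"
    by (rule L2_set_triangle_ineq)
  moreover have "L2_set (\<lambda>k. x k - y k) {..<n} = L2_set (\<lambda>k. y k - x k) {..<n}"
    by (simp add: L2_set_def power2_commute)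
  ultimately have l: "1 / 2 \<le> L2_set y {..<n}" using d assms(1) by simp
  have sq: "(L2_set y {..<n})\<^sup>2 = (\<Sum>k<n. (y k)\<^sup>2)" by (simp add: L2_set_def sum_nonneg)
  show "1 / 4 \<le> (\<Sum>k<n. (y k)\<^sup>2)" using power_mono[OF l, of 2] by (simp add: sq power_divide)
  show "(\<Sum>k<n. (y k)\<^sup>2) \<le> 4" using power_mono[OF u, of 2] by (simp add: sq)
qed

lemma card_eq_sum_indicator:
  fixes y :: "nat \<Rightarrow> real"
  shows "(\<Sum>k<n. indicator S (y k) :: real) = real (card {k. k < n \<and> y k \<in> S})"
proof -
  have "{..<n} \<inter> {k. y k \<in> S} = {k. k < n \<and> y k \<in> S}" by auto
  moreover have "(\<Sum>k<n. indicator S (y k) :: real) = (\<Sum>k<n. if y k \<in> S then 1 else 0)"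
    by (rule sum.cong) (auto simp: indicator_def)
  ultimately show ?thesis
    using sum.If_cases[of "{..<n}" "\<lambda>k. y k \<in> S" "\<lambda>_. 1::real" "\<lambda>_. 0"] by simp
qed

text \<open>
  Integrate against products of the weight \<open>\<one>\<^bsub>[-r, r]\<^esub> + \<zeta> g\<close>, where \<open>g\<close> is a Gaussian density: its integral
  barely exceeds \<open>2 r\<close>, yet its products are not small at vectors with few coordinates outside \<open>[-r, r]\<close>.
\<close>

lemma emeasure_few_large_coordinates:
  fixes c1 \<gamma> \<zeta> r :: real
  assumes n: "0 < n" and c1: "0 < c1" and r: "0 \<le> r" and \<zeta>: "0 < \<zeta>"
    and \<gamma>: "\<gamma> = \<zeta> * sqrt (c1 * n / (2 * pi))" "\<gamma> \<le> 1"
  shows "emeasure (lebesgue_on_nat n) {y\<in>space (lebesgue_on_nat n).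
      (\<Sum>k<n. (y k)\<^sup>2) \<le> 4 \<and> (\<Sum>k<n. indicator {z. r < \<bar>z\<bar>} (y k)) \<le> c1 * n}
    \<le> ennreal (\<gamma> powr (- (c1 * n)) * exp (2 * c1 * n) * (2 * r + \<zeta>) ^ n)"
    (is "emeasure ?L ?W \<le> _")
proof -
  \<comment> \<open>With this variance the Gaussian factors lose at most
    \<open>exp (- (2 * c1 * n))\<close> in total on the ball of radius 2. Then
    \<open>\<gamma>\<close> is the peak of \<open>\<zeta>\<close> times the density, which is the
    price of one large coordinate.\<close>
  define \<sigma> where "\<sigma> = 1 / sqrt (c1 * n)"
  have \<sigma>: "0 < \<sigma>" using c1 n by (simp add: \<sigma>_def)
  have s2: "\<sigma>\<^sup>2 = 1 / (c1 * n)" using c1 n by (simp add: \<sigma>_def power_divide)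
  define g where "g z = indicator {-r..r} z + \<zeta> * normal_density 0 \<sigma> z" for z
  have g0: "0 \<le> g z" for z unfolding g_def using \<zeta> by (intro add_nonneg_nonneg mult_nonneg_nonneg normal_density_nonneg) auto
  have \<gamma>0: "0 < \<gamma>" unfolding \<gamma>(1) using \<zeta> c1 n by simp
  have nd: "\<zeta> * normal_density 0 \<sigma> z = \<gamma> * exp (- (c1 * n * z\<^sup>2 / 2))" for z
  proof -
    have "1 / sqrt (2 * pi * \<sigma>\<^sup>2) = sqrt (c1 * n / (2 * pi))"
      unfolding s2 using c1 n by (simp add: real_sqrt_divide)
    then show ?thesis unfolding normal_density_def \<gamma>(1) s2 using c1 n by (simp add: mult_ac)
  qed
  \<comment> \<open>Outside \<open>[-r, r]\<close> the Gaussian part supplies the factor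
    \<open>\<gamma>\<close>; inside, the indicator supplies 1.\<close>
  have gl: "\<gamma> powr (indicator {z. r < \<bar>z\<bar>} z) * exp (- (c1 * n * z\<^sup>2 / 2)) \<le> g z" for z
  proof (cases "r < \<bar>z\<bar>")
    case True
    then show ?thesis using \<gamma>0 by (simp add: g_def nd)
  next
    case False
    then have "z \<in> {-r..r}" by auto
    then have "g z = 1 + \<gamma> * exp (- (c1 * n * z\<^sup>2 / 2))" by (simp only: g_def nd indicator_simps)
    moreover have "exp (- (c1 * n * z\<^sup>2 / 2)) \<le> 1" using c1 by simp
    moreover have "0 \<le> \<gamma> * exp (- (c1 * n * z\<^sup>2 / 2))" using \<gamma>0 by simp
    moreover have "\<gamma> powr (indicator {z. r < \<bar>z\<bar>} z) * exp (- (c1 * n * z\<^sup>2 / 2)) = exp (- (c1 * n * z\<^sup>2 / 2))"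
      using False \<gamma>0 by simp
    ultimately show ?thesis by linarith
  qed
  let ?C = "\<gamma> powr (- (c1 * n)) * exp (2 * c1 * n)"
  have C0: "0 \<le> ?C" by simp
  have Wm: "?W \<in> sets ?L"
  proof -
    have "(\<lambda>y. \<Sum>k<n. (y k)\<^sup>2) \<in> borel_measurable ?L"
      by (rule borel_measurable_sum) (auto intro!: borel_measurable_power component_borel)
    moreover have "(\<lambda>y. \<Sum>k<n. indicator {z. r < \<bar>z\<bar>} (y k) :: real) \<in> borel_measurable ?L"
    proof (rule borel_measurable_sum)
      fix k assume "k \<in> {..<n}"
      then have "(\<lambda>y. y k) \<in> borel_measurable ?L" by (auto intro: component_borel)
      moreover have "(indicator {z. r < \<bar>z\<bar>} :: real \<Rightarrow> real) \<in> borel_measurable borel" by measurable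
      ultimately show "(\<lambda>y. indicator {z. r < \<bar>z\<bar>} (y k) :: real) \<in> borel_measurable ?L" by (rule measurable_compose)
    qed
    ultimately show ?thesis by measurable
  qed
  have "emeasure ?L ?W \<le> ennreal ?C * ennreal (2 * r + \<zeta>) ^ n"
  proof (rule emeasure_le_prod_nn_integral[OF Wm, where g = "\<lambda>_ z. ennreal (g z)"])
    show "(\<lambda>z. ennreal (g z)) \<in> borel_measurable borel" unfolding g_def by measurable
    show "(\<integral>\<^sup>+z. ennreal (g z) \<partial>lborel) \<le> ennreal (2 * r + \<zeta>)"
    proof -
      have "(\<integral>\<^sup>+z. ennreal (g z) \<partial>lborel) = (\<integral>\<^sup>+z. indicator {-r..r} z + ennreal \<zeta> * ennreal (normal_density 0 \<sigma> z) \<partial>lborel)"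
        unfolding g_def using \<zeta> by (intro nn_integral_cong) (simp add: ennreal_mult'[symmetric] ennreal_indicator[symmetric] del: ennreal_indicator)
      also have "\<dots> = ennreal (2 * r) + ennreal \<zeta>"
        using r by (subst nn_integral_add) (auto simp: nn_integral_cmult nn_integral_normal_density[OF \<sigma>])
      finally show ?thesis using r \<zeta> by simp
    qed
    fix y assume y: "y \<in> ?W"
    have "\<gamma> powr (c1 * n) * exp (- (2 * c1 * n)) \<le> \<gamma> powr (\<Sum>k<n. indicator {z. r < \<bar>z\<bar>} (y k)) * exp (\<Sum>k<n. - (c1 * n * (y k)\<^sup>2 / 2))"
    proof (intro mult_mono)
      show "\<gamma> powr (c1 * n) \<le> \<gamma> powr (\<Sum>k<n. indicator {z. r < \<bar>z\<bar>} (y k))"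
        using y \<gamma>0 \<gamma>(2) by (intro powr_mono') auto
      have "(c1 * n / 2) * (\<Sum>k<n. (y k)\<^sup>2) \<le> (c1 * n / 2) * 4"
        using y c1 by (intro mult_left_mono) auto
      then show "exp (- (2 * c1 * n)) \<le> exp (\<Sum>k<n. - (c1 * n * (y k)\<^sup>2 / 2))"
        by (simp add: sum_negf sum_distrib_left)
    qed auto
    also have "\<dots> = (\<Prod>k<n. \<gamma> powr (indicator {z. r < \<bar>z\<bar>} (y k)) * exp (- (c1 * n * (y k)\<^sup>2 / 2)))"
      using \<gamma>0 by (simp add: prod.distrib exp_sum powr_sum)
    also have "\<dots> \<le> (\<Prod>k<n. g (y k))" by (intro prod_mono conjI gl) auto
    finally have "?C * (\<gamma> powr (c1 * n) * exp (- (2 * c1 * n))) \<le> ?C * (\<Prod>k<n. g (y k))"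
      by (intro mult_left_mono C0)
    moreover have "?C * (\<gamma> powr (c1 * n) * exp (- (2 * c1 * n))) = 1"
      using \<gamma>0 by (simp add: powr_minus exp_minus field_simps)
    ultimately have "ennreal 1 \<le> ennreal (?C * (\<Prod>k<n. g (y k)))" by (intro ennreal_leI) simp
    also have "\<dots> = ennreal ?C * ennreal (\<Prod>k<n. g (y k))" by (rule ennreal_mult'[OF C0])
    also have "ennreal (\<Prod>k<n. g (y k)) = (\<Prod>k<n. ennreal (g (y k)))" using g0 by (simp add: prod_ennreal)
    finally show "1 \<le> ennreal ?C * (\<Prod>k<n. ennreal (g (y k)))" by simp
  qed
  also have "\<dots> = ennreal (?C * (2 * r + \<zeta>) ^ n)"
    using r \<zeta> by (simp only: ennreal_power[OF add_nonneg_nonneg[OF mult_nonneg_nonneg[of 2 r]]] ennreal_mult'[OF C0, symmetric])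
  finally show ?thesis .
qed

context anticoncentrated_matrix
begin

text \<open>Volume balance: compressible vectors fill at most
  \<open>(2 * h * \<kappa>\<^sup>2) ^ n\<close>, a box retains half of
  \<open>(2 * h / \<kappa>) ^ n\<close>, and the rows gain \<open>q ^ card I\<close>. The entropy
  thus costs \<open>\<kappa> ^ 3\<close> per dimension, which can be brought close to 1 while
  \<open>q\<close> stays fixed.\<close>

lemma compressible_event:
  fixes R \<kappa> c\<^sub>h \<rho> c1 \<zeta> t \<mu> c q :: real
  assumes I: "I \<subseteq> {..<n}" "n \<le> card I + 1" and n2: "2 \<le> n"
    and pos: "0 < R" "0 < \<kappa>" "0 < c\<^sub>h" "c\<^sub>h \<le> 1 / 2" "0 < \<rho>" "0 < c1" "0 < \<zeta>" "0 \<le> t" "0 < \<mu>" "0 < q" "q < 1"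
    and row: "exp (\<mu> * c) * (2 * (1 + row_decay) / (3 + row_decay) + (1 - 2 * (1 + row_decay) / (3 + row_decay)) * exp (- \<mu> * (1 - row_decay))) \<le> q"
    and tc: "2 * (t + 2 * c\<^sub>h * R * sqrt K)\<^sup>2 \<le> c"
    and \<zeta>: "1 + \<rho> / c\<^sub>h + \<zeta> \<le> \<kappa>"
    and \<gamma>: "2 * c\<^sub>h * \<zeta> * sqrt (c1 / (2 * pi)) \<le> 1"
      "(2 * c\<^sub>h * \<zeta> * sqrt (c1 / (2 * pi))) powr (- c1) * exp (2 * c1) \<le> \<kappa>"
  obtains E where "E \<in> events" "prob E \<le> ((1 + 1 / R\<^sup>2) / \<kappa>\<^sup>2) ^ n + 2 / q * (q * \<kappa> ^ 3) ^ n"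
    "\<And>\<omega> x. \<omega> \<in> space M - E \<Longrightarrow> L2_set x {..<n} = 1 \<Longrightarrow>
      real (card {k. k < n \<and> \<rho> / sqrt n < \<bar>x k\<bar>}) \<le> c1 * n \<Longrightarrow>
      L2_set (mat_vec n (\<lambda>i j. B i j \<omega>) x) I \<le> t * sqrt n \<Longrightarrow> False"
proof -
  let ?L = "lebesgue_on_nat n"
  define h where "h = c\<^sub>h / sqrt n"
  \<comment> \<open>Coordinates of \<open>x\<close> of size at most \<open>\<rho> / sqrt n\<close>
    stay within this threshold throughout the box, so the box around a compressible vector lies in
    \<open>W\<close>.\<close>
  define r where "r = h + \<rho> / sqrt n"
  define \<zeta>' where "\<zeta>' = 2 * h * \<zeta>"
  define \<gamma> where "\<gamma> = 2 * c\<^sub>h * \<zeta> * sqrt (c1 / (2 * pi))"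
  have h: "0 < h" unfolding h_def using pos n_pos by simp
  have \<gamma>0: "0 < \<gamma>" unfolding \<gamma>_def using pos by simp
  let ?W0 = "{y\<in>space ?L. (\<Sum>k<n. (y k)\<^sup>2) \<le> 4 \<and> (\<Sum>k<n. indicator {z. r < \<bar>z\<bar>} (y k)) \<le> c1 * n}"
  define W where "W = {y\<in>space ?L. 1 / 4 \<le> (\<Sum>k<n. (y k)\<^sup>2) \<and> (\<Sum>k<n. (y k)\<^sup>2) \<le> 4 \<and> (\<Sum>k<n. indicator {z. r < \<bar>z\<bar>} (y k)) \<le> c1 * n}"
  define w where "w = \<gamma> powr (- (c1 * n)) * exp (2 * c1 * n) * (2 * r + \<zeta>') ^ n"
  have w0: "0 \<le> w" unfolding w_def r_def \<zeta>'_def using h pos by (intro mult_nonneg_nonneg zero_le_power add_nonneg_nonneg) auto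
  have m1: "(\<lambda>y. \<Sum>k<n. (y k)\<^sup>2) \<in> borel_measurable ?L"
    by (rule borel_measurable_sum) (auto intro!: borel_measurable_power component_borel)
  have m2: "(\<lambda>y. \<Sum>k<n. indicator {z. r < \<bar>z\<bar>} (y k) :: real) \<in> borel_measurable ?L"
  proof (rule borel_measurable_sum)
    fix k assume "k \<in> {..<n}"
    then have "(\<lambda>y. y k) \<in> borel_measurable ?L" by (auto intro: component_borel)
    moreover have "(indicator {z. r < \<bar>z\<bar>} :: real \<Rightarrow> real) \<in> borel_measurable borel" by measurable
    ultimately show "(\<lambda>y. indicator {z. r < \<bar>z\<bar>} (y k) :: real) \<in> borel_measurable ?L" by (rule measurable_compose)
  qed
  have W: "W \<in> sets ?L" unfolding W_def using m1 m2 by measurable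
  have "emeasure ?L W \<le> emeasure ?L ?W0"
    by (rule emeasure_mono) (use m1 m2 in \<open>auto simp: W_def\<close>)
  also have "\<dots> \<le> ennreal w"
    unfolding w_def
  proof (rule emeasure_few_large_coordinates)
    show "\<gamma> = \<zeta>' * sqrt (c1 * n / (2 * pi))"
      using n_pos by (simp add: \<gamma>_def \<zeta>'_def h_def real_sqrt_mult real_sqrt_divide)
  qed (use n_pos pos h \<gamma> in \<open>auto simp: r_def \<zeta>'_def \<gamma>_def\<close>)
  finally have Ww: "emeasure ?L W \<le> ennreal w" .
  obtain E where E: "E \<in> events" "prob E \<le> ((1 + 1 / R\<^sup>2) / \<kappa>\<^sup>2) ^ n + 2 * q ^ card I * w * (\<kappa> / (2 * h)) ^ n"
    "\<And>\<omega> x. \<omega> \<in> space M - E \<Longrightarrow> L2_set (mat_vec n (\<lambda>i j. B i j \<omega>) x) I \<le> t * sqrt n \<Longrightarrow>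
      (\<And>y. y \<in> space ?L \<Longrightarrow> (\<forall>k<n. \<bar>y k - x k\<bar> \<le> h) \<Longrightarrow> y \<in> W) \<Longrightarrow> False"
  proof (rule volume_union_bound[OF I(1) pos(1,2) h _ W Ww w0, of "t * sqrt n" "q ^ card I"])
    fix y assume y: "y \<in> W"
    have T: "t * sqrt n + 2 * h * R * sqrt K * n = (t + 2 * c\<^sub>h * R * sqrt K) * sqrt n"
      unfolding h_def using n_pos by (simp add: field_simps real_sqrt_mult[symmetric])
    have T0: "0 \<le> (t + 2 * c\<^sub>h * R * sqrt K) * sqrt n" using pos K_pos by simp
    have "prob {\<omega>\<in>space M. L2_set (mat_vec n (\<lambda>i j. B i j \<omega>) y) I \<le> t * sqrt n + 2 * h * R * sqrt K * n}
      = prob {\<omega>\<in>space M. (\<Sum>i\<in>I. (\<Sum>k<n. B i k \<omega> * y k)\<^sup>2) \<le> ((t + 2 * c\<^sub>h * R * sqrt K) * sqrt n)\<^sup>2}"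
      unfolding T L2_set_le_iff[OF T0] by (simp add: mat_vec_def)
    also have "\<dots> \<le> q ^ card I"
    proof (rule prob_residual_small_le[OF I(1) _ _ pos(9) _ row])
      have "((t + 2 * c\<^sub>h * R * sqrt K) * sqrt n)\<^sup>2 = 2 * (t + 2 * c\<^sub>h * R * sqrt K)\<^sup>2 * (n / 2)"
        by (simp add: power_mult_distrib)
      also have "\<dots> \<le> c * (n / 2)" using tc by (intro mult_right_mono) auto
      also have "\<dots> \<le> c * card I"
      proof (rule mult_left_mono)
        show "real n / 2 \<le> real (card I)" using I(2) n2 by linarith
        show "0 \<le> c" using tc by (meson order_trans zero_le_mult_iff zero_le_numeral zero_le_power2)
      qed
      finally show "((t + 2 * c\<^sub>h * R * sqrt K) * sqrt n)\<^sup>2 \<le> c * real (card I)" .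
    qed (use y in \<open>auto simp: W_def\<close>)
    finally show "prob {\<omega>\<in>space M. L2_set (mat_vec n (\<lambda>i j. B i j \<omega>) y) I \<le> t * sqrt n + 2 * h * R * sqrt K * n} \<le> q ^ card I" .
  qed (use pos in auto)
  show thesis
  proof (rule that[OF E(1)])
    have "2 * q ^ card I * w * (\<kappa> / (2 * h)) ^ n \<le> 2 * (q ^ n / q) * ((\<kappa> * (2 * h * \<kappa>)) ^ n) * (\<kappa> / (2 * h)) ^ n"
    proof (intro mult_mono mult_left_mono)
      \<comment> \<open>At most one row is missing, which costs the factor
        \<open>1 / q\<close>.\<close>
      have "q * q ^ card I \<le> q ^ n" unfolding power_Suc[symmetric]
        using I(2) pos by (intro power_decreasing) auto
      then show "q ^ card I \<le> q ^ n / q" using pos by (simp add: field_simps)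
      have "\<gamma> powr (- (c1 * n)) * exp (2 * c1 * n) = (\<gamma> powr (- c1) * exp (2 * c1)) ^ n"
      proof -
        have "\<gamma> powr (- (c1 * n)) = (\<gamma> powr (- c1)) ^ n"
          using \<gamma>0 by (simp add: powr_powr powr_realpow[symmetric])
        moreover have "exp (2 * c1 * n) = exp (2 * c1) ^ n"
          by (simp add: exp_of_nat_mult[symmetric] mult_ac)
        ultimately show ?thesis by (simp add: power_mult_distrib)
      qed
      moreover have "2 * r + \<zeta>' = 2 * h * (1 + \<rho> / c\<^sub>h + \<zeta>)"
        using pos n_pos unfolding r_def \<zeta>'_def h_def by (simp add: field_simps)
      ultimately have "w = (\<gamma> powr (- c1) * exp (2 * c1) * (2 * h * (1 + \<rho> / c\<^sub>h + \<zeta>))) ^ n"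
        unfolding w_def by (simp add: power_mult_distrib)
      also have "\<dots> \<le> (\<kappa> * (2 * h * \<kappa>)) ^ n"
        using \<gamma>(2) \<zeta> h pos by (intro power_mono mult_mono) (auto simp: \<gamma>_def intro!: mult_nonneg_nonneg add_nonneg_nonneg)
      finally show "w \<le> (\<kappa> * (2 * h * \<kappa>)) ^ n" .
    qed (use pos h w0 in auto)
    also have "\<dots> = 2 / q * (q * \<kappa> ^ 3) ^ n"
    proof -
      have "\<kappa> * (2 * h * \<kappa>) * (\<kappa> / (2 * h)) = \<kappa> ^ 3" using h by (simp add: power3_eq_cube)
      then have "((\<kappa> * (2 * h * \<kappa>)) ^ n) * (\<kappa> / (2 * h)) ^ n = (\<kappa> ^ 3) ^ n"
        by (simp only: power_mult_distrib[symmetric])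
      then show ?thesis by (simp only: power_mult_distrib mult.assoc) simp
    qed
    finally show "prob E \<le> ((1 + 1 / R\<^sup>2) / \<kappa>\<^sup>2) ^ n + 2 / q * (q * \<kappa> ^ 3) ^ n" using E(2) by simp
    fix \<omega> x
    assume \<omega>: "\<omega> \<in> space M - E" and x: "L2_set x {..<n} = 1"
      and sp: "real (card {k. k < n \<and> \<rho> / sqrt n < \<bar>x k\<bar>}) \<le> c1 * n"
      and small: "L2_set (mat_vec n (\<lambda>i j. B i j \<omega>) x) I \<le> t * sqrt n"
    show False
    proof (rule E(3)[OF \<omega> small])
      fix y assume y: "y \<in> space ?L" "\<forall>k<n. \<bar>y k - x k\<bar> \<le> h"
      have "1 / 4 \<le> (\<Sum>k<n. (y k)\<^sup>2)" "(\<Sum>k<n. (y k)\<^sup>2) \<le> 4"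
        using L2_set_perturb[OF x, of y c\<^sub>h] y(2) pos n_pos by (auto simp: h_def)
      moreover have "(\<Sum>k<n. indicator {z. r < \<bar>z\<bar>} (y k)) \<le> c1 * n"
      proof -
        have "card {k. k < n \<and> y k \<in> {z. r < \<bar>z\<bar>}} \<le> card {k. k < n \<and> \<rho> / sqrt n < \<bar>x k\<bar>}"
        proof (rule card_mono)
          show "{k. k < n \<and> y k \<in> {z. r < \<bar>z\<bar>}} \<subseteq> {k. k < n \<and> \<rho> / sqrt n < \<bar>x k\<bar>}"
          proof
            fix k assume "k \<in> {k. k < n \<and> y k \<in> {z. r < \<bar>z\<bar>}}"
            then have k: "k < n" "r < \<bar>y k\<bar>" by auto
            then have "\<bar>y k - x k\<bar> \<le> h" using y(2) by blast
            then show "k \<in> {k. k < n \<and> \<rho> / sqrt n < \<bar>x k\<bar>}" using k by (simp add: r_def)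
          qed
        qed simp
        then show ?thesis unfolding card_eq_sum_indicator using sp by linarith
      qed
      ultimately show "y \<in> W" using y(1) by (simp add: W_def)
    qed
  qed
qed

end

subsection \<open>Incompressible vectors\<close>

context anticoncentrated_matrix
begin

section \<open>Wrapping indices and perturbation of the row oscillation\<close>

definition row_moment :: "nat \<Rightarrow> real" where
  "row_moment i = (\<Sum>k<n. expectation (\<lambda>\<omega>. (B i k \<omega>)\<^sup>2))"

text \<open>
  At frequency \<open>s\<close>, the phases \<open>s y\<^sub>k x\<close> with \<open>\<bar>y\<^sub>k\<bar>\<close> of order \<open>1 / sqrt n\<close> stay within half a
  period for most \<open>x\<close> in the support of the law unless \<open>k\<close> is one of the following indices.
\<close>

definition wrapping :: "real \<Rightarrow> nat \<Rightarrow> real \<Rightarrow> nat set" where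
  "wrapping c\<^sub>T i s = {k. k < n \<and> measure (law i k) {x. 1 \<le> \<bar>x\<bar> \<and> \<bar>x\<bar> \<le> c\<^sub>T * sqrt n / s} < (1 - b) / 2}"

lemma wrapping_mono:
  assumes "0 < s" "s \<le> s'" "0 \<le> c\<^sub>T" "i < n"
  shows "wrapping c\<^sub>T i s \<subseteq> wrapping c\<^sub>T i s'"
proof
  fix k assume k: "k \<in> wrapping c\<^sub>T i s"
  then interpret N: real_distribution "law i k" using assms by (intro real_distribution_law) (auto simp: wrapping_def)
  have "c\<^sub>T * sqrt n / s' \<le> c\<^sub>T * sqrt n / s" using assms by (intro divide_left_mono) auto
  then have "measure (law i k) {x. 1 \<le> \<bar>x\<bar> \<and> \<bar>x\<bar> \<le> c\<^sub>T * sqrt n / s'} \<le> measure (law i k) {x. 1 \<le> \<bar>x\<bar> \<and> \<bar>x\<bar> \<le> c\<^sub>T * sqrt n / s}"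
    by (intro N.finite_measure_mono) (auto simp: N.events_eq_borel)
  then show "k \<in> wrapping c\<^sub>T i s'" using k by (auto simp: wrapping_def)
qed

lemma wrapping_far:
  assumes "k \<in> wrapping c\<^sub>T i s" "i < n"
  shows "(1 - b) / 2 \<le> measure (law i k) {x. c\<^sub>T * sqrt n / s < \<bar>x\<bar>}"
proof -
  have k: "k < n" using assms by (simp add: wrapping_def)
  interpret N: real_distribution "law i k" by (rule real_distribution_law[OF assms(2) k])
  let ?T = "c\<^sub>T * sqrt n / s"
  have "1 - b \<le> N.prob {x. 1 \<le> \<bar>x\<bar>}" using assms(2) k by (intro sym_law_far entry_measurable levy)
  also have "\<dots> \<le> N.prob ({x. 1 \<le> \<bar>x\<bar> \<and> \<bar>x\<bar> \<le> ?T} \<union> {x. ?T < \<bar>x\<bar>})"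
    by (rule N.finite_measure_mono) (auto simp: N.events_eq_borel)
  also have "\<dots> \<le> N.prob {x. 1 \<le> \<bar>x\<bar> \<and> \<bar>x\<bar> \<le> ?T} + N.prob {x. ?T < \<bar>x\<bar>}"
    by (rule measure_Un_le) (auto simp: N.events_eq_borel)
  finally show ?thesis using assms(1) by (simp add: wrapping_def)
qed

text \<open>Each index of \<open>S\<close> has enough mass within half a period, so the oscillation
  grows like \<open>s\<^sup>2\<close> and the characteristic function decays like a
  Gaussian.\<close>

lemma row_osc_ge_nonwrapping:
  assumes i: "i < n" and s: "0 < s" and S: "S \<subseteq> {..<n}" "S \<inter> wrapping c\<^sub>T i s = {}" and pos: "0 \<le> \<rho>" "0 < \<Lambda>" "\<Lambda> * c\<^sub>T \<le> pi" "0 \<le> c\<^sub>T"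
    and y: "\<And>k. k \<in> S \<Longrightarrow> \<rho> / sqrt n \<le> \<bar>y k\<bar> \<and> \<bar>y k\<bar> \<le> \<Lambda> / sqrt n"
  shows "card S * ((1 - b) * \<rho>\<^sup>2 * s\<^sup>2 / (12 * n)) \<le> row_osc i y s"
proof -
  have fS: "finite S" using S finite_subset by blast
  have "card S * ((1 - b) * \<rho>\<^sup>2 * s\<^sup>2 / (12 * n)) = (\<Sum>k\<in>S. (1 - b) * \<rho>\<^sup>2 * s\<^sup>2 / (12 * n))" by simp
  also have "\<dots> \<le> (\<Sum>k\<in>S. osc (law i k) (s * y k))"
  proof (rule sum_mono)
    fix k assume k: "k \<in> S"
    then have kn: "k < n" using S by auto
    interpret N: real_distribution "law i k" by (rule real_distribution_law[OF i kn])
    have p: "(1 - b) / 2 \<le> N.prob {x. 1 \<le> \<bar>x\<bar> \<and> \<bar>x\<bar> \<le> c\<^sub>T * sqrt n / s}"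
      using k S kn by (auto simp: wrapping_def)
    have "\<bar>s * y k\<bar> * (c\<^sub>T * sqrt n / s) = \<bar>y k\<bar> * (c\<^sub>T * sqrt n)" using s by (simp add: abs_mult)
    also have "\<dots> \<le> \<Lambda> / sqrt n * (c\<^sub>T * sqrt n)" using y[OF k] pos by (intro mult_right_mono) auto
    also have "\<dots> \<le> pi" using n_pos pos by simp
    finally have "(1 - b) / 2 * (s * y k)\<^sup>2 / 6 \<le> osc (law i k) (s * y k)" by (rule N.osc_ge_det[OF p])
    moreover have "(\<rho> / sqrt n)\<^sup>2 \<le> \<bar>y k\<bar>\<^sup>2" using y[OF k] pos by (intro power_mono) auto
    then have "\<rho>\<^sup>2 / n \<le> (y k)\<^sup>2" by (simp add: power_divide)
    then have "((1 - b) * s\<^sup>2 / 12) * (\<rho>\<^sup>2 / n) \<le> ((1 - b) * s\<^sup>2 / 12) * (y k)\<^sup>2"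
      using b by (intro mult_left_mono) auto
    moreover have "(1 - b) * \<rho>\<^sup>2 * s\<^sup>2 / (12 * n) = ((1 - b) * s\<^sup>2 / 12) * (\<rho>\<^sup>2 / n)" by simp
    moreover have "(1 - b) / 2 * (s * y k)\<^sup>2 / 6 = ((1 - b) * s\<^sup>2 / 12) * (y k)\<^sup>2" by (simp add: power_mult_distrib)
    ultimately show "(1 - b) * \<rho>\<^sup>2 * s\<^sup>2 / (12 * n) \<le> osc (law i k) (s * y k)" by linarith
  qed
  also have "\<dots> \<le> row_osc i y s"
    unfolding row_osc_def using S(1) i
    by (intro sum_mono2 real_distribution.osc_nonneg real_distribution_law) auto
  finally show ?thesis .
qed

lemma sum_osc_le_row_moment:
  assumes i: "i < n" and u: "\<And>k. k < n \<Longrightarrow> \<bar>u k\<bar> \<le> e"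
  shows "(\<Sum>k<n. osc (law i k) (u k)) \<le> 2 * e\<^sup>2 * row_moment i"
proof -
  have "(\<Sum>k<n. osc (law i k) (u k)) \<le> (\<Sum>k<n. 2 * e\<^sup>2 * expectation (\<lambda>\<omega>. (B i k \<omega>)\<^sup>2))"
  proof (rule sum_mono)
    fix k assume "k \<in> {..<n}"
    then have k: "k < n" by simp
    interpret N: real_distribution "law i k" by (rule real_distribution_law[OF i k])
    note s2 = sym_law_second_moment[OF entry_measurable[OF i k] square_integrable[OF i k]]
    have "(u k)\<^sup>2 \<le> e\<^sup>2" using u[OF k] by (simp add: abs_le_square_iff[symmetric])
    have "osc (law i k) (u k) \<le> (u k)\<^sup>2 / 2 * (\<integral>x. x\<^sup>2 \<partial>law i k)" by (rule N.osc_le_second_moment[OF s2(1)])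
    also have "\<dots> \<le> e\<^sup>2 / 2 * (4 * expectation (\<lambda>\<omega>. (B i k \<omega>)\<^sup>2))"
      using \<open>(u k)\<^sup>2 \<le> e\<^sup>2\<close> s2(2) by (intro mult_mono Bochner_Integration.integral_nonneg) auto
    finally show "osc (law i k) (u k) \<le> 2 * e\<^sup>2 * expectation (\<lambda>\<omega>. (B i k \<omega>)\<^sup>2)" by simp
  qed
  then show ?thesis by (simp add: row_moment_def sum_distrib_left)
qed

text \<open>The triangle inequality for \<open>osc\<close>, valid up to a factor 2, lets vector and
  frequency change at once. The error involves the second moments of the row, which is the reason
  for singling out light rows.\<close>

lemma row_osc_perturb:
  assumes i: "i < n" and u: "\<And>k. k < n \<Longrightarrow> \<bar>s' * y k - s * x k\<bar> \<le> e"
  shows "row_osc i y s' \<le> 2 * row_osc i x s + 4 * e\<^sup>2 * row_moment i"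
proof -
  have "row_osc i y s' \<le> (\<Sum>k<n. 2 * osc (law i k) (s * x k) + 2 * osc (law i k) (s' * y k - s * x k))"
    unfolding row_osc_def
  proof (rule sum_mono)
    fix k assume "k \<in> {..<n}"
    then interpret N: real_distribution "law i k" by (intro real_distribution_law i) auto
    show "osc (law i k) (s' * y k) \<le> 2 * osc (law i k) (s * x k) + 2 * osc (law i k) (s' * y k - s * x k)"
      using N.osc_add_le[of "s * x k" "s' * y k - s * x k"] by simp
  qed
  also have "\<dots> = 2 * row_osc i x s + 2 * (\<Sum>k<n. osc (law i k) (s' * y k - s * x k))"
    by (simp add: row_osc_def sum.distrib sum_distrib_left)
  finally show ?thesis using sum_osc_le_row_moment[OF i, of "\<lambda>k. s' * y k - s * x k" e] u by simp
qed

text \<open>At frequencies up to 1 a wrapping index has symmetrised mass at least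
  \<open>(1 - b) / 2\<close> beyond \<open>c\<^sub>T * sqrt n\<close>, so the entry has a second
  moment of order \<open>n\<close>. The 8 is this 2 times the 4 lost by symmetrisation.\<close>

lemma card_wrapping_le:
  fixes c\<^sub>T :: real
  assumes i: "i < n" and s: "0 < s" "s \<le> 1" and c: "0 < c\<^sub>T"
  shows "card (wrapping c\<^sub>T i s) * (c\<^sub>T\<^sup>2 * n * (1 - b) / 8) \<le> row_moment i"
proof -
  have "card (wrapping c\<^sub>T i s) * (c\<^sub>T\<^sup>2 * n * (1 - b) / 8) = (\<Sum>k\<in>wrapping c\<^sub>T i s. c\<^sub>T\<^sup>2 * n * (1 - b) / 8)" by simp
  also have "\<dots> \<le> (\<Sum>k\<in>wrapping c\<^sub>T i s. expectation (\<lambda>\<omega>. (B i k \<omega>)\<^sup>2))"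
  proof (rule sum_mono)
    fix k assume k: "k \<in> wrapping c\<^sub>T i s"
    then have kn: "k < n" by (simp add: wrapping_def)
    interpret N: real_distribution "law i k" by (rule real_distribution_law[OF i kn])
    note s2 = sym_law_second_moment[OF entry_measurable[OF i kn] square_integrable[OF i kn]]
    let ?T = "c\<^sub>T * sqrt n / s"
    let ?S = "{x. ?T < \<bar>x\<bar>}"
    have S: "?S \<in> N.events" by (simp add: N.events_eq_borel)
    have T: "c\<^sub>T * sqrt n \<le> ?T" using s c by (simp add: pos_le_divide_eq mult_left_le)
    have "(c\<^sub>T * sqrt n)\<^sup>2 * ((1 - b) / 2) \<le> (c\<^sub>T * sqrt n)\<^sup>2 * N.prob ?S"
      using wrapping_far[OF k i] by (intro mult_left_mono) auto
    also have "\<dots> = (\<integral>x. (c\<^sub>T * sqrt n)\<^sup>2 * indicator ?S x \<partial>law i k)" using S by simp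
    also have "\<dots> \<le> (\<integral>x. x\<^sup>2 \<partial>law i k)"
    proof (rule Bochner_Integration.integral_mono[OF _ s2(1)])
      show "integrable (law i k) (\<lambda>x. (c\<^sub>T * sqrt n)\<^sup>2 * indicator ?S x)"
        using S by (intro integrable_mult_right) (simp add: N.emeasure_eq_measure)
      show "(c\<^sub>T * sqrt n)\<^sup>2 * indicator ?S x \<le> x\<^sup>2" for x
      proof (cases "x \<in> ?S")
        case True
        then have "c\<^sub>T * sqrt n \<le> \<bar>x\<bar>" using T by auto
        then have "(c\<^sub>T * sqrt n)\<^sup>2 \<le> \<bar>x\<bar>\<^sup>2" using c by (intro power_mono) auto
        then show ?thesis using True by simp
      qed auto
    qed
    finally show "c\<^sub>T\<^sup>2 * n * (1 - b) / 8 \<le> expectation (\<lambda>\<omega>. (B i k \<omega>)\<^sup>2)"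
      using s2(2) by (simp add: power_mult_distrib)
  qed
  also have "\<dots> \<le> row_moment i"
    unfolding row_moment_def by (rule sum_mono2) (auto simp: wrapping_def intro!: Bochner_Integration.integral_nonneg)
  finally show ?thesis .
qed

section \<open>The volume of resonant vectors\<close>

definition resonant_set :: "real \<Rightarrow> real \<Rightarrow> real \<Rightarrow> real \<Rightarrow> nat \<Rightarrow> real \<Rightarrow> (nat \<Rightarrow> real) set" where
  "resonant_set c\<^sub>T \<Lambda> c2 \<eta> i s = {y\<in>space (lebesgue_on_nat n). (\<Sum>k<n. (y k)\<^sup>2) \<le> 4 \<and>
     c2 * n / 2 \<le> card {k\<in>wrapping c\<^sub>T i s. \<bar>y k\<bar> \<le> \<Lambda> / sqrt n} \<and> row_osc i y s \<le> 5 * \<eta> * n}"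

lemma row_osc_measurable: "i < n \<Longrightarrow> (\<lambda>y. row_osc i y s) \<in> borel_measurable (lebesgue_on_nat n)"
proof -
  assume i: "i < n"
  have "(\<lambda>y. osc (law i k) (s * y k)) \<in> borel_measurable (lebesgue_on_nat n)" if "k < n" for k
  proof -
    interpret N: real_distribution "law i k" by (rule real_distribution_law[OF i that])
    show ?thesis
      by (rule measurable_compose[OF _ N.osc_measurable]) (use component_borel[OF that] in measurable)
  qed
  then show ?thesis unfolding row_osc_def by (intro borel_measurable_sum) auto
qed

lemma resonant_set_measurable:
  assumes i: "i < n"
  shows "resonant_set c\<^sub>T \<Lambda> c2 \<eta> i s \<in> sets (lebesgue_on_nat n)"
proof -
  let ?L = "lebesgue_on_nat n"
  let ?R = "wrapping c\<^sub>T i s"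
  have fR: "finite ?R" by (simp add: wrapping_def)
  have card: "real (card {k\<in>?R. \<bar>y k\<bar> \<le> \<Lambda> / sqrt n}) = (\<Sum>k\<in>?R. indicator {z. \<bar>z\<bar> \<le> \<Lambda> / sqrt n} (y k))" for y :: "nat \<Rightarrow> real"
  proof -
    have "(\<Sum>k\<in>?R. indicator {z. \<bar>z\<bar> \<le> \<Lambda> / sqrt n} (y k)) = (\<Sum>k\<in>?R. if \<bar>y k\<bar> \<le> \<Lambda> / sqrt n then 1 else (0::real))"
      by (rule sum.cong) (auto simp: indicator_def)
    moreover have "?R \<inter> {k. \<bar>y k\<bar> \<le> \<Lambda> / sqrt n} = {k\<in>?R. \<bar>y k\<bar> \<le> \<Lambda> / sqrt n}" by auto
    ultimately show ?thesis using fR by (simp add: sum.If_cases)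
  qed
  have "(\<lambda>y. \<Sum>k<n. (y k)\<^sup>2) \<in> borel_measurable ?L"
    by (rule borel_measurable_sum) (auto intro!: borel_measurable_power component_borel)
  moreover have "(\<lambda>y. \<Sum>k\<in>?R. indicator {z. \<bar>z\<bar> \<le> \<Lambda> / sqrt n} (y k) :: real) \<in> borel_measurable ?L"
  proof (rule borel_measurable_sum)
    fix k assume "k \<in> ?R"
    then have "(\<lambda>y. y k) \<in> borel_measurable ?L" by (auto intro: component_borel simp: wrapping_def)
    moreover have "(indicator {z. \<bar>z\<bar> \<le> \<Lambda> / sqrt n} :: real \<Rightarrow> real) \<in> borel_measurable borel" by measurable
    ultimately show "(\<lambda>y. indicator {z. \<bar>z\<bar> \<le> \<Lambda> / sqrt n} (y k) :: real) \<in> borel_measurable ?L" by (rule measurable_compose)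
  qed
  ultimately show ?thesis unfolding resonant_set_def card using row_osc_measurable[OF i] by measurable
qed

text \<open>The majorant is a product of Gaussian densities of variance \<open>1 / n\<close>, tilted
  by \<open>1 / \<delta>\<close> on the sets \<open>e k\<close>. As \<open>e k\<close> has length at
  most \<open>\<delta> / sqrt n\<close> and the density is at most \<open>sqrt n\<close>, the tilt
  at most doubles each integral, whereas a resonant vector collects the factor
  \<open>1 / \<delta>\<close> at least \<open>c2 * n / 4\<close> times.\<close>

lemma emeasure_resonant_set_le:
  assumes i: "i < n" and s: "0 < s" and pos: "0 < c\<^sub>T" "0 < \<Lambda>" "0 < c2" "0 < \<eta>"
    and \<delta>: "4 * sqrt (6 * (80 * \<eta> / (c2 * (1 - b)))) / ((1 - b) / 2) * (\<Lambda> + 3 / c\<^sub>T) \<le> \<delta>" "0 < \<delta>" "\<delta> \<le> 1"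
  shows "emeasure (lebesgue_on_nat n) (resonant_set c\<^sub>T \<Lambda> c2 \<eta> i s)
    \<le> ennreal (\<delta> powr (c2 * n / 4) * (2 * sqrt (2 * pi) * exp 2 / sqrt n) ^ n)"
proof -
  let ?R = "wrapping c\<^sub>T i s"
  let ?r = "80 * \<eta> / (c2 * (1 - b))"
  \<comment> \<open>If fewer than \<open>c2 * n / 4\<close> coordinates fell below this threshold,
    the remaining wrapping ones would contribute more than
    \<open>c2 * n / 4 * (20 * \<eta> / c2) = 5 * \<eta> * n\<close>. The 80 in \<open>?r\<close>
    makes the threshold equal to \<open>?r * ((1 - b) / 2) / 2\<close>.\<close>
  define F where "F k = {z. \<bar>z\<bar> \<le> \<Lambda> / sqrt n \<and> osc (law i k) (s * z) \<le> 20 * \<eta> / c2}" for k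
  define \<sigma> where "\<sigma> = 1 / sqrt n"
  have \<sigma>: "0 < \<sigma>" using n_pos by (simp add: \<sigma>_def)
  have s2: "\<sigma>\<^sup>2 = 1 / n" using n_pos by (simp add: \<sigma>_def power_divide)
  let ?t = "1 / \<delta>"
  define e where "e k = (if k \<in> ?R then F k else {})" for k
  define g where "g k z = normal_density 0 \<sigma> z * (1 + (?t - 1) * indicator (e k) z)" for k z
  have t1: "1 \<le> ?t" using \<delta> by simp
  have em: "e k \<in> sets borel" for k
  proof (cases "k \<in> ?R")
    case True
    then interpret N: real_distribution "law i k" by (intro real_distribution_law i) (auto simp: wrapping_def)
    show ?thesis using True unfolding e_def F_def by simp
  qed (simp add: e_def)
  have eL: "emeasure lborel (e k) \<le> ennreal (\<delta> / sqrt n)" for k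
  proof (cases "k \<in> ?R")
    case True
    then interpret N: real_distribution "law i k" by (intro real_distribution_law i) (auto simp: wrapping_def)
    have "emeasure lborel {y. \<bar>y\<bar> \<le> \<Lambda> / sqrt n \<and> osc (law i k) (s * y) \<le> ?r * ((1 - b) / 2) / 2}
      \<le> ennreal (4 * sqrt (6 * ?r) / ((1 - b) / 2) * (\<Lambda> / sqrt n + 3 / (s * (c\<^sub>T * sqrt n / s))))"
      by (rule N.osc_small_volume[OF _ wrapping_far[OF True i]]) (use b s pos n_pos in auto)
    also have "?r * ((1 - b) / 2) / 2 = 20 * \<eta> / c2" using b pos by (simp add: field_simps)
    also have "4 * sqrt (6 * ?r) / ((1 - b) / 2) * (\<Lambda> / sqrt n + 3 / (s * (c\<^sub>T * sqrt n / s)))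
      = 4 * sqrt (6 * ?r) / ((1 - b) / 2) * (\<Lambda> + 3 / c\<^sub>T) / sqrt n"
    proof -
      have "\<Lambda> / sqrt n + 3 / (s * (c\<^sub>T * sqrt n / s)) = (\<Lambda> + 3 / c\<^sub>T) / sqrt n"
        using s by (simp add: add_divide_distrib)
      then show ?thesis by (simp only: times_divide_eq_right)
    qed
    also have "ennreal \<dots> \<le> ennreal (\<delta> / sqrt n)" using \<delta>(1) by (intro ennreal_leI divide_right_mono) auto
    finally show ?thesis using True by (simp add: e_def F_def)
  qed (use \<delta> in \<open>simp add: e_def\<close>)
  have nd: "normal_density 0 \<sigma> z = sqrt (n / (2 * pi)) * exp (- (n * z\<^sup>2 / 2))" for z :: real
  proof -
    have "1 / sqrt (2 * pi * \<sigma>\<^sup>2) = sqrt (n / (2 * pi))"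
      unfolding s2 using n_pos by (simp add: real_sqrt_divide)
    then show ?thesis unfolding normal_density_def s2 using n_pos by (simp add: mult_ac)
  qed
  have nd_le: "normal_density 0 \<sigma> z \<le> sqrt n" for z :: real
  proof -
    have "real n / (2 * pi) \<le> real n / 1" using pi_gt3 by (intro divide_left_mono) auto
    then have "sqrt (n / (2 * pi)) \<le> sqrt n" by (intro real_sqrt_le_mono) simp
    then have "sqrt (n / (2 * pi)) * exp (- (n * z\<^sup>2 / 2)) \<le> sqrt n * 1" by (intro mult_mono) auto
    then show ?thesis using nd[of z] by linarith
  qed
  have g0: "0 \<le> g k z" for k and z :: real unfolding g_def using t1 by (intro mult_nonneg_nonneg add_nonneg_nonneg) auto
  have gm: "(\<lambda>z. ennreal (g k z)) \<in> borel_measurable borel" for k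
    unfolding g_def using em[of k] by measurable
  have gi: "(\<integral>\<^sup>+z. ennreal (g k z) \<partial>lborel) \<le> 2" for k
  proof -
    have "(\<integral>\<^sup>+z. ennreal (g k z) \<partial>lborel) \<le> (\<integral>\<^sup>+z. ennreal (normal_density 0 \<sigma> z) + ennreal (sqrt n / \<delta>) * indicator (e k) z \<partial>lborel)"
    proof (rule nn_integral_mono)
      fix z :: real
      have "g k z \<le> normal_density 0 \<sigma> z + sqrt n / \<delta> * indicator (e k) z"
      proof (cases "z \<in> e k")
        case True
        have "g k z = normal_density 0 \<sigma> z * (1 / \<delta>)" using True by (simp add: g_def)
        also have "\<dots> \<le> sqrt n * (1 / \<delta>)" using nd_le \<delta> by (intro mult_right_mono) auto
        finally show ?thesis using True by (simp add: add_increasing)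
      qed (simp add: g_def)
      then have "ennreal (g k z) \<le> ennreal (normal_density 0 \<sigma> z + sqrt n / \<delta> * indicator (e k) z)" by (rule ennreal_leI)
      also have "\<dots> = ennreal (normal_density 0 \<sigma> z) + ennreal (sqrt n / \<delta>) * indicator (e k) z"
        using \<delta> by (cases "z \<in> e k") auto
      finally show "ennreal (g k z) \<le> ennreal (normal_density 0 \<sigma> z) + ennreal (sqrt n / \<delta>) * indicator (e k) z" .
    qed
    also have "\<dots> = 1 + ennreal (sqrt n / \<delta>) * emeasure lborel (e k)"
      using em[of k] by (subst nn_integral_add) (auto simp: nn_integral_cmult_indicator nn_integral_normal_density[OF \<sigma>])
    also have "\<dots> \<le> 1 + ennreal (sqrt n / \<delta>) * ennreal (\<delta> / sqrt n)"
      by (intro add_left_mono mult_left_mono eL) auto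
    also have "ennreal (sqrt n / \<delta>) * ennreal (\<delta> / sqrt n) = 1"
      using \<delta> n_pos by (subst ennreal_mult'[symmetric]) auto
    finally show ?thesis by simp
  qed
  let ?C = "\<delta> powr (c2 * n / 4) * (sqrt (2 * pi) * exp 2 / sqrt n) ^ n"
  have C0: "0 \<le> ?C" by simp
  have "emeasure (lebesgue_on_nat n) (resonant_set c\<^sub>T \<Lambda> c2 \<eta> i s) \<le> ennreal ?C * 2 ^ n"
  proof (rule emeasure_le_prod_nn_integral[OF resonant_set_measurable[OF i], where g = "\<lambda>k z. ennreal (g k z)"])
    fix y assume y: "y \<in> resonant_set c\<^sub>T \<Lambda> c2 \<eta> i s"
    let ?A = "{k\<in>?R. \<bar>y k\<bar> \<le> \<Lambda> / sqrt n}"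
    let ?E = "{k. k < n \<and> y k \<in> e k}"
    have fR: "finite ?R" by (simp add: wrapping_def)
    have EA: "?E \<subseteq> ?A" by (auto simp: e_def F_def split: if_splits)
    have cE: "c2 * n / 4 \<le> card ?E"
    proof (rule ccontr)
      assume neg: "\<not> ?thesis"
      have "card ?A = card ?E + card (?A - ?E)"
        using EA fR by (metis (no_types, lifting) card_Diff_subset card_mono finite_subset le_add_diff_inverse mem_Collect_eq subsetI)
      then have "c2 * n / 4 < card (?A - ?E)" using y neg by (auto simp: resonant_set_def)
      then have "c2 * n / 4 * (20 * \<eta> / c2) < card (?A - ?E) * (20 * \<eta> / c2)"
        using pos by (intro mult_strict_right_mono) auto
      also have "\<dots> = (\<Sum>k\<in>?A - ?E. 20 * \<eta> / c2)" by simp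
      also have "\<dots> \<le> (\<Sum>k\<in>?A - ?E. osc (law i k) (s * y k))"
        by (intro sum_mono) (auto simp: e_def F_def wrapping_def)
      also have "\<dots> \<le> row_osc i y s"
        unfolding row_osc_def using i
        by (intro sum_mono2 real_distribution.osc_nonneg real_distribution_law) (auto simp: wrapping_def)
      also have "\<dots> \<le> 5 * \<eta> * n" using y by (simp add: resonant_set_def)
      finally show False using pos by simp
    qed
    have "1 \<le> \<delta> powr (c2 * n / 4) * ?t powr (c2 * n / 4)"
      using \<delta> by (simp add: powr_mult[symmetric])
    also have "\<dots> \<le> \<delta> powr (c2 * n / 4) * ?t powr card ?E"
      using cE t1 by (intro mult_left_mono powr_mono) auto
    also have "\<dots> \<le> \<delta> powr (c2 * n / 4) * ((sqrt (2 * pi) * exp 2 / sqrt n) ^ n * (\<Prod>k<n. g k (y k)))"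
    proof (intro mult_left_mono)
      have "?t powr card ?E = (\<Prod>k\<in>?E. ?t)" using \<delta> by (simp add: powr_realpow)
      also have "\<dots> = (\<Prod>k<n. if y k \<in> e k then ?t else 1)"
      proof -
        have "{..<n} \<inter> {k. y k \<in> e k} = ?E" by auto
        then show ?thesis by (subst prod.If_cases) simp_all
      qed
      also have "\<dots> = (\<Prod>k<n. 1 + (?t - 1) * indicator (e k) (y k))"
        by (intro prod.cong) auto
      finally have 1: "?t powr card ?E = (\<Prod>k<n. 1 + (?t - 1) * indicator (e k) (y k))" .
      have "(\<Prod>k<n. normal_density 0 \<sigma> (y k)) = sqrt (n / (2 * pi)) ^ n * exp (- (n / 2 * (\<Sum>k<n. (y k)\<^sup>2)))"
        unfolding nd by (simp add: prod.distrib exp_sum[symmetric] sum_negf sum_distrib_left)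
      also have "\<dots> \<ge> sqrt (n / (2 * pi)) ^ n * exp (- (n / 2 * 4))"
      proof -
        have "(\<Sum>k<n. (y k)\<^sup>2) \<le> 4" using y by (simp add: resonant_set_def)
        then have "n / 2 * (\<Sum>k<n. (y k)\<^sup>2) \<le> n / 2 * 4" by (rule mult_left_mono) simp
        then show ?thesis by (intro mult_left_mono) auto
      qed
      finally have "sqrt (n / (2 * pi)) ^ n * exp (- (n / 2 * 4)) \<le> (\<Prod>k<n. normal_density 0 \<sigma> (y k))" .
      moreover have "sqrt (n / (2 * pi)) ^ n * exp (- (n / 2 * 4)) = 1 / (sqrt (2 * pi) * exp 2 / sqrt n) ^ n"
      proof -
        have "exp (n / 2 * 4) = exp (2::real) ^ n" by (simp add: exp_of_nat_mult[symmetric] mult_ac)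
        then show ?thesis using n_pos
          by (simp add: real_sqrt_divide power_divide power_mult_distrib exp_minus field_simps)
      qed
      ultimately have "1 \<le> (sqrt (2 * pi) * exp 2 / sqrt n) ^ n * (\<Prod>k<n. normal_density 0 \<sigma> (y k))"
        using n_pos by (simp add: pos_divide_le_eq mult.commute)
      then have "1 * ?t powr card ?E \<le> ((sqrt (2 * pi) * exp 2 / sqrt n) ^ n * (\<Prod>k<n. normal_density 0 \<sigma> (y k))) * ?t powr card ?E"
        by (rule mult_right_mono) simp
      then show "?t powr card ?E \<le> (sqrt (2 * pi) * exp 2 / sqrt n) ^ n * (\<Prod>k<n. g k (y k))"
        unfolding 1 g_def prod.distrib by (simp add: mult.assoc)
    qed simp
    finally have "1 \<le> ?C * (\<Prod>k<n. g k (y k))" by (simp add: mult.assoc)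
    then have "ennreal 1 \<le> ennreal (?C * (\<Prod>k<n. g k (y k)))" by (rule ennreal_leI)
    also have "\<dots> = ennreal ?C * ennreal (\<Prod>k<n. g k (y k))" by (rule ennreal_mult'[OF C0])
    also have "ennreal (\<Prod>k<n. g k (y k)) = (\<Prod>k<n. ennreal (g k (y k)))" using g0 by (simp add: prod_ennreal)
    finally show "1 \<le> ennreal ?C * (\<Prod>k<n. ennreal (g k (y k)))" by simp
  qed (use gm gi in auto)
  also have "ennreal ?C * 2 ^ n = ennreal (?C * 2 ^ n)"
    by (simp only: ennreal_mult'[OF C0] ennreal_power[symmetric] zero_le_numeral ennreal_numeral)
  also have "?C * 2 ^ n = \<delta> powr (c2 * n / 4) * (2 * sqrt (2 * pi) * exp 2 / sqrt n) ^ n"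
    by (simp add: power_mult_distrib power_divide)
  finally show ?thesis .
qed


section \<open>Resonances, and the decay they obstruct\<close>

definition spread :: "real \<Rightarrow> real \<Rightarrow> (nat \<Rightarrow> real) \<Rightarrow> nat set" where
  "spread \<rho> \<Lambda> x = {k. k < n \<and> \<rho> / sqrt n < \<bar>x k\<bar> \<and> \<bar>x k\<bar> \<le> \<Lambda> / sqrt n}"

text \<open>
  If few spread coordinates are wrapping, \<open>row_osc\<close> is at least of order \<open>s\<^sup>2\<close> for trivial reasons. A resonance
  is a failure of decay for arithmetic reasons, and such failures are rare in volume.
\<close>

definition resonant :: "real \<Rightarrow> real \<Rightarrow> real \<Rightarrow> real \<Rightarrow> real \<Rightarrow> nat \<Rightarrow> (nat \<Rightarrow> real) \<Rightarrow> real \<Rightarrow> bool" where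
  "resonant \<rho> \<Lambda> c\<^sub>T c2 \<eta> i x s \<longleftrightarrow>
    c2 * n / 2 \<le> card (spread \<rho> \<Lambda> x \<inter> wrapping c\<^sub>T i s) \<and> row_osc i x s < \<eta> * n"

text \<open>
  Only boundedly many rows are not light, so their small ball estimates can be discarded.
\<close>

definition light_rows :: "real \<Rightarrow> nat set" where
  "light_rows \<tau> = {i. i < n \<and> row_moment i \<le> \<tau>\<^sup>2 * (real n)\<^sup>2}"

lemma light_rows_subset: "light_rows \<tau> \<subseteq> {..<n}"
  by (auto simp: light_rows_def)

lemma row_moment_nonneg: "0 \<le> row_moment i"
  unfolding row_moment_def by (intro sum_nonneg Bochner_Integration.integral_nonneg) auto

lemma card_heavy_rows_le:
  assumes "0 < \<tau>" shows "card ({..<n} - light_rows \<tau>) \<le> K / \<tau>\<^sup>2"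
proof -
  have "card ({..<n} - light_rows \<tau>) * (\<tau>\<^sup>2 * (real n)\<^sup>2) = (\<Sum>i\<in>{..<n} - light_rows \<tau>. \<tau>\<^sup>2 * (real n)\<^sup>2)" by simp
  also have "\<dots> \<le> (\<Sum>i\<in>{..<n} - light_rows \<tau>. row_moment i)"
    by (rule sum_mono) (auto simp: light_rows_def)
  also have "\<dots> \<le> (\<Sum>i<n. row_moment i)" by (rule sum_mono2) (auto simp: row_moment_nonneg)
  also have "\<dots> \<le> K * (real n)\<^sup>2" using hilbert_schmidt by (simp add: row_moment_def)
  finally have "(card ({..<n} - light_rows \<tau>) * \<tau>\<^sup>2) * (real n)\<^sup>2 \<le> K * (real n)\<^sup>2" by (simp add: mult_ac)
  then have "card ({..<n} - light_rows \<tau>) * \<tau>\<^sup>2 \<le> K" using n_pos by simp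
  then show ?thesis using assms by (simp add: pos_le_divide_eq)
qed

text \<open>The start of the induction over frequencies: up to frequency 1 wrapping is expensive in
  second moments, and a light row cannot afford \<open>c2 * n / 2\<close> wrapping indices.\<close>

lemma not_resonant_low_frequency:
  assumes i: "i \<in> light_rows \<tau>" and s: "0 < s" "s \<le> 1" and c: "0 < c\<^sub>T" and \<tau>: "16 * \<tau>\<^sup>2 < c2 * c\<^sub>T\<^sup>2 * (1 - b)"
  shows "\<not> resonant \<rho> \<Lambda> c\<^sub>T c2 \<eta> i x s"
proof
  assume "resonant \<rho> \<Lambda> c\<^sub>T c2 \<eta> i x s"
  then have "c2 * n / 2 \<le> card (spread \<rho> \<Lambda> x \<inter> wrapping c\<^sub>T i s)" by (simp add: resonant_def)
  also have "\<dots> \<le> card (wrapping c\<^sub>T i s)" by (intro of_nat_mono card_mono) (auto simp: wrapping_def)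
  finally have "c2 * n / 2 * (c\<^sub>T\<^sup>2 * n * (1 - b) / 8) \<le> card (wrapping c\<^sub>T i s) * (c\<^sub>T\<^sup>2 * n * (1 - b) / 8)"
    using b by (intro mult_right_mono) auto
  also have "\<dots> \<le> row_moment i"
  proof -
    have "i < n" using i by (simp add: light_rows_def)
    from card_wrapping_le[OF this s c] show ?thesis .
  qed
  also have "\<dots> \<le> \<tau>\<^sup>2 * (real n)\<^sup>2" using i by (simp add: light_rows_def)
  finally have "(c2 * c\<^sub>T\<^sup>2 * (1 - b)) * (real n)\<^sup>2 \<le> 16 * \<tau>\<^sup>2 * (real n)\<^sup>2" by (simp add: power2_eq_square mult_ac)
  then have "c2 * c\<^sub>T\<^sup>2 * (1 - b) \<le> 16 * \<tau>\<^sup>2" using n_pos by simp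
  then show False using \<tau> by simp
qed

text \<open>Two mechanisms: if many spread coordinates wrap, the absence of a resonance gives
  oscillation \<open>\<eta> * n\<close> at \<open>x\<close>, of which \<open>y\<close> keeps a
  quarter. Otherwise at least \<open>c2 * n / 2\<close> spread coordinates do not wrap and give
  Gaussian decay, with \<open>192 = 2 * 2 * 4 * 12\<close>.\<close>

lemma not_resonant_decay:
  fixes c2 :: real
  assumes i: "i < n" and s: "0 \<le> s" and sp: "c2 * n \<le> card (spread \<rho> \<Lambda> x)"
    and nr: "0 < s \<Longrightarrow> \<not> resonant \<rho> \<Lambda> c\<^sub>T c2 \<eta> i x s"
    and y: "\<And>k. k < n \<Longrightarrow> \<bar>y k - x k\<bar> \<le> h" and h: "h \<le> \<rho> / (2 * sqrt n)" "h \<le> \<Lambda> / sqrt n"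
    and pos: "0 < \<rho>" "0 < \<Lambda>" "0 < c2" "0 < c\<^sub>T" "2 * \<Lambda> * c\<^sub>T \<le> pi"
    and err: "8 * (s * h)\<^sup>2 * row_moment i \<le> \<eta> * n"
  shows "exp (- row_osc i y s / 2) \<le> exp (- ((1 - b) * c2 * \<rho>\<^sup>2 / 192) * s\<^sup>2) + exp (- (\<eta> * n / 8))"
\<comment> \<open>\<open>wrapping\<close> divides by the frequency, so 0 is set apart; there the
  first exponential on the right equals 1.\<close>
proof (cases "s = 0")
  case True
  have "exp (- row_osc i y s / 2) \<le> 1" using row_osc_nonneg[OF i] by simp
  moreover have "exp (- ((1 - b) * c2 * \<rho>\<^sup>2 / 192) * s\<^sup>2) = 1" using True by simp
  ultimately show ?thesis using exp_ge_zero[of "- (\<eta> * n / 8)"] by linarith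
next
  case False
  then have s0: "0 < s" using s by simp
  let ?S = "spread \<rho> \<Lambda> x - wrapping c\<^sub>T i s"
  have fs: "finite (spread \<rho> \<Lambda> x)" by (simp add: spread_def)
  show ?thesis
  proof (cases "c2 * n / 2 \<le> card (spread \<rho> \<Lambda> x \<inter> wrapping c\<^sub>T i s)")
    case True
    then have "\<eta> * n \<le> row_osc i x s" using nr[OF s0] by (simp add: resonant_def)
    also have "\<dots> \<le> 2 * row_osc i y s + 4 * (s * h)\<^sup>2 * row_moment i"
    proof (rule row_osc_perturb[OF i])
      fix k assume "k < n"
      have "\<bar>s * x k - s * y k\<bar> = s * \<bar>y k - x k\<bar>" using s0
        by (simp add: abs_mult abs_minus_commute flip: right_diff_distrib)
      also have "\<dots> \<le> s * h" using y[OF \<open>k < n\<close>] s by (intro mult_left_mono)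
      finally show "\<bar>s * x k - s * y k\<bar> \<le> s * h" .
    qed
    finally have "\<eta> * n / 4 \<le> row_osc i y s" using err by simp
    then have "exp (- row_osc i y s / 2) \<le> exp (- (\<eta> * n / 8))" by simp
    then show ?thesis using exp_ge_zero[of "- ((1 - b) * c2 * \<rho>\<^sup>2 / 192) * s\<^sup>2"] by linarith
  next
    case False
    have "card (spread \<rho> \<Lambda> x) = card ?S + card (spread \<rho> \<Lambda> x \<inter> wrapping c\<^sub>T i s)"
      using fs by (metis Diff_disjoint Int_Diff_Un Int_commute Un_commute add.commute card_Diff_subset_Int card_Un_disjoint finite_Diff finite_Int Int_Diff)
    then have S: "c2 * n / 2 \<le> card ?S" using False sp by linarith
    have "c2 * n / 2 * ((1 - b) * (\<rho> / 2)\<^sup>2 * s\<^sup>2 / (12 * n)) \<le> card ?S * ((1 - b) * (\<rho> / 2)\<^sup>2 * s\<^sup>2 / (12 * n))"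
      using S b by (intro mult_right_mono) auto
    also have "\<dots> \<le> row_osc i y s"
    proof (rule row_osc_ge_nonwrapping[OF i s0, where \<Lambda> = "2 * \<Lambda>"])
      fix k assume "k \<in> ?S"
      then have k: "k < n" "\<rho> / sqrt n < \<bar>x k\<bar>" "\<bar>x k\<bar> \<le> \<Lambda> / sqrt n" by (auto simp: spread_def)
      have "\<bar>y k\<bar> \<ge> \<bar>x k\<bar> - h" "\<bar>y k\<bar> \<le> \<bar>x k\<bar> + h" using y[OF k(1)] by linarith+
      moreover have "\<rho> / sqrt n = \<rho> / (2 * sqrt n) + \<rho> / (2 * sqrt n)" by (simp add: field_simps)
      moreover have "\<rho> / 2 / sqrt n = \<rho> / (2 * sqrt n)" "2 * \<Lambda> / sqrt n = \<Lambda> / sqrt n + \<Lambda> / sqrt n" by simp_all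
      ultimately show "\<rho> / 2 / sqrt n \<le> \<bar>y k\<bar> \<and> \<bar>y k\<bar> \<le> 2 * \<Lambda> / sqrt n" using k h by linarith
    qed (use pos in \<open>auto simp: spread_def\<close>)
    also have "c2 * n / 2 * ((1 - b) * (\<rho> / 2)\<^sup>2 * s\<^sup>2 / (12 * n)) = 2 * (((1 - b) * c2 * \<rho>\<^sup>2 / 192) * s\<^sup>2)"
      using n_pos by (simp add: power_divide)
    finally have "exp (- row_osc i y s / 2) \<le> exp (- ((1 - b) * c2 * \<rho>\<^sup>2 / 192) * s\<^sup>2)" by simp
    then show ?thesis using exp_ge_zero[of "- (\<eta> * n / 8)"] by linarith
  qed
qed

text \<open>Nonresonance of \<open>x\<close> below \<open>D\<close> gives every light row a small
  ball bound of order \<open>1 / D\<close>, valid at all points of the box around \<open>x\<close>.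
  Resonance in \<open>[D, 2 * D]\<close> puts the same box into a set of small volume. The bound is
  the product of the two effects.\<close>

lemma level_event:
  fixes R \<kappa> c\<^sub>h \<rho> \<Lambda> c\<^sub>T c2 \<eta> \<delta> \<tau> D a Lc :: real
  defines "a \<equiv> (1 - b) * c2 * \<rho>\<^sup>2 / 192"
  defines "Lc \<equiv> 160 / sqrt a + 40"
  defines "h \<equiv> c\<^sub>h / (D * sqrt n)"
  assumes I: "I \<subseteq> {..<n}"
    and pos: "0 < R" "0 < \<kappa>" "0 < c\<^sub>h" "c\<^sub>h \<le> 1 / 2" "0 < \<rho>" "0 < \<Lambda>" "0 < c\<^sub>T" "0 < c2" "0 < \<eta>"
    and par: "c\<^sub>h \<le> \<rho> / 2" "c\<^sub>h \<le> \<Lambda>" "2 * \<Lambda> * c\<^sub>T \<le> pi" "c\<^sub>h * R * sqrt K \<le> 1" "12 * \<tau>\<^sup>2 \<le> \<eta>"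
    and \<delta>: "4 * sqrt (6 * (80 * \<eta> / (c2 * (1 - b)))) / ((1 - b) / 2) * (2 * \<Lambda> + 3 / c\<^sub>T) \<le> \<delta>" "0 < \<delta>" "\<delta> \<le> 1"
    and D: "1 \<le> D" "D \<le> exp (\<eta> * n / 8)"
  obtains E where "E \<in> events"
    "prob E \<le> ((1 + 1 / R\<^sup>2) / \<kappa>\<^sup>2) ^ n + 2 * (exp n * (Lc / D) ^ card (I \<inter> light_rows \<tau>)) *
       (n * (D * sqrt n + 2) * (\<delta> powr (c2 * n / 4) * (2 * sqrt (2 * pi) * exp 2 / sqrt n) ^ n)) * (\<kappa> / (2 * h)) ^ n"
    "\<And>\<omega> x i s\<^sub>0. \<omega> \<in> space M - E \<Longrightarrow> L2_set x {..<n} = 1 \<Longrightarrow> L2_set (mat_vec n (\<lambda>i j. B i j \<omega>) x) I \<le> 0 \<Longrightarrow>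
      c2 * n \<le> card (spread \<rho> \<Lambda> x) \<Longrightarrow>
      (\<And>j s. j \<in> light_rows \<tau> \<Longrightarrow> 0 < s \<Longrightarrow> s < D \<Longrightarrow> \<not> resonant \<rho> \<Lambda> c\<^sub>T c2 \<eta> j x s) \<Longrightarrow>
      i \<in> light_rows \<tau> \<Longrightarrow> D \<le> s\<^sub>0 \<Longrightarrow> s\<^sub>0 \<le> 2 * D \<Longrightarrow> resonant \<rho> \<Lambda> c\<^sub>T c2 \<eta> i x s\<^sub>0 \<Longrightarrow> False"
proof -
  note ps = prob_space_axioms and emm = emeasure_eq_measure
  let ?L = "lebesgue_on_nat n"
  let ?G = "light_rows \<tau>"
  interpret L: sigma_finite_measure ?L by (rule sigma_finite_lebesgue_on_nat)
  interpret MP: pair_sigma_finite M ?L ..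
  have sn: "0 < sqrt n" using n_pos by simp
  have a: "0 < a" unfolding a_def using b pos by simp
  have h: "0 < h" unfolding h_def using pos D sn by simp
  have Dh: "D * h = c\<^sub>h / sqrt n" unfolding h_def using D by simp
  have hle: "h \<le> c\<^sub>h / sqrt n" unfolding h_def using D pos sn by (intro divide_left_mono) auto
  have fG: "finite ?G" using light_rows_subset finite_subset by blast
  define T where "T = 0 + 2 * h * R * sqrt K * n"
  have T0: "0 \<le> T" unfolding T_def using h pos K_pos by simp
  let ?Q = "\<lambda>\<omega> y. L2_set (mat_vec n (\<lambda>i j. B i j \<omega>) y) I"
  define p where "p = exp (real n) * (Lc / D) ^ card (I \<inter> ?G)"
  have Lc0: "0 \<le> Lc" unfolding Lc_def using a by simp
  have p0: "0 \<le> p" unfolding p_def using Lc0 D by simp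
  \<comment> \<open>A point of the resonant sets may have further resonances below \<open>D\<close>
    and then lack the small ball bound. So \<open>W\<close> is restricted to points where
    \<open>f\<close> is at most \<open>p\<close>, and this is verified only on boxes around the
    relevant \<open>x\<close>.\<close>
  define f where "f y = measure M {\<omega>\<in>space M. ?Q \<omega> y \<le> T}" for y
  have f_m: "f \<in> borel_measurable ?L"
  proof -
    let ?A = "{z\<in>space (M \<Otimes>\<^sub>M ?L). ?Q (fst z) (snd z) \<le> T}"
    have "(\<lambda>z. ?Q (fst z) (snd z)) \<in> borel_measurable (M \<Otimes>\<^sub>M ?L)"
      using residual_measurable[OF I] by (simp add: case_prod_beta')
    then have "?A \<in> sets (M \<Otimes>\<^sub>M ?L)" by measurable
    then have "(\<lambda>y. emeasure M ((\<lambda>\<omega>. (\<omega>, y)) -` ?A)) \<in> borel_measurable ?L"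
      by (rule MP.measurable_emeasure_Pair2)
    then have "(\<lambda>y. enn2real (emeasure M ((\<lambda>\<omega>. (\<omega>, y)) -` ?A))) \<in> borel_measurable ?L" by measurable
    also have "?this \<longleftrightarrow> f \<in> borel_measurable ?L"
    proof (rule measurable_cong)
      fix y assume "y \<in> space ?L"
      then have "(\<lambda>\<omega>. (\<omega>, y)) -` ?A = {\<omega>\<in>space M. ?Q \<omega> y \<le> T}" by (auto simp: space_pair_measure)
      then show "enn2real (emeasure M ((\<lambda>\<omega>. (\<omega>, y)) -` ?A)) = f y" by (simp add: f_def measure_def)
    qed
    finally show ?thesis .
  qed
  \<comment> \<open>Frequencies in \<open>[D, 2 * D]\<close> are rounded up to multiples of
    \<open>1 / sqrt n\<close>, upwards because wrapping sets grow with the frequency; hence the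
    extra 1.\<close>
  define Ms where "Ms = {m::nat. D * sqrt n \<le> m \<and> m \<le> 2 * D * sqrt n + 1}"
  have Ms_sub: "Ms \<subseteq> {nat \<lceil>D * sqrt n\<rceil>..nat \<lfloor>2 * D * sqrt n + 1\<rfloor>}"
  proof
    fix m assume "m \<in> Ms"
    then have m: "D * sqrt n \<le> real m" "real m \<le> 2 * D * sqrt n + 1" by (auto simp: Ms_def)
    have "nat \<lceil>D * sqrt n\<rceil> \<le> m" using m(1) by (simp add: nat_ceiling_le_eq)
    moreover have "m \<le> nat \<lfloor>2 * D * sqrt n + 1\<rfloor>" by (rule le_nat_floor[OF m(2)])
    ultimately show "m \<in> {nat \<lceil>D * sqrt n\<rceil>..nat \<lfloor>2 * D * sqrt n + 1\<rfloor>}" by simp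
  qed
  have fM: "finite Ms" using Ms_sub finite_subset by blast
  have cM: "card Ms \<le> D * sqrt n + 2"
  proof -
    define A where "A = nat \<lfloor>2 * D * sqrt n + 1\<rfloor>"
    define A' where "A' = nat \<lceil>D * sqrt n\<rceil>"
    have 1: "card Ms \<le> card {A'..A}" using Ms_sub unfolding A_def A'_def by (intro card_mono) auto
    have 2: "real A \<le> 2 * D * sqrt n + 1" unfolding A_def using D sn by (intro of_nat_floor) auto
    have 3: "D * sqrt n \<le> real A'" unfolding A'_def by (rule real_nat_ceiling_ge)
    have 4: "0 \<le> D * sqrt n" using D sn by simp
    show ?thesis
    proof (cases "A' \<le> Suc A")
      case True
      then have "real (card {A'..A}) = real A + 1 - real A'" by (simp add: of_nat_diff)
      then show ?thesis using 1 2 3 by linarith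
    next
      case False
      then have "card {A'..A} = 0" by simp
      then show ?thesis using 1 4 by linarith
    qed
  qed
  define v where "v = \<delta> powr (c2 * n / 4) * (2 * sqrt (2 * pi) * exp 2 / sqrt n) ^ n"
  have v0: "0 \<le> v" unfolding v_def using sn by simp
  let ?V = "\<lambda>i m. resonant_set c\<^sub>T (2 * \<Lambda>) c2 \<eta> i (real m / sqrt n)"
  define W where "W = {y\<in>space ?L. f y \<le> p} \<inter> (\<Union>i\<in>?G. \<Union>m\<in>Ms. ?V i m)"
  have Vm: "?V i m \<in> sets ?L" if "i \<in> ?G" for i m
    using that light_rows_subset by (intro resonant_set_measurable) auto
  have Um: "(\<Union>m\<in>Ms. ?V i m) \<in> sets ?L" if "i \<in> ?G" for i
    using Vm[OF that] fM by (intro sets.finite_UN) auto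
  have W: "W \<in> sets ?L"
    unfolding W_def using f_m Vm fM fG by (intro sets.Int sets.finite_UN) auto
  have "emeasure ?L W \<le> emeasure ?L (\<Union>i\<in>?G. \<Union>m\<in>Ms. ?V i m)"
    by (rule emeasure_mono) (use Vm fM fG in \<open>auto simp: W_def intro!: sets.finite_UN\<close>)
  also have "\<dots> \<le> (\<Sum>i\<in>?G. emeasure ?L (\<Union>m\<in>Ms. ?V i m))"
    by (rule emeasure_subadditive_finite[OF fG]) (use Um in auto)
  also have "\<dots> \<le> (\<Sum>i\<in>?G. \<Sum>m\<in>Ms. emeasure ?L (?V i m))"
    by (intro sum_mono emeasure_subadditive_finite fM) (use Vm in auto)
  also have "\<dots> \<le> (\<Sum>i\<in>?G. \<Sum>m\<in>Ms. ennreal v)"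
  proof (intro sum_mono)
    fix i m assume i: "i \<in> ?G" and m: "m \<in> Ms"
    have "0 < D * sqrt n" using D sn by simp
    then have "0 < real m / sqrt n" using m sn unfolding Ms_def by simp
    then show "emeasure ?L (?V i m) \<le> ennreal v"
      unfolding v_def using i light_rows_subset pos \<delta> by (intro emeasure_resonant_set_le) auto
  qed
  also have "\<dots> = ennreal (card ?G * (card Ms * v))"
    using v0 by (simp add: ennreal_mult ennreal_of_nat_eq_real_of_nat mult.assoc)
  also have "\<dots> \<le> ennreal (n * (D * sqrt n + 2) * v)"
  proof (rule ennreal_leI)
    have "card ?G \<le> n" using card_mono[OF _ light_rows_subset] by auto
    then have "card ?G * (card Ms * v) \<le> n * ((D * sqrt n + 2) * v)"
      using cM v0 D by (intro mult_mono mult_right_mono) auto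
    then show "card ?G * (card Ms * v) \<le> n * (D * sqrt n + 2) * v" by (simp add: mult.assoc)
  qed
  finally have Ww: "emeasure ?L W \<le> ennreal (n * (D * sqrt n + 2) * v)" .
  obtain E where E: "E \<in> sets M" "measure M E \<le> ((1 + 1 / R\<^sup>2) / \<kappa>\<^sup>2) ^ n + 2 * p * (n * (D * sqrt n + 2) * v) * (\<kappa> / (2 * h)) ^ n"
    "\<And>\<omega> x. \<omega> \<in> space M - E \<Longrightarrow> ?Q \<omega> x \<le> 0 \<Longrightarrow>
      (\<And>y. y \<in> space ?L \<Longrightarrow> (\<forall>k<n. \<bar>y k - x k\<bar> \<le> h) \<Longrightarrow> y \<in> W) \<Longrightarrow> False"
  proof (rule volume_union_bound[OF I pos(1,2) h _ W Ww _ p0, of 0])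
    show "measure M {\<omega>\<in>space M. ?Q \<omega> y \<le> 0 + 2 * h * R * sqrt K * n} \<le> p" if "y \<in> W" for y
      using that by (auto simp: W_def f_def T_def)
    show "0 \<le> n * (D * sqrt n + 2) * v" using v0 D by simp
  qed auto
  show thesis
  proof (rule that[OF E(1)])
    show "measure M E \<le> ((1 + 1 / R\<^sup>2) / \<kappa>\<^sup>2) ^ n + 2 * (exp n * (Lc / D) ^ card (I \<inter> ?G)) *
       (n * (D * sqrt n + 2) * (\<delta> powr (c2 * n / 4) * (2 * sqrt (2 * pi) * exp 2 / sqrt n) ^ n)) * (\<kappa> / (2 * h)) ^ n"
      using E(2) unfolding p_def v_def .
    fix \<omega> x i s\<^sub>0
    assume \<omega>: "\<omega> \<in> space M - E" and x: "L2_set x {..<n} = 1" and ker: "?Q \<omega> x \<le> 0"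
      and sp: "c2 * n \<le> card (spread \<rho> \<Lambda> x)"
      and nr: "\<And>j s. j \<in> ?G \<Longrightarrow> 0 < s \<Longrightarrow> s < D \<Longrightarrow> \<not> resonant \<rho> \<Lambda> c\<^sub>T c2 \<eta> j x s"
      and i: "i \<in> ?G" and s0: "D \<le> s\<^sub>0" "s\<^sub>0 \<le> 2 * D" and res: "resonant \<rho> \<Lambda> c\<^sub>T c2 \<eta> i x s\<^sub>0"
    show False
    proof (rule E(3)[OF \<omega> ker])
      fix y assume y: "y \<in> space ?L" "\<forall>k<n. \<bar>y k - x k\<bar> \<le> h"
      have y2: "(\<Sum>k<n. (y k)\<^sup>2) \<le> 4"
      proof (rule L2_set_perturb(2)[OF x])
        show "\<bar>y k - x k\<bar> \<le> c\<^sub>h / sqrt n" if "k < n" for k using y(2) that hle by force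
      qed (use pos n_pos in auto)
      have yk: "\<bar>y k\<bar> \<le> 2" if "k < n" for k
      proof -
        have "(y k)\<^sup>2 \<le> (\<Sum>k<n. (y k)\<^sup>2)" by (rule member_le_sum) (use that in auto)
        then have "(y k)\<^sup>2 \<le> 2\<^sup>2" using y2 by simp
        then show ?thesis using abs_le_square_iff[of "y k" 2] by simp
      qed
      have "f y \<le> measure M {\<omega>\<in>space M. (\<Sum>j\<in>I \<inter> ?G. (\<Sum>k<n. B j k \<omega> * y k)\<^sup>2) \<le> T\<^sup>2}"
        unfolding f_def
      proof (rule finite_measure.finite_measure_mono)
        show "finite_measure M" by (rule prob_space.finite_measure[OF ps])
        have "(\<lambda>\<omega>. \<Sum>j\<in>I \<inter> ?G. (\<Sum>k<n. B j k \<omega> * y k)\<^sup>2) \<in> borel_measurable M"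
          using I by (intro borel_measurable_sum borel_measurable_power row_sum_measurable) auto
        then show "{\<omega>\<in>space M. (\<Sum>j\<in>I \<inter> ?G. (\<Sum>k<n. B j k \<omega> * y k)\<^sup>2) \<le> T\<^sup>2} \<in> sets M" by measurable
        show "{\<omega>\<in>space M. ?Q \<omega> y \<le> T} \<subseteq> {\<omega>\<in>space M. (\<Sum>j\<in>I \<inter> ?G. (\<Sum>k<n. B j k \<omega> * y k)\<^sup>2) \<le> T\<^sup>2}"
        proof safe
          fix \<omega> assume "?Q \<omega> y \<le> T"
          then have "(\<Sum>j\<in>I. (\<Sum>k<n. B j k \<omega> * y k)\<^sup>2) \<le> T\<^sup>2" unfolding L2_set_le_iff[OF T0] mat_vec_def .
          moreover have "(\<Sum>j\<in>I \<inter> ?G. (\<Sum>k<n. B j k \<omega> * y k)\<^sup>2) \<le> (\<Sum>j\<in>I. (\<Sum>k<n. B j k \<omega> * y k)\<^sup>2)"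
            using I finite_subset by (intro sum_mono2) auto
          ultimately show "(\<Sum>j\<in>I \<inter> ?G. (\<Sum>k<n. B j k \<omega> * y k)\<^sup>2) \<le> T\<^sup>2" by linarith
        qed
      qed
      \<comment> \<open>The cut-off \<open>D / 2\<close> instead of \<open>D\<close> keeps all
        frequencies strictly below \<open>D\<close>, where \<open>x\<close> is nonresonant.\<close>
      also have "\<dots> \<le> exp ((D / 2)\<^sup>2 * T\<^sup>2) * (10 * (8 / (sqrt a * (D / 2)) + 4 * exp (- (\<eta> * n / 8)))) ^ card (I \<inter> ?G)"
      proof (rule prob_residual_le)
        fix j s assume j: "j \<in> I \<inter> ?G" and s: "0 \<le> s" "s \<le> D / 2"
        have jn: "j < n" using j light_rows_subset by auto
        show "exp (- row_osc j y s / 2) \<le> exp (- a * s\<^sup>2) + exp (- (\<eta> * n / 8))"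
          unfolding a_def
        proof (rule not_resonant_decay[OF jn s(1) sp, where h = h and c\<^sub>T = c\<^sub>T])
          show "\<not> resonant \<rho> \<Lambda> c\<^sub>T c2 \<eta> j x s" if "0 < s" using nr[of j s] j s that D by auto
          show "\<bar>y k - x k\<bar> \<le> h" if "k < n" for k using y(2) that by blast
          have "c\<^sub>h / sqrt n \<le> \<rho> / 2 / sqrt n" using par sn by (intro divide_right_mono) auto
          then show "h \<le> \<rho> / (2 * sqrt n)" using hle by simp
          have "c\<^sub>h / sqrt n \<le> \<Lambda> / sqrt n" using par sn by (intro divide_right_mono) auto
          then show "h \<le> \<Lambda> / sqrt n" using hle by simp
          have "s * h \<le> D * h" using s D h by (intro mult_right_mono) auto
          then have "s * h \<le> (1 / 2) / sqrt n"
            unfolding Dh using pos(4) sn divide_right_mono[of c\<^sub>h "1/2" "sqrt n"] by linarith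
          then have "(s * h)\<^sup>2 \<le> ((1 / 2) / sqrt n)\<^sup>2" using s h by (intro power_mono) auto
          then have "(s * h)\<^sup>2 \<le> 1 / (4 * n)" by (simp add: power_divide)
          then have "8 * (s * h)\<^sup>2 * row_moment j \<le> 8 * (1 / (4 * n)) * (\<tau>\<^sup>2 * (real n)\<^sup>2)"
            using j row_moment_nonneg by (intro mult_mono) (auto simp: light_rows_def)
          also have "\<dots> = 2 * \<tau>\<^sup>2 * n" using n_pos by (simp add: power2_eq_square)
          also have "\<dots> \<le> \<eta> * n" using par(5) zero_le_power2[of \<tau>] by (intro mult_right_mono) linarith+
          finally show "8 * (s * h)\<^sup>2 * row_moment j \<le> \<eta> * n" .
        qed (use pos par in auto)
      qed (use I a D in auto)
      also have "\<dots> \<le> p"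
        unfolding p_def
      proof (intro mult_mono power_mono)
        \<comment> \<open>The residual allowance \<open>T\<close> is of order
          \<open>sqrt n / D\<close>, so the exponential prefactor is at most \<open>exp n\<close>
          whatever \<open>D\<close> is.\<close>
        have "(D / 2) * T = (c\<^sub>h * R * sqrt K) * sqrt n"
        proof -
          have "(D / 2) * T = (D * h) * (R * sqrt K) * n" by (simp add: T_def)
          also have "\<dots> = c\<^sub>h * R * sqrt K * (n / sqrt n)" unfolding Dh by simp
          also have "n / sqrt n = sqrt n" by (rule real_div_sqrt) simp
          finally show ?thesis .
        qed
        then have "(D / 2)\<^sup>2 * T\<^sup>2 = (c\<^sub>h * R * sqrt K)\<^sup>2 * n"
          by (metis of_nat_0_le_iff power_mult_distrib real_sqrt_pow2)
        also have "\<dots> \<le> (1::real)\<^sup>2 * n" using par(4) pos K_pos by (intro mult_right_mono power_mono) auto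
        finally show "exp ((D / 2)\<^sup>2 * T\<^sup>2) \<le> exp (real n)" by simp
        \<comment> \<open>The cap on \<open>D\<close> enters here: the floor of the characteristic
          functions is negligible at scale \<open>1 / D\<close>.\<close>
        have "exp (- (\<eta> * n / 8)) \<le> 1 / D"
          using D by (simp add: exp_minus inverse_eq_divide frac_le)
        then have "10 * (8 / (sqrt a * (D / 2)) + 4 * exp (- (\<eta> * n / 8))) \<le> 10 * (8 / (sqrt a * (D / 2)) + 4 * (1 / D))" by simp
        also have "\<dots> = Lc / D" unfolding Lc_def using a D by (simp add: field_simps)
        finally show "10 * (8 / (sqrt a * (D / 2)) + 4 * exp (- (\<eta> * n / 8))) \<le> Lc / D" .
        show "0 \<le> 10 * (8 / (sqrt a * (D / 2)) + 4 * exp (- (\<eta> * n / 8)))" using a D by (intro mult_nonneg_nonneg add_nonneg_nonneg) auto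
      qed (use a D in \<open>auto intro!: zero_le_power mult_nonneg_nonneg add_nonneg_nonneg\<close>)
      finally have fy: "f y \<le> p" .
      define m where "m = nat \<lceil>s\<^sub>0 * sqrt n\<rceil>"
      have s0n: "0 < s\<^sub>0" using s0 D by simp
      have m: "s\<^sub>0 * sqrt n \<le> m" "m \<le> s\<^sub>0 * sqrt n + 1"
      proof -
        show "s\<^sub>0 * sqrt n \<le> m" unfolding m_def by (rule real_nat_ceiling_ge)
        have "0 \<le> s\<^sub>0 * sqrt n" using s0n sn by simp
        then have "0 \<le> \<lceil>s\<^sub>0 * sqrt n\<rceil>" by simp
        then have "real m = real_of_int \<lceil>s\<^sub>0 * sqrt n\<rceil>" unfolding m_def by simp
        then show "m \<le> s\<^sub>0 * sqrt n + 1" using of_int_ceiling_le_add_one[of "s\<^sub>0 * sqrt n"] by simp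
      qed
      have mMs: "m \<in> Ms"
      proof -
        have "D * sqrt n \<le> s\<^sub>0 * sqrt n" "s\<^sub>0 * sqrt n \<le> 2 * D * sqrt n" using s0 sn by (intro mult_right_mono; simp)+
        then show ?thesis using m unfolding Ms_def by simp
      qed
      let ?s = "real m / sqrt n"
      have ms: "s\<^sub>0 \<le> ?s" "?s \<le> s\<^sub>0 + 1 / sqrt n"
        using m sn by (auto simp: field_simps)
      have iN: "i < n" using i light_rows_subset by auto
      have "y \<in> ?V i m"
        unfolding resonant_set_def
      proof (intro CollectI conjI y(1) y2)
        have "c2 * n / 2 \<le> card (spread \<rho> \<Lambda> x \<inter> wrapping c\<^sub>T i s\<^sub>0)" using res by (simp add: resonant_def)
        also have "card (spread \<rho> \<Lambda> x \<inter> wrapping c\<^sub>T i s\<^sub>0) \<le> card {k\<in>wrapping c\<^sub>T i ?s. \<bar>y k\<bar> \<le> 2 * \<Lambda> / sqrt n}"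
        proof (rule card_mono)
          show "spread \<rho> \<Lambda> x \<inter> wrapping c\<^sub>T i s\<^sub>0 \<subseteq> {k\<in>wrapping c\<^sub>T i ?s. \<bar>y k\<bar> \<le> 2 * \<Lambda> / sqrt n}"
          proof
            fix k assume k: "k \<in> spread \<rho> \<Lambda> x \<inter> wrapping c\<^sub>T i s\<^sub>0"
            then have "k \<in> wrapping c\<^sub>T i ?s" using wrapping_mono[OF s0n ms(1) less_imp_le[OF pos(7)] iN] by blast
            moreover have "\<bar>y k\<bar> \<le> 2 * \<Lambda> / sqrt n"
            proof -
              have "k < n" "\<bar>x k\<bar> \<le> \<Lambda> / sqrt n" using k by (auto simp: spread_def)
              moreover have "c\<^sub>h / sqrt n \<le> \<Lambda> / sqrt n" using par sn by (intro divide_right_mono) auto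
              moreover have "2 * \<Lambda> / sqrt n = \<Lambda> / sqrt n + \<Lambda> / sqrt n" by simp
              ultimately show ?thesis using y(2) hle by force
            qed
            ultimately show "k \<in> {k\<in>wrapping c\<^sub>T i ?s. \<bar>y k\<bar> \<le> 2 * \<Lambda> / sqrt n}" by simp
          qed
        qed (simp add: wrapping_def)
        finally show "c2 * n / 2 \<le> card {k\<in>wrapping c\<^sub>T i ?s. \<bar>y k\<bar> \<le> 2 * \<Lambda> / sqrt n}" by simp
        \<comment> \<open>The phases move by at most \<open>2 / sqrt n\<close> through the rounded
          frequency, as \<open>\<bar>y k\<bar> \<le> 2\<close>, and by at most
          \<open>1 / sqrt n\<close> through the change from \<open>x\<close> to \<open>y\<close>. On
          a light row the bound \<open>\<eta> * n\<close> then becomes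
          \<open>2 * \<eta> * n + 3 * \<eta> * n\<close>, the threshold in
          \<open>resonant_set\<close>.\<close>
        have "row_osc i y ?s \<le> 2 * row_osc i x s\<^sub>0 + 4 * (3 / sqrt n)\<^sup>2 * row_moment i"
        proof (rule row_osc_perturb[OF iN])
          fix k assume k: "k < n"
          have "?s * y k - s\<^sub>0 * x k = (?s - s\<^sub>0) * y k + s\<^sub>0 * (y k - x k)" by (simp add: algebra_simps)
          then have "\<bar>?s * y k - s\<^sub>0 * x k\<bar> \<le> \<bar>?s - s\<^sub>0\<bar> * \<bar>y k\<bar> + s\<^sub>0 * \<bar>y k - x k\<bar>"
            using s0n by (metis abs_mult abs_of_pos abs_triangle_ineq)
          also have "\<dots> \<le> 1 / sqrt n * 2 + (2 * D) * h"
            using ms yk[OF k] y(2) k s0 D h by (intro add_mono mult_mono) auto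
          also have "(2 * D) * h = 2 * (c\<^sub>h / sqrt n)" using Dh by simp
          also have "1 / sqrt n * 2 + 2 * (c\<^sub>h / sqrt n) = (2 + 2 * c\<^sub>h) / sqrt n" by (simp add: add_divide_distrib)
          also have "\<dots> \<le> 3 / sqrt n" using pos sn by (intro divide_right_mono) auto
          finally show "\<bar>?s * y k - s\<^sub>0 * x k\<bar> \<le> 3 / sqrt n" .
        qed
        also have "\<dots> \<le> 2 * (\<eta> * n) + 4 * (3 / sqrt n)\<^sup>2 * (\<tau>\<^sup>2 * (real n)\<^sup>2)"
          using res i by (intro add_mono mult_left_mono) (auto simp: resonant_def light_rows_def)
        also have "4 * (3 / sqrt n)\<^sup>2 * (\<tau>\<^sup>2 * (real n)\<^sup>2) = 3 * (12 * \<tau>\<^sup>2) * n"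
          using n_pos by (simp add: power_divide power2_eq_square)
        also have "2 * (\<eta> * n) + 3 * (12 * \<tau>\<^sup>2) * n \<le> 2 * (\<eta> * n) + 3 * \<eta> * n"
          using par(5) by (intro add_left_mono mult_right_mono mult_left_mono) auto
        finally show "row_osc i y ?s \<le> 5 * \<eta> * n" by simp
      qed
      then show "y \<in> W" unfolding W_def using y(1) fy i mMs by blast
    qed
  qed
qed


text \<open>The power \<open>D ^ n\<close> from the box volume cancels against the rows up to
  \<open>r + 1\<close> missing ones, and the number of grid frequencies adds one more power, which
  makes \<open>D ^ (r + 2)\<close>. The powers of \<open>sqrt n\<close> from box and ball cancel
  too. What remains is a constant to the power \<open>n\<close>, made small through
  \<open>\<delta>\<close>.\<close>

lemma level_bound_arith:
  fixes D Lc \<kappa> c\<^sub>h \<delta> c2 Cv :: real and r m :: nat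
  assumes D: "1 \<le> D" and Lc: "1 \<le> Lc" and m: "m \<le> n" "n \<le> m + r + 1" and pos: "0 < \<kappa>" "0 < c\<^sub>h" "0 < \<delta>" "0 < Cv"
    and Dr: "D ^ (r + 2) \<le> exp n"
    and \<Xi>: "exp 1 * Lc * Cv * \<kappa> / (2 * c\<^sub>h) * \<delta> powr (c2 / 4) \<le> exp (- 3)"
  shows "2 * (exp n * (Lc / D) ^ m) * (n * (D * sqrt n + 2) * (\<delta> powr (c2 * n / 4) * (Cv / sqrt n) ^ n)) * (\<kappa> / (2 * (c\<^sub>h / (D * sqrt n)))) ^ n
    \<le> 6 * (real n)\<^sup>2 * exp (- 2) ^ n"
proof -
  have sn: "1 \<le> sqrt n" using n_pos by simp
  let ?\<Xi> = "exp 1 * Lc * Cv * \<kappa> / (2 * c\<^sub>h) * \<delta> powr (c2 / 4)"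
  have 1: "(Lc / D) ^ m \<le> Lc ^ n * D ^ (r + 1) / D ^ n"
  proof -
    have "D ^ n \<le> D ^ (m + (r + 1))" using D m by (intro power_increasing) auto
    then have "D ^ n \<le> D ^ m * D ^ (r + 1)" by (simp only: power_add)
    moreover have "Lc ^ m \<le> Lc ^ n" using Lc m by (intro power_increasing) auto
    ultimately have "Lc ^ m * D ^ n \<le> Lc ^ n * (D ^ m * D ^ (r + 1))"
      using D Lc by (intro mult_mono) auto
    then have "Lc ^ m / D ^ m \<le> Lc ^ n * D ^ (r + 1) / D ^ n"
      using D by (simp add: pos_divide_le_eq pos_le_divide_eq mult_ac)
    then show ?thesis by (simp add: power_divide)
  qed
  have 2: "n * (D * sqrt n + 2) \<le> 3 * (real n)\<^sup>2 * D"
  proof -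
    have "D * sqrt n \<le> D * n"
    proof (rule mult_left_mono)
      have "sqrt n \<le> sqrt n * sqrt n" using sn mult_left_mono[OF sn, of "sqrt n"] by simp
      then show "sqrt n \<le> n" by simp
    qed (use D in simp)
    moreover have "1 \<le> D * n" using D n_pos mult_mono[of 1 D 1 "real n"] by simp
    ultimately have "D * sqrt n + 2 \<le> 3 * (D * n)" by linarith
    then have "n * (D * sqrt n + 2) \<le> n * (3 * (D * n))" by (intro mult_left_mono) auto
    then show ?thesis by (simp add: power2_eq_square mult_ac)
  qed
  let ?Z = "(\<delta> powr (c2 * n / 4) * (Cv / sqrt n) ^ n) * (\<kappa> / (2 * (c\<^sub>h / (D * sqrt n)))) ^ n"
  have Z0: "0 \<le> ?Z" using pos D by (intro mult_nonneg_nonneg zero_le_power) auto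
  have e: "exp (real n) = exp 1 ^ n" by (simp add: exp_of_nat_mult[symmetric])
  have d: "\<delta> powr (c2 * n / 4) = (\<delta> powr (c2 / 4)) ^ n"
    using pos by (simp add: powr_realpow[symmetric] powr_powr)
  have "2 * (exp n * (Lc / D) ^ m) * (n * (D * sqrt n + 2) * (\<delta> powr (c2 * n / 4) * (Cv / sqrt n) ^ n)) * (\<kappa> / (2 * (c\<^sub>h / (D * sqrt n)))) ^ n
    = 2 * exp n * (((Lc / D) ^ m * (n * (D * sqrt n + 2))) * ?Z)"
    by (simp add: mult_ac)
  also have "\<dots> \<le> 2 * exp n * (((Lc ^ n * D ^ (r + 1) / D ^ n) * (3 * (real n)\<^sup>2 * D)) * ?Z)"
    using Lc D Z0 by (intro mult_left_mono mult_right_mono mult_mono 1 2) auto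
  also have "\<dots> = 6 * (real n)\<^sup>2 * (D ^ (r + 2)) * (exp 1 ^ n * Lc ^ n / D ^ n * ?Z)"
    unfolding e by simp
  also have "exp 1 ^ n * Lc ^ n / D ^ n * ?Z = ?\<Xi> ^ n"
  proof -
    have "exp 1 ^ n * Lc ^ n / D ^ n * ?Z = (exp 1 * Lc / D * (\<delta> powr (c2 / 4) * (Cv / sqrt n) * (\<kappa> / (2 * (c\<^sub>h / (D * sqrt n)))))) ^ n"
      unfolding d by (simp only: power_mult_distrib power_divide mult_ac)
    also have "exp 1 * Lc / D * (\<delta> powr (c2 / 4) * (Cv / sqrt n) * (\<kappa> / (2 * (c\<^sub>h / (D * sqrt n))))) = ?\<Xi>"
      using D sn pos by (simp add: field_simps)
    finally show ?thesis .
  qed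
  also have "6 * (real n)\<^sup>2 * (D ^ (r + 2)) * ?\<Xi> ^ n \<le> 6 * (real n)\<^sup>2 * exp n * exp (- 3) ^ n"
    using Dr \<Xi> Lc pos D by (intro mult_mono power_mono) auto
  also have "\<dots> = 6 * (real n)\<^sup>2 * exp (- 2) ^ n"
    by (simp add: exp_of_nat_mult[symmetric] exp_add[symmetric])
  finally show ?thesis .
qed

text \<open>Outside all level events, nonresonance propagates from one dyadic range to the next. The
  assumption on lower frequencies is a condition on \<open>x\<close> inside each level statement, so
  the induction is deterministic and the probabilities merely add.\<close>

lemma nonresonance_event:
  fixes R \<kappa> c\<^sub>h \<rho> \<Lambda> c\<^sub>T c2 \<eta> \<delta> \<tau> a Lc c\<^sub>D :: real and r :: nat
  defines "a \<equiv> (1 - b) * c2 * \<rho>\<^sup>2 / 192"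
  defines "Lc \<equiv> 160 / sqrt a + 40"
  assumes I: "I \<subseteq> {..<n}" "n \<le> card I + 1"
    and pos: "0 < R" "0 < \<kappa>" "0 < c\<^sub>h" "c\<^sub>h \<le> 1 / 2" "0 < \<rho>" "0 < \<Lambda>" "0 < c\<^sub>T" "0 < c2" "0 < \<eta>"
    and par: "c\<^sub>h \<le> \<rho> / 2" "c\<^sub>h \<le> \<Lambda>" "2 * \<Lambda> * c\<^sub>T \<le> pi" "c\<^sub>h * R * sqrt K \<le> 1" "12 * \<tau>\<^sup>2 \<le> \<eta>"
    and \<delta>: "4 * sqrt (6 * (80 * \<eta> / (c2 * (1 - b)))) / ((1 - b) / 2) * (2 * \<Lambda> + 3 / c\<^sub>T) \<le> \<delta>" "0 < \<delta>" "\<delta> \<le> 1"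
    and \<Xi>: "exp 1 * Lc * (2 * sqrt (2 * pi) * exp 2) * \<kappa> / (2 * c\<^sub>h) * \<delta> powr (c2 / 4) \<le> exp (- 3)"
    and \<tau>: "0 < \<tau>" "16 * \<tau>\<^sup>2 < c2 * c\<^sub>T\<^sup>2 * (1 - b)" "K / \<tau>\<^sup>2 \<le> r"
    and cD: "0 < c\<^sub>D" "c\<^sub>D \<le> \<eta> / 8" "c\<^sub>D * (r + 2) \<le> 1 / 2"
  obtains E where "E \<in> events"
    "prob E \<le> 2 * n * (((1 + 1 / R\<^sup>2) / \<kappa>\<^sup>2) ^ n + 6 * (real n)\<^sup>2 * exp (- 2) ^ n)"
    "\<And>\<omega> x i s. \<omega> \<in> space M - E \<Longrightarrow> L2_set x {..<n} = 1 \<Longrightarrow> L2_set (mat_vec n (\<lambda>i j. B i j \<omega>) x) I \<le> 0 \<Longrightarrow>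
      c2 * n \<le> card (spread \<rho> \<Lambda> x) \<Longrightarrow> i \<in> light_rows \<tau> \<Longrightarrow> 0 < s \<Longrightarrow> s \<le> exp (c\<^sub>D * n) \<Longrightarrow>
      \<not> resonant \<rho> \<Lambda> c\<^sub>T c2 \<eta> i x s"
proof -
  let ?G = "light_rows \<tau>"
  let ?bad = "\<lambda>\<omega> x. L2_set x {..<n} = 1 \<and> L2_set (mat_vec n (\<lambda>i j. B i j \<omega>) x) I \<le> 0 \<and> c2 * n \<le> card (spread \<rho> \<Lambda> x)"
  let ?res = "\<lambda>i x s. resonant \<rho> \<Lambda> c\<^sub>T c2 \<eta> i x s"
  \<comment> \<open>There are at most \<open>2 * n\<close> levels, as
    \<open>exp (c\<^sub>D * n) < 4 ^ n\<close>.\<close>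
  define lev where "lev = {j::nat. 2 ^ j \<le> exp (c\<^sub>D * n)}"
  have a: "0 < a" unfolding a_def using b pos by simp
  have Lc1: "1 \<le> Lc" unfolding Lc_def using a by (simp add: add_increasing)
  have cD2: "c\<^sub>D \<le> 1 / 4"
  proof -
    have "c\<^sub>D * 2 \<le> c\<^sub>D * (r + 2)" using cD(1) by (intro mult_left_mono) auto
    then show ?thesis using cD(3) by simp
  qed
  have levn: "lev \<subseteq> {..<2 * n}"
  proof
    fix j assume "j \<in> lev"
    then have "2 ^ j \<le> exp (c\<^sub>D * n)" by (simp add: lev_def)
    also have "\<dots> \<le> exp (1 * n)" using mult_right_mono[of c\<^sub>D 1 "real n"] cD2 by simp
    also have "\<dots> = exp 1 ^ n" by (simp add: exp_of_nat_mult[symmetric])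
    also have "\<dots> < 4 ^ n"
      using exp_le n_pos by (intro power_strict_mono) auto
    also have "(4::real) ^ n = 2 ^ (2 * n)" by (simp add: power_mult)
    finally show "j \<in> {..<2 * n}" by simp
  qed
  have flev: "finite lev" using levn finite_subset by blast
  have clev: "card lev \<le> 2 * n" using card_mono[OF _ levn] by simp
  define P where "P = ((1 + 1 / R\<^sup>2) / \<kappa>\<^sup>2) ^ n + 6 * (real n)\<^sup>2 * exp (- 2) ^ n"
  have P0: "0 \<le> P" unfolding P_def using pos by (intro add_nonneg_nonneg mult_nonneg_nonneg zero_le_power divide_nonneg_nonneg) auto
  have "\<exists>E. E \<in> events \<and> prob E \<le> P \<and> (\<forall>\<omega>\<in>space M - E. \<forall>x. ?bad \<omega> x \<longrightarrow>
      (\<forall>j s. j \<in> ?G \<longrightarrow> 0 < s \<longrightarrow> s < 2 ^ l \<longrightarrow> \<not> ?res j x s) \<longrightarrow>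
      (\<forall>i s. i \<in> ?G \<longrightarrow> 2 ^ l \<le> s \<longrightarrow> s \<le> 2 * 2 ^ l \<longrightarrow> \<not> ?res i x s))" if l: "l \<in> lev" for l
  proof -
    have D: "(1::real) \<le> 2 ^ l" "(2::real) ^ l \<le> exp (\<eta> * n / 8)"
    proof -
      have "2 ^ l \<le> exp (c\<^sub>D * n)" using l by (simp add: lev_def)
      also have "\<dots> \<le> exp (\<eta> * n / 8)" using mult_right_mono[OF cD(2), of "real n"] by simp
      finally show "(2::real) ^ l \<le> exp (\<eta> * n / 8)" .
    qed simp
    obtain E where E: "E \<in> events"
      "prob E \<le> ((1 + 1 / R\<^sup>2) / \<kappa>\<^sup>2) ^ n + 2 * (exp n * ((160 / sqrt ((1 - b) * c2 * \<rho>\<^sup>2 / 192) + 40) / 2 ^ l) ^ card (I \<inter> ?G)) *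
       (n * (2 ^ l * sqrt n + 2) * (\<delta> powr (c2 * n / 4) * (2 * sqrt (2 * pi) * exp 2 / sqrt n) ^ n)) * (\<kappa> / (2 * (c\<^sub>h / (2 ^ l * sqrt n)))) ^ n"
      "\<And>\<omega> x i s\<^sub>0. \<omega> \<in> space M - E \<Longrightarrow> L2_set x {..<n} = 1 \<Longrightarrow> L2_set (mat_vec n (\<lambda>i j. B i j \<omega>) x) I \<le> 0 \<Longrightarrow>
        c2 * n \<le> card (spread \<rho> \<Lambda> x) \<Longrightarrow>
        (\<And>j s. j \<in> ?G \<Longrightarrow> 0 < s \<Longrightarrow> s < 2 ^ l \<Longrightarrow> \<not> ?res j x s) \<Longrightarrow>
        i \<in> ?G \<Longrightarrow> 2 ^ l \<le> s\<^sub>0 \<Longrightarrow> s\<^sub>0 \<le> 2 * 2 ^ l \<Longrightarrow> ?res i x s\<^sub>0 \<Longrightarrow> False"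
      using level_event[OF I(1) pos par \<delta> D] by blast
    have "2 * (exp n * (Lc / 2 ^ l) ^ card (I \<inter> ?G)) *
       (n * (2 ^ l * sqrt n + 2) * (\<delta> powr (c2 * n / 4) * (2 * sqrt (2 * pi) * exp 2 / sqrt n) ^ n)) * (\<kappa> / (2 * (c\<^sub>h / (2 ^ l * sqrt n)))) ^ n
       \<le> 6 * (real n)\<^sup>2 * exp (- 2) ^ n"
    proof (rule level_bound_arith[OF D(1) Lc1 _ _ pos(2,3) \<delta>(2) _ _ \<Xi>, where r = r])
      have fI: "finite I" using I finite_subset by blast
      show "card (I \<inter> ?G) \<le> n" using card_mono[of "{..<n}" "I \<inter> ?G"] I by auto
      have "card I \<le> card (I \<inter> ?G) + card ({..<n} - ?G)"
        by (rule order_trans[OF card_mono card_Un_le]) (use I fI in auto)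
      moreover have "real (card ({..<n} - ?G)) \<le> r" using card_heavy_rows_le[OF \<tau>(1)] \<tau>(3) by linarith
      ultimately show "n \<le> card (I \<inter> ?G) + r + 1" using I(2) by linarith
      have "(2::real) ^ l \<le> exp (c\<^sub>D * n)" using l by (simp add: lev_def)
      then have "((2::real) ^ l) ^ (r + 2) \<le> exp (c\<^sub>D * n) ^ (r + 2)" by (intro power_mono) auto
      also have "\<dots> = exp (real (r + 2) * (c\<^sub>D * n))" by (rule exp_of_nat_mult[symmetric])
      also have "real (r + 2) * (c\<^sub>D * n) = (c\<^sub>D * (r + 2)) * n" by simp
      also have "exp ((c\<^sub>D * (r + 2)) * n) \<le> exp (1 * n)"
        using mult_right_mono[of "c\<^sub>D * (r + 2)" 1 "real n"] cD(3) by simp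
      finally show "((2::real) ^ l) ^ (r + 2) \<le> exp n" by simp
    qed simp
    then have "prob E \<le> P" using E(2) unfolding P_def Lc_def a_def by linarith
    with E(1,3) show ?thesis by blast
  qed
  then have "\<forall>l\<in>lev. \<exists>E. E \<in> events \<and> prob E \<le> P \<and> (\<forall>\<omega>\<in>space M - E. \<forall>x. ?bad \<omega> x \<longrightarrow>
      (\<forall>j s. j \<in> ?G \<longrightarrow> 0 < s \<longrightarrow> s < 2 ^ l \<longrightarrow> \<not> ?res j x s) \<longrightarrow>
      (\<forall>i s. i \<in> ?G \<longrightarrow> 2 ^ l \<le> s \<longrightarrow> s \<le> 2 * 2 ^ l \<longrightarrow> \<not> ?res i x s))"
    by (rule ballI)
  from bchoice[OF this] obtain E where E0: "\<forall>l\<in>lev. E l \<in> events \<and> prob (E l) \<le> P \<and> (\<forall>\<omega>\<in>space M - E l. \<forall>x. ?bad \<omega> x \<longrightarrow>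
      (\<forall>j s. j \<in> ?G \<longrightarrow> 0 < s \<longrightarrow> s < 2 ^ l \<longrightarrow> \<not> ?res j x s) \<longrightarrow>
      (\<forall>i s. i \<in> ?G \<longrightarrow> 2 ^ l \<le> s \<longrightarrow> s \<le> 2 * 2 ^ l \<longrightarrow> \<not> ?res i x s))"
    by (rule exE)
  have E: "E l \<in> events" "prob (E l) \<le> P"
    "\<And>\<omega> x. \<omega> \<in> space M - E l \<Longrightarrow> ?bad \<omega> x \<Longrightarrow>
      (\<forall>j s. j \<in> ?G \<longrightarrow> 0 < s \<longrightarrow> s < 2 ^ l \<longrightarrow> \<not> ?res j x s) \<Longrightarrow>
      (\<forall>i s. i \<in> ?G \<longrightarrow> 2 ^ l \<le> s \<longrightarrow> s \<le> 2 * 2 ^ l \<longrightarrow> \<not> ?res i x s)" if "l \<in> lev" for l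
    using bspec[OF E0 that] by (simp_all del: not_le not_less)
  show thesis
  proof (rule that[of "\<Union>l\<in>lev. E l"])
    show "(\<Union>l\<in>lev. E l) \<in> events" using E(1) flev by auto
    have "prob (\<Union>l\<in>lev. E l) \<le> (\<Sum>l\<in>lev. prob (E l))"
      using E(1) flev by (intro finite_measure_subadditive_finite) auto
    also have "\<dots> \<le> (\<Sum>l\<in>lev. P)" using E(2) by (intro sum_mono) auto
    also have "\<dots> = card lev * P" by simp
    also have "\<dots> \<le> (2 * n) * P" using clev P0 by (intro mult_right_mono) auto
    finally show "prob (\<Union>l\<in>lev. E l) \<le> 2 * n * (((1 + 1 / R\<^sup>2) / \<kappa>\<^sup>2) ^ n + 6 * (real n)\<^sup>2 * exp (- 2) ^ n)"
      by (simp add: P_def)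
    fix \<omega> x i s
    assume \<omega>: "\<omega> \<in> space M - (\<Union>l\<in>lev. E l)" and x: "L2_set x {..<n} = 1" "L2_set (mat_vec n (\<lambda>i j. B i j \<omega>) x) I \<le> 0"
      "c2 * n \<le> card (spread \<rho> \<Lambda> x)" and i: "i \<in> ?G" and s: "0 < s" "s \<le> exp (c\<^sub>D * n)"
    have low: "\<not> ?res j x u" if "j \<in> ?G" "0 < u" "u \<le> 1" for j u
      by (rule not_resonant_low_frequency[OF that(1,2,3) pos(7) \<tau>(2)])
    have dyadic: "\<exists>l. 2 ^ l \<le> u \<and> u \<le> 2 * 2 ^ l" if u1: "1 \<le> u" for u :: real
    proof -
      have "\<exists>l. u < 2 ^ l" using real_arch_pow[of 2 u] by simp
      then obtain l where l: "u < 2 ^ l" "\<And>l'. l' < l \<Longrightarrow> \<not> u < 2 ^ l'" using exists_least_iff[of "\<lambda>l. u < 2 ^ l"] by blast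
      have "l \<noteq> 0" using l(1) u1 by (cases l) auto
      then obtain l' where "l = Suc l'" using not0_implies_Suc by blast
      then show ?thesis using l(1) l(2)[of l'] by (intro exI[of _ l']) auto
    qed
    \<comment> \<open>A frequency below \<open>2 ^ l\<close> is at most 1 or belongs to a lower
      level, so all light rows are nonresonant there and the statement at level \<open>l\<close>
      applies.\<close>
    have all: "\<forall>j\<in>?G. \<forall>u. 2 ^ l \<le> u \<longrightarrow> u \<le> 2 * 2 ^ l \<longrightarrow> \<not> ?res j x u" if "l \<in> lev" for l
      using that
    proof (induction l rule: less_induct)
      case (less l)
      have "\<not> ?res j x u" if j: "j \<in> ?G" and u: "0 < u" "u < 2 ^ l" for j u
      proof (cases "u \<le> 1")
        case True
        then show ?thesis using low j u by blast
      next
        case False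
        then obtain l' where l': "2 ^ l' \<le> u" "u \<le> 2 * 2 ^ l'" using dyadic[of u] by auto
        have "(2::real) ^ l' < 2 ^ l" by (rule le_less_trans[OF l'(1) u(2)])
        then have "l' < l" by simp
        have "(2::real) ^ l \<le> exp (c\<^sub>D * n)" using less.prems by (simp add: lev_def)
        with \<open>(2::real) ^ l' < 2 ^ l\<close> have "(2::real) ^ l' \<le> exp (c\<^sub>D * n)" by linarith
        then have "l' \<in> lev" by (simp add: lev_def)
        then show ?thesis using less.IH[OF \<open>l' < l\<close>] j l' by blast
      qed
      moreover have "\<omega> \<in> space M - E l" using \<omega> less.prems by blast
      moreover have "?bad \<omega> x" using x by blast
      ultimately have "\<forall>i s. i \<in> ?G \<longrightarrow> 2 ^ l \<le> s \<longrightarrow> s \<le> 2 * 2 ^ l \<longrightarrow> \<not> ?res i x s"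
        by (intro E(3)[OF less.prems]) blast+
      then show ?case by blast
    qed
    show "\<not> ?res i x s"
    proof (cases "s \<le> 1")
      case True
      then show ?thesis using low i s by blast
    next
      case False
      then obtain l where l: "2 ^ l \<le> s" "s \<le> 2 * 2 ^ l" using dyadic[of s] by auto
      have "2 ^ l \<le> exp (c\<^sub>D * n)" using l(1) s(2) by (rule order_trans)
      then have "l \<in> lev" by (simp add: lev_def)
      then show ?thesis using all i l by blast
    qed
  qed
qed

text \<open>The tensorised estimate for a single row, at the unperturbed vector, that is with
  \<open>h = 0\<close>.\<close>

lemma nonresonant_small_ball:
  fixes \<rho> \<Lambda> c\<^sub>T c2 \<eta> t c\<^sub>D a :: real
  defines "a \<equiv> (1 - b) * c2 * \<rho>\<^sup>2 / 192"
  assumes i: "i < n" and sp: "c2 * n \<le> card (spread \<rho> \<Lambda> x)"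
    and pos: "0 < \<rho>" "0 < \<Lambda>" "0 < c2" "0 < c\<^sub>T" "2 * \<Lambda> * c\<^sub>T \<le> pi" "0 < \<eta>"
    and cD: "0 < c\<^sub>D" "c\<^sub>D \<le> \<eta> / 8"
    and nr: "\<And>s. 0 < s \<Longrightarrow> s \<le> exp (c\<^sub>D * n) \<Longrightarrow> \<not> resonant \<rho> \<Lambda> c\<^sub>T c2 \<eta> i x s"
    and t: "0 \<le> t"
  shows "prob {\<omega>\<in>space M. \<bar>\<Sum>k<n. B i k \<omega> * x k\<bar> \<le> t} \<le> exp 1 * (80 / sqrt a + 40) * (t + exp (- c\<^sub>D * n))"
proof -
  \<comment> \<open>Frequencies above \<open>exp (c\<^sub>D * n)\<close> are not under control, so
    the radius is raised to the inverse of that value. The choice \<open>D = 1 / t'\<close> makes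
    the prefactor equal to \<open>exp 1\<close>.\<close>
  define t' where "t' = max t (exp (- c\<^sub>D * n))"
  have t': "0 < t'" "t \<le> t'" "exp (- c\<^sub>D * n) \<le> t'" "t' \<le> t + exp (- c\<^sub>D * n)"
    unfolding t'_def using t by (auto simp: less_max_iff_disj)
  define D where "D = 1 / t'"
  have D: "0 < D" using t' by (simp add: D_def)
  have Dle: "D \<le> exp (c\<^sub>D * n)"
  proof -
    have "D \<le> 1 / exp (- c\<^sub>D * n)" unfolding D_def using t' by (intro divide_left_mono) auto
    also have "1 / exp (- c\<^sub>D * n) = exp (c\<^sub>D * n)" by (simp add: exp_minus inverse_eq_divide)
    finally show ?thesis .
  qed
  have a: "0 < a" unfolding a_def using b pos by simp
  have m: "(\<lambda>\<omega>. (\<Sum>k<n. B i k \<omega> * x k)\<^sup>2) \<in> borel_measurable M"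
    using row_sum_measurable[OF i, of x] by (intro borel_measurable_power) auto
  have "prob {\<omega>\<in>space M. \<bar>\<Sum>k<n. B i k \<omega> * x k\<bar> \<le> t} \<le> prob {\<omega>\<in>space M. (\<Sum>i\<in>{i}. (\<Sum>k<n. B i k \<omega> * x k)\<^sup>2) \<le> t'\<^sup>2}"
  proof (rule finite_measure_mono)
    show "{\<omega>\<in>space M. (\<Sum>i\<in>{i}. (\<Sum>k<n. B i k \<omega> * x k)\<^sup>2) \<le> t'\<^sup>2} \<in> events" using m by simp
    show "{\<omega>\<in>space M. \<bar>\<Sum>k<n. B i k \<omega> * x k\<bar> \<le> t} \<subseteq> {\<omega>\<in>space M. (\<Sum>i\<in>{i}. (\<Sum>k<n. B i k \<omega> * x k)\<^sup>2) \<le> t'\<^sup>2}"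
    proof safe
      fix \<omega> assume "\<bar>\<Sum>k<n. B i k \<omega> * x k\<bar> \<le> t"
      then have "\<bar>\<Sum>k<n. B i k \<omega> * x k\<bar> \<le> \<bar>t'\<bar>" using t' by simp
      then show "(\<Sum>i\<in>{i}. (\<Sum>k<n. B i k \<omega> * x k)\<^sup>2) \<le> t'\<^sup>2" unfolding abs_le_square_iff by simp
    qed
  qed
  also have "\<dots> \<le> exp (D\<^sup>2 * t'\<^sup>2) * (10 * (8 / (sqrt a * D) + 4 * exp (- (\<eta> * n / 8)))) ^ card {i}"
  proof (rule prob_residual_le[OF _ D a])
    fix j s assume j: "j \<in> {i}" and s: "0 \<le> s" "s \<le> D"
    have "exp (- row_osc i x s / 2) \<le> exp (- ((1 - b) * c2 * \<rho>\<^sup>2 / 192) * s\<^sup>2) + exp (- (\<eta> * n / 8))"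
      by (rule not_resonant_decay[OF i s(1) sp, where h = 0 and c\<^sub>T = c\<^sub>T]) (use nr[of s] s Dle pos in auto)
    then show "exp (- row_osc j x s / 2) \<le> exp (- a * s\<^sup>2) + exp (- (\<eta> * n / 8))" using j by (simp add: a_def)
  qed (use i in auto)
  also have "\<dots> = exp 1 * (10 * (8 / sqrt a * t' + 4 * exp (- (\<eta> * n / 8))))"
    using t' by (simp add: D_def power_divide)
  also have "\<dots> \<le> exp 1 * (10 * (8 / sqrt a * t' + 4 * t'))"
  proof -
    have "c\<^sub>D * n \<le> \<eta> * n / 8" using mult_right_mono[OF cD(2), of "real n"] by simp
    then have "exp (- (\<eta> * n / 8)) \<le> exp (- c\<^sub>D * n)" by simp
    then have "exp (- (\<eta> * n / 8)) \<le> t'" using t'(3) by (rule order_trans)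
    then show ?thesis by simp
  qed
  also have "\<dots> = exp 1 * (80 / sqrt a + 40) * t'" by (simp add: algebra_simps)
  also have "\<dots> \<le> exp 1 * (80 / sqrt a + 40) * (t + exp (- c\<^sub>D * n))"
    using t'(4) a by (intro mult_left_mono) auto
  finally show ?thesis .
qed

end

subsection \<open>Distances to hyperplanes\<close>

text \<open>Gaussian elimination: a pivot equation with nonzero last coefficient removes the last
  unknown from the other equations, and both counts drop by one. Without a pivot the last basis
  vector is a solution.\<close>

lemma exists_orthogonal:
  fixes a :: "'l \<Rightarrow> nat \<Rightarrow> real"
  assumes "finite L" "card L < n"
  shows "\<exists>v. (\<exists>i<n. v i \<noteq> 0) \<and> (\<forall>l\<in>L. (\<Sum>i<n. a l i * v i) = 0)"
  using assms
proof (induction n arbitrary: L a)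
  case 0
  then show ?case by simp
next
  case (Suc n)
  show ?case
  proof (cases "\<forall>l\<in>L. a l n = 0")
    case True
    then have "(\<Sum>i<Suc n. a l i * (if i = n then 1 else 0)) = 0" if "l \<in> L" for l
      using that by simp
    then show ?thesis by (intro exI[of _ "\<lambda>i. if i = n then 1 else 0"]) auto
  next
    case False
    then obtain l0 where l0: "l0 \<in> L" "a l0 n \<noteq> 0" by blast
    let ?a = "\<lambda>l i. a l i - a l n / a l0 n * a l0 i"
    have "card (L - {l0}) < n" using Suc.prems card_Diff1_less[OF Suc.prems(1) l0(1)] by linarith
    then obtain v where v: "\<exists>i<n. v i \<noteq> 0" "\<And>l. l \<in> L - {l0} \<Longrightarrow> (\<Sum>i<n. ?a l i * v i) = 0"
      using Suc.IH[of "L - {l0}" ?a] Suc.prems by auto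
    define w where "w i = (if i = n then - (\<Sum>i<n. a l0 i * v i) / a l0 n else v i)" for i
    have wn: "(\<Sum>i<n. c i * w i) = (\<Sum>i<n. c i * v i)" for c
      by (rule sum.cong) (auto simp: w_def)
    have "(\<Sum>i<Suc n. a l i * w i) = 0" if "l \<in> L" for l
    proof (cases "l = l0")
      case True
      then show ?thesis using l0 by (simp add: wn) (simp add: w_def)
    next
      case False
      then have "(\<Sum>i<n. a l i * v i) - a l n / a l0 n * (\<Sum>i<n. a l0 i * v i) = 0"
        using v(2)[of l] that by (simp add: left_diff_distrib sum_subtractf sum_distrib_left mult.assoc)
      then show ?thesis by (simp add: wn) (simp add: w_def)
    qed
    moreover have "\<exists>i<Suc n. w i \<noteq> 0" using v(1) by (auto simp: w_def intro: less_SucI)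
    ultimately show ?thesis by blast
  qed
qed

lemma exists_orthogonal_unit:
  fixes a :: "'l \<Rightarrow> nat \<Rightarrow> real"
  assumes "finite L" "card L < n"
  shows "\<exists>v. L2_set v {..<n} = 1 \<and> (\<forall>l\<in>L. (\<Sum>i<n. a l i * v i) = 0)"
proof -
  obtain v where v: "\<exists>i<n. v i \<noteq> 0" "\<And>l. l \<in> L \<Longrightarrow> (\<Sum>i<n. a l i * v i) = 0"
    using exists_orthogonal[OF assms] by blast
  have "L2_set v {..<n} \<noteq> 0" using v(1) by (auto simp: L2_set_eq_0_iff)
  then have pos: "0 < L2_set v {..<n}" using L2_set_nonneg[of v "{..<n}"] by linarith
  let ?c = "1 / L2_set v {..<n}"
  have "L2_set (\<lambda>i. ?c * v i) {..<n} = 1" using pos by (subst L2_set_scale) simp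
  moreover have "(\<Sum>i<n. a l i * (?c * v i)) = 0" if "l \<in> L" for l
  proof -
    have "(\<Sum>i<n. a l i * (?c * v i)) = ?c * (\<Sum>i<n. a l i * v i)" by (simp add: sum_distrib_left mult_ac)
    then show ?thesis using v(2)[OF that] by simp
  qed
  ultimately show ?thesis by blast
qed

section \<open>The distance of a row from the span of the others\<close>

context random_square_matrix
begin

text \<open>A unit normal \<open>v\<close> to the other rows is chosen separately for each outcome
  of these rows, and only then row \<open>k\<close> is averaged by Fubini. So \<open>v\<close> never
  has to depend measurably on the outcome.\<close>

lemma distance_event:
  fixes t p :: real
  assumes k: "k < n" and I: "I = {..<n} - {k}" and E: "E \<in> events" and p: "0 \<le> p"
    and normal: "\<And>\<omega> v. \<omega> \<in> space M - E \<Longrightarrow> L2_set v {..<n} = 1 \<Longrightarrow>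
      L2_set (mat_vec n (\<lambda>i j. B i j \<omega>) v) I \<le> 0 \<Longrightarrow>
      prob {\<omega>'\<in>space M. \<bar>\<Sum>j<n. B k j \<omega>' * v j\<bar> \<le> t} \<le> p"
  obtains S where "S \<in> events" "prob S \<le> prob E + p"
    "\<And>\<omega> z. \<omega> \<in> space M \<Longrightarrow> L2_set (\<lambda>j. B k j \<omega> + (\<Sum>l\<in>I. z l * B l j \<omega>)) {..<n} < t \<Longrightarrow> \<omega> \<in> S"
proof -
  note emm = emeasure_eq_measure and fmm = finite_measure_mono and ps = prob_space_axioms
  let ?X = "{k} \<times> {..<n}" and ?Y = "I \<times> {..<n}"
  let ?PX = "PiM ?X (\<lambda>_. borel :: real measure)" and ?PY = "PiM ?Y (\<lambda>_. borel :: real measure)"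
  define X where "X \<omega> = (\<lambda>p\<in>?X. B (fst p) (snd p) \<omega>)" for \<omega>
  define Y where "Y \<omega> = (\<lambda>p\<in>?Y. B (fst p) (snd p) \<omega>)" for \<omega>
  have iv: "indep_var ?PX X ?PY Y"
    using indep_var_restrict[OF indep, of ?X ?Y] k I by (auto simp: X_def[abs_def] Y_def[abs_def] case_prod_beta)
  have Xm: "X \<in> M \<rightarrow>\<^sub>M ?PX" and Ym: "Y \<in> M \<rightarrow>\<^sub>M ?PY" and
    law: "distr M ?PX X \<Otimes>\<^sub>M distr M ?PY Y = distr M (?PX \<Otimes>\<^sub>M ?PY) (\<lambda>\<omega>. (X \<omega>, Y \<omega>))"
    using iv[unfolded indep_var_distribution_eq] by auto
  interpret N1: prob_space "distr M ?PX X" by (rule prob_space_distr[OF Xm])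
  interpret N2: prob_space "distr M ?PY Y" by (rule prob_space_distr[OF Ym])
  interpret NN: pair_sigma_finite "distr M ?PX X" "distr M ?PY Y" ..
  obtain D :: "(nat \<Rightarrow> real) set" where D: "countable D"
    "\<And>U. open U \<Longrightarrow> U \<noteq> {} \<Longrightarrow> \<exists>d\<in>D. d \<in> U"
    by (rule countable_dense_setE) blast
  define d where "d x y z = L2_set (\<lambda>j. x (k, j) + (\<Sum>l\<in>I. z l * y (l, j))) {..<n}" for x y :: "nat \<times> nat \<Rightarrow> real" and z :: "nat \<Rightarrow> real"
  \<comment> \<open>The condition on \<open>z\<close> is open, so coefficients from a countable
    dense set detect it and \<open>T\<close> is measurable.\<close>
  define T where "T = {q\<in>space (?PX \<Otimes>\<^sub>M ?PY). \<exists>z\<in>D. d (fst q) (snd q) z < t}"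
  have dm: "(\<lambda>q. d (fst q) (snd q) z) \<in> borel_measurable (?PX \<Otimes>\<^sub>M ?PY)" for z
  proof -
    have 1: "(\<lambda>q. fst q (k, j)) \<in> borel_measurable (?PX \<Otimes>\<^sub>M ?PY)" if "j < n" for j
      using that by (intro measurable_compose[OF measurable_fst measurable_component_singleton]) auto
    have 2: "(\<lambda>q. snd q (l, j)) \<in> borel_measurable (?PX \<Otimes>\<^sub>M ?PY)" if "l \<in> I" "j < n" for l j
      using that by (intro measurable_compose[OF measurable_snd measurable_component_singleton]) auto
    show ?thesis unfolding d_def L2_set_def
      by (intro measurable_compose[OF _ borel_measurable_sqrt] borel_measurable_sum borel_measurable_power
          borel_measurable_add borel_measurable_times borel_measurable_const 1 2) auto
  qed
  have Tm: "T \<in> sets (?PX \<Otimes>\<^sub>M ?PY)"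
    unfolding T_def using dm D(1) by measurable
  have Tm': "T \<in> sets (distr M ?PX X \<Otimes>\<^sub>M distr M ?PY Y)"
    using Tm by (simp cong: sets_pair_measure_cong)
  define S where "S = {\<omega>\<in>space M. (X \<omega>, Y \<omega>) \<in> T}"
  have XYm: "(\<lambda>\<omega>. (X \<omega>, Y \<omega>)) \<in> M \<rightarrow>\<^sub>M ?PX \<Otimes>\<^sub>M ?PY" using Xm Ym by measurable
  have S: "S \<in> sets M" unfolding S_def using measurable_sets[OF XYm Tm] by (simp add: vimage_def Int_def conj_commute)
  have sect: "{\<omega>'\<in>space M. (X \<omega>', Y \<omega>) \<in> T} \<in> sets M" if "\<omega> \<in> space M" for \<omega>
  proof -
    have "(\<lambda>\<omega>'. (X \<omega>', Y \<omega>)) \<in> M \<rightarrow>\<^sub>M ?PX \<Otimes>\<^sub>M ?PY"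
      using Xm measurable_space[OF Ym that] by measurable
    from measurable_sets[OF this Tm] show ?thesis by (simp add: vimage_def Int_def conj_commute)
  qed
  have "emeasure M S = emeasure (distr M (?PX \<Otimes>\<^sub>M ?PY) (\<lambda>\<omega>. (X \<omega>, Y \<omega>))) T"
    unfolding S_def by (subst emeasure_distr[OF XYm Tm]) (auto intro!: arg_cong[where f = "emeasure M"])
  also have "\<dots> = emeasure (distr M ?PX X \<Otimes>\<^sub>M distr M ?PY Y) T" by (simp only: law)
  also have "\<dots> = (\<integral>\<^sup>+y. emeasure (distr M ?PX X) ((\<lambda>x. (x, y)) -` T) \<partial>distr M ?PY Y)"
    by (rule NN.emeasure_pair_measure_alt2[OF Tm'])
  also have "\<dots> = (\<integral>\<^sup>+\<omega>. emeasure (distr M ?PX X) ((\<lambda>x. (x, Y \<omega>)) -` T) \<partial>M)"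
    using NN.measurable_emeasure_Pair2[OF Tm'] by (intro nn_integral_distr[OF Ym]) simp
  \<comment> \<open>From here on the other rows are frozen at \<open>\<omega>\<close>, while
    \<open>\<omega>'\<close> carries an independent row \<open>k\<close>.\<close>
  also have "\<dots> \<le> (\<integral>\<^sup>+\<omega>. indicator E \<omega> + ennreal p \<partial>M)"
  proof (rule nn_integral_mono)
    fix \<omega> assume \<omega>: "\<omega> \<in> space M"
    have "(\<lambda>x. (x, Y \<omega>)) -` T \<in> sets ?PX"
    proof -
      have "(\<lambda>x. (x, Y \<omega>)) -` T \<in> sets (distr M ?PX X)" by (rule sets_Pair2[OF Tm'])
      then show ?thesis by simp
    qed
    then have "emeasure (distr M ?PX X) ((\<lambda>x. (x, Y \<omega>)) -` T) = emeasure M (X -` ((\<lambda>x. (x, Y \<omega>)) -` T) \<inter> space M)"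
      by (rule emeasure_distr[OF Xm])
    also have "X -` ((\<lambda>x. (x, Y \<omega>)) -` T) \<inter> space M = {\<omega>'\<in>space M. (X \<omega>', Y \<omega>) \<in> T}" by auto
    also have "emeasure M {\<omega>'\<in>space M. (X \<omega>', Y \<omega>) \<in> T} \<le> indicator E \<omega> + ennreal p"
    proof (cases "\<omega> \<in> E")
      case True
      have "emeasure M {\<omega>'\<in>space M. (X \<omega>', Y \<omega>) \<in> T} \<le> 1" by (rule prob_space.emeasure_le_1[OF ps])
      then show ?thesis using True by (simp add: add_increasing2)
    next
      case False
      have fI: "finite I" and cI: "card I < n" using I k by auto
      obtain v where v: "L2_set v {..<n} = 1" "\<And>l. l \<in> I \<Longrightarrow> (\<Sum>j<n. B l j \<omega> * v j) = 0"
        using exists_orthogonal_unit[OF fI cI, of "\<lambda>l j. B l j \<omega>"] by blast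
      have "L2_set (mat_vec n (\<lambda>i j. B i j \<omega>) v) I = 0"
        using fI v(2) by (simp add: L2_set_eq_0_iff mat_vec_def)
      then have pv: "measure M {\<omega>'\<in>space M. \<bar>\<Sum>j<n. B k j \<omega>' * v j\<bar> \<le> t} \<le> p"
        using normal[of \<omega> v] \<omega> False v(1) by simp
      have "measure M {\<omega>'\<in>space M. (X \<omega>', Y \<omega>) \<in> T} \<le> measure M {\<omega>'\<in>space M. \<bar>\<Sum>j<n. B k j \<omega>' * v j\<bar> \<le> t}"
      proof (rule fmm)
        have "(\<lambda>\<omega>'. \<Sum>j<n. B k j \<omega>' * v j) \<in> borel_measurable M"
          using k by (intro borel_measurable_sum borel_measurable_times entry_measurable borel_measurable_const) auto
        then show "{\<omega>'\<in>space M. \<bar>\<Sum>j<n. B k j \<omega>' * v j\<bar> \<le> t} \<in> sets M" by measurable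
        show "{\<omega>'\<in>space M. (X \<omega>', Y \<omega>) \<in> T} \<subseteq> {\<omega>'\<in>space M. \<bar>\<Sum>j<n. B k j \<omega>' * v j\<bar> \<le> t}"
        proof safe
          fix \<omega>' assume "(X \<omega>', Y \<omega>) \<in> T"
          then obtain z where z: "d (X \<omega>') (Y \<omega>) z < t" by (auto simp: T_def)
          let ?u = "\<lambda>j. B k j \<omega>' + (\<Sum>l\<in>I. z l * B l j \<omega>)"
          have du: "d (X \<omega>') (Y \<omega>) z = L2_set ?u {..<n}"
            unfolding d_def by (intro L2_set_cong refl) (auto simp: X_def Y_def intro!: sum.cong)
          have "(\<Sum>j<n. ?u j * v j) = (\<Sum>j<n. B k j \<omega>' * v j) + (\<Sum>j<n. \<Sum>l\<in>I. z l * (B l j \<omega> * v j))"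
            by (simp add: distrib_right sum.distrib sum_distrib_right mult.assoc)
          also have "(\<Sum>j<n. \<Sum>l\<in>I. z l * (B l j \<omega> * v j)) = (\<Sum>l\<in>I. z l * (\<Sum>j<n. B l j \<omega> * v j))"
            by (subst sum.swap) (simp add: sum_distrib_left)
          also have "\<dots> = 0" using v(2) by simp
          finally have "\<bar>\<Sum>j<n. B k j \<omega>' * v j\<bar> = \<bar>\<Sum>j<n. ?u j * v j\<bar>" by simp
          also have "\<dots> \<le> (\<Sum>j<n. \<bar>?u j\<bar> * \<bar>v j\<bar>)" by (rule order_trans[OF sum_abs]) (simp add: abs_mult)
          also have "\<dots> \<le> L2_set ?u {..<n} * L2_set v {..<n}" by (rule L2_set_mult_ineq)
          also have "\<dots> \<le> t" using z v(1) du by simp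
          finally show "\<bar>\<Sum>j<n. B k j \<omega>' * v j\<bar> \<le> t" .
        qed
      qed
      then have "measure M {\<omega>'\<in>space M. (X \<omega>', Y \<omega>) \<in> T} \<le> p" using pv by linarith
      then show ?thesis using False by (simp add: emm ennreal_leI)
    qed
    finally show "emeasure (distr M ?PX X) ((\<lambda>x. (x, Y \<omega>)) -` T) \<le> indicator E \<omega> + ennreal p" .
  qed
  also have "\<dots> = emeasure M E + ennreal p"
    using E by (subst nn_integral_add) (auto simp: prob_space.emeasure_space_1[OF ps])
  also have "\<dots> = ennreal (measure M E + p)" using p by (simp add: emm)
  finally have "measure M S \<le> measure M E + p" unfolding emm using p by (subst (asm) ennreal_le_iff) auto
  moreover have "\<omega> \<in> S" if \<omega>: "\<omega> \<in> space M" and z: "L2_set (\<lambda>j. B k j \<omega> + (\<Sum>l\<in>I. z l * B l j \<omega>)) {..<n} < t" for \<omega> z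
  proof -
    have du: "d (X \<omega>) (Y \<omega>) z = L2_set (\<lambda>j. B k j \<omega> + (\<Sum>l\<in>I. z l * B l j \<omega>)) {..<n}" for z
      unfolding d_def by (intro L2_set_cong refl) (auto simp: X_def Y_def intro!: sum.cong)
    have "open {z. d (X \<omega>) (Y \<omega>) z < t}"
      unfolding d_def L2_set_def
      by (intro open_Collect_less continuous_intros continuous_on_product_coordinates)
    moreover have "{z. d (X \<omega>) (Y \<omega>) z < t} \<noteq> {}" using z du by auto
    ultimately obtain z' where "z' \<in> D" "d (X \<omega>) (Y \<omega>) z' < t" using D(2) by blast
    then show ?thesis unfolding S_def T_def using \<omega> measurable_space[OF XYm \<omega>] by auto
  qed
  ultimately show thesis using S that by blast
qed

end

subsection \<open>Choice of constants\<close>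

text \<open>The constants have to be fixed before the matrix, hence outside the locale;
  \<open>d\<close> repeats \<open>row_decay\<close>. The conditions are those of
  \<open>compressible_event\<close>, together with those that make its probability bound
  exponentially small.\<close>

definition compressible_constants ::
  "real \<Rightarrow> real \<Rightarrow> real \<Rightarrow> real \<Rightarrow> real \<Rightarrow> real \<Rightarrow> real \<Rightarrow> real \<Rightarrow> real \<Rightarrow> real \<Rightarrow> real \<Rightarrow> real \<Rightarrow> bool" where
  "compressible_constants K b \<mu> c q \<kappa> R t c\<^sub>h \<rho> \<zeta> c1 \<longleftrightarrow> (let d = exp (- (1 - b) / 576) in
    0 < \<mu> \<and> 0 < q \<and> q < 1 \<and> 1 < \<kappa> \<and> q * \<kappa> ^ 3 < 1 \<and> 0 < R \<and> 0 < t \<and>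
    0 < c\<^sub>h \<and> c\<^sub>h \<le> 1 / 2 \<and> 0 < \<rho> \<and> 0 < \<zeta> \<and> 0 < c1 \<and>
    exp (\<mu> * c) * (2 * (1 + d) / (3 + d) + (1 - 2 * (1 + d) / (3 + d)) * exp (- \<mu> * (1 - d))) \<le> q \<and>
    1 + 1 / R\<^sup>2 \<le> \<kappa> \<and> 2 * (t + 2 * c\<^sub>h * R * sqrt K)\<^sup>2 \<le> c \<and> 1 + \<rho> / c\<^sub>h + \<zeta> \<le> \<kappa> \<and>
    2 * c\<^sub>h * \<zeta> * sqrt (c1 / (2 * pi)) \<le> 1 \<and>
    (2 * c\<^sub>h * \<zeta> * sqrt (c1 / (2 * pi))) powr (- c1) * exp (2 * c1) \<le> \<kappa>)"

text \<open>The gain \<open>q\<close> of a row depends on \<open>b\<close> alone. Then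
  \<open>\<kappa>\<close> is adapted to \<open>q\<close>, and all later constants serve to keep the
  volume costs below \<open>\<kappa>\<close> and the residual below the threshold
  \<open>c\<close>.\<close>

lemma exists_compressible_constants:
  fixes K b :: real
  assumes K: "0 < K" and b: "0 < b" "b < 1"
  shows "\<exists>\<mu> c q \<kappa> R t c\<^sub>h \<rho> \<zeta> c1. compressible_constants K b \<mu> c q \<kappa> R t c\<^sub>h \<rho> \<zeta> c1"
proof -
  define d where "d = exp (- (1 - b) / 576)"
  have d: "0 < d" "d < 1" using b by (auto simp: d_def)
  define q0 where "q0 = 2 * (1 + d) / (3 + d)"
  have q0: "0 < q0" "q0 < 1" using d by (auto simp: q0_def field_simps add_pos_pos)
  \<comment> \<open>This makes the exponential factor equal to 1/2, so that \<open>q1\<close> is the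
    midpoint of \<open>q0\<close> and 1.\<close>
  define \<mu> where "\<mu> = ln 2 / (1 - d)"
  have \<mu>: "0 < \<mu>" using d by (simp add: \<mu>_def)
  have e: "exp (- \<mu> * (1 - d)) = 1 / 2" using d by (simp add: \<mu>_def exp_minus)
  define q1 where "q1 = q0 + (1 - q0) * (1 / 2)"
  have "q1 = (1 + q0) / 2" by (simp add: q1_def field_simps)
  then have q1: "0 < q1" "q1 < 1" using q0 by auto
  define q where "q = (1 + q1) / 2"
  have q: "q1 < q" "q < 1" "0 < q" using q1 by (auto simp: q_def)
  define c where "c = ln (q / q1) / \<mu>"
  have c: "0 < c" using q q1 \<mu> by (simp add: c_def)
  have "exp (\<mu> * c) = q / q1" using \<mu> q q1 by (simp add: c_def)
  then have row: "exp (\<mu> * c) * (q0 + (1 - q0) * exp (- \<mu> * (1 - d))) \<le> q"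
    unfolding e q1_def[symmetric] using q1 by simp
  \<comment> \<open>The sixth root gives \<open>q * \<kappa> ^ 3 = sqrt q\<close>.\<close>
  define \<kappa> where "\<kappa> = (1 / q) powr (1 / 6)"
  have \<kappa>: "1 < \<kappa>" unfolding \<kappa>_def using q by (intro gr_one_powr) auto
  have "\<kappa> ^ 3 = sqrt (1 / q)"
    using q by (simp add: \<kappa>_def powr_realpow[symmetric] powr_powr powr_half_sqrt)
  then have "q * \<kappa> ^ 3 = sqrt q"
    using q real_div_sqrt[of q] by (simp add: real_sqrt_divide)
  then have q\<kappa>: "q * \<kappa> ^ 3 < 1" using q by simp
  define R where "R = 1 / sqrt (\<kappa> - 1)"
  have R: "0 < R" "1 + 1 / R\<^sup>2 \<le> \<kappa>" using \<kappa> by (auto simp: R_def power_divide)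
  define t where "t = sqrt (c / 2) / 2"
  have t: "0 < t" using c by (simp add: t_def)
  define c\<^sub>h where "c\<^sub>h = min (1 / 2) (t / (2 * R * sqrt K))"
  have ch: "0 < c\<^sub>h" "c\<^sub>h \<le> 1 / 2" using t R K by (auto simp: c\<^sub>h_def)
  have "c\<^sub>h * (2 * R * sqrt K) \<le> t / (2 * R * sqrt K) * (2 * R * sqrt K)"
    unfolding c\<^sub>h_def using R K by (intro mult_right_mono) auto
  then have tc0: "2 * c\<^sub>h * R * sqrt K \<le> t" using R K by (simp add: mult_ac)
  have "(t + 2 * c\<^sub>h * R * sqrt K)\<^sup>2 \<le> (2 * t)\<^sup>2"
    using tc0 t ch R K by (intro power_mono) auto
  also have "(2 * t)\<^sup>2 = c / 2" using c by (simp add: t_def)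
  finally have tc: "2 * (t + 2 * c\<^sub>h * R * sqrt K)\<^sup>2 \<le> c" by simp
  define \<rho> where "\<rho> = c\<^sub>h * (\<kappa> - 1) / 2"
  define \<zeta> where "\<zeta> = (\<kappa> - 1) / 2"
  have \<rho>\<zeta>: "0 < \<rho>" "0 < \<zeta>" "1 + \<rho> / c\<^sub>h + \<zeta> \<le> \<kappa>" using ch \<kappa> by (auto simp: \<rho>_def \<zeta>_def field_simps)
  define A where "A = 2 * c\<^sub>h * \<zeta> / sqrt (2 * pi)"
  have A: "0 < A" using ch \<rho>\<zeta> by (simp add: A_def)
  \<comment> \<open>As \<open>x powr x\<close> tends to 1 at 0, a small enough proportion
    \<open>c1\<close> of large coordinates costs arbitrarily little.\<close>
  have "((\<lambda>x. (A * sqrt x) powr (- x) * exp (2 * x)) \<longlongrightarrow> 1) (at_right 0)" using A by real_asymp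
  then have ev1: "eventually (\<lambda>x. (A * sqrt x) powr (- x) * exp (2 * x) < \<kappa>) (at_right 0)"
    using \<kappa> by (rule order_tendstoD)
  have "((\<lambda>x. A * sqrt x) \<longlongrightarrow> 0) (at_right 0)" using A by real_asymp
  then have ev2: "eventually (\<lambda>x. A * sqrt x < 1) (at_right 0)" by (rule order_tendstoD) simp
  have ev3: "eventually (\<lambda>x::real. 0 < x) (at_right 0)" by (rule eventually_at_right_less)
  obtain c1 where c1: "(A * sqrt c1) powr (- c1) * exp (2 * c1) < \<kappa>" "A * sqrt c1 < 1" "0 < c1"
    using eventually_happens'[OF trivial_limit_at_right_real eventually_conj[OF ev1 eventually_conj[OF ev2 ev3]]] by blast
  have Ac: "2 * c\<^sub>h * \<zeta> * sqrt (c1 / (2 * pi)) = A * sqrt c1" by (simp add: A_def real_sqrt_divide)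
  have "compressible_constants K b \<mu> c q \<kappa> R t c\<^sub>h \<rho> \<zeta> c1"
    unfolding compressible_constants_def Let_def d_def[symmetric] q0_def[symmetric] Ac
    by (intro conjI \<mu> q(2,3) \<kappa> q\<kappa> R t ch \<rho>\<zeta> c1(3) row tc less_imp_le[OF c1(1)] less_imp_le[OF c1(2)])
  then show ?thesis by blast
qed

text \<open>
  The constants are chosen in the order \<open>\<Lambda>, c\<^sub>T, c2, c\<^sub>h, \<delta>, \<eta>, \<tau>, r, c\<^sub>D\<close>. This is possible because the Gaussian
  decay rate of the small ball estimate does not depend on \<open>\<eta>\<close>, so that \<open>\<delta>\<close> can be taken small compared with it.
\<close>

definition incompressible_constants ::
  "real \<Rightarrow> real \<Rightarrow> real \<Rightarrow> real \<Rightarrow> real \<Rightarrow> real \<Rightarrow> real \<Rightarrow> real \<Rightarrow> real \<Rightarrow> real \<Rightarrow> real \<Rightarrow> real \<Rightarrow> real \<Rightarrow> real \<Rightarrow> nat \<Rightarrow> bool" where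
  "incompressible_constants K b \<kappa> R \<rho> c1 c\<^sub>h \<Lambda> c\<^sub>T c2 \<eta> \<delta> \<tau> c\<^sub>D r \<longleftrightarrow>
    0 < c\<^sub>h \<and> c\<^sub>h \<le> 1 / 2 \<and> 0 < \<Lambda> \<and> 0 < c\<^sub>T \<and> 0 < c2 \<and> 0 < \<eta> \<and>
    c\<^sub>h \<le> \<rho> / 2 \<and> c\<^sub>h \<le> \<Lambda> \<and> 2 * \<Lambda> * c\<^sub>T \<le> pi \<and> c\<^sub>h * R * sqrt K \<le> 1 \<and> 12 * \<tau>\<^sup>2 \<le> \<eta> \<and>
    4 * sqrt (6 * (80 * \<eta> / (c2 * (1 - b)))) / ((1 - b) / 2) * (2 * \<Lambda> + 3 / c\<^sub>T) \<le> \<delta> \<and> 0 < \<delta> \<and> \<delta> \<le> 1 \<and>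
    exp 1 * (160 / sqrt ((1 - b) * c2 * \<rho>\<^sup>2 / 192) + 40) * (2 * sqrt (2 * pi) * exp 2) * \<kappa> / (2 * c\<^sub>h) * \<delta> powr (c2 / 4) \<le> exp (- 3) \<and>
    0 < \<tau> \<and> 16 * \<tau>\<^sup>2 < c2 * c\<^sub>T\<^sup>2 * (1 - b) \<and> K / \<tau>\<^sup>2 \<le> r \<and>
    0 < c\<^sub>D \<and> c\<^sub>D \<le> \<eta> / 8 \<and> c\<^sub>D * (r + 2) \<le> 1 / 2 \<and> c2 + 1 / \<Lambda>\<^sup>2 \<le> c1"

lemma exists_incompressible_constants:
  fixes K b \<kappa> R \<rho> c1 :: real
  assumes K: "0 < K" and b: "0 < b" "b < 1" and pos: "1 < \<kappa>" "0 < R" "0 < \<rho>" "0 < c1"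
  shows "\<exists>c\<^sub>h \<Lambda> c\<^sub>T c2 \<eta> \<delta> \<tau> c\<^sub>D r. incompressible_constants K b \<kappa> R \<rho> c1 c\<^sub>h \<Lambda> c\<^sub>T c2 \<eta> \<delta> \<tau> c\<^sub>D r"
proof -
  \<comment> \<open>Half of \<open>c1\<close> is set aside for coordinates beyond
    \<open>\<Lambda> / sqrt n\<close>, of which a unit vector has at most
    \<open>n / \<Lambda>\<^sup>2 = c1 * n / 2\<close>.\<close>
  define c2 where "c2 = c1 / 2"
  define \<Lambda> where "\<Lambda> = sqrt (2 / c1)"
  define c\<^sub>T where "c\<^sub>T = pi / (2 * \<Lambda>)"
  have c2: "0 < c2" and \<Lambda>: "0 < \<Lambda>" using pos by (auto simp: c2_def \<Lambda>_def)
  have cT: "0 < c\<^sub>T" "2 * \<Lambda> * c\<^sub>T \<le> pi" using \<Lambda> by (auto simp: c\<^sub>T_def)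
  have c12: "c2 + 1 / \<Lambda>\<^sup>2 \<le> c1" using pos by (simp add: c2_def \<Lambda>_def)
  define c\<^sub>h where "c\<^sub>h = Min {1 / 2, \<rho> / 2, \<Lambda>, 1 / (R * sqrt K)}"
  have ch: "0 < c\<^sub>h" "c\<^sub>h \<le> 1 / 2" "c\<^sub>h \<le> \<rho> / 2" "c\<^sub>h \<le> \<Lambda>" "c\<^sub>h \<le> 1 / (R * sqrt K)"
    using pos \<Lambda> K by (auto simp: c\<^sub>h_def)
  have chR: "c\<^sub>h * R * sqrt K \<le> 1"
    using mult_right_mono[OF ch(5), of "R * sqrt K"] pos K by (simp add: mult.assoc)
  define A where "A = exp 1 * (160 / sqrt ((1 - b) * c2 * \<rho>\<^sup>2 / 192) + 40) * (2 * sqrt (2 * pi) * exp 2) * \<kappa> / (2 * c\<^sub>h)"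
  have A: "0 < A" unfolding A_def using pos c2 b ch by (intro divide_pos_pos mult_pos_pos add_nonneg_pos) auto
  \<comment> \<open>\<open>A\<close> involves only constants chosen earlier, so a small
    \<open>\<delta>\<close> can absorb it.\<close>
  define \<delta> where "\<delta> = min 1 ((exp (- 3) / A) powr (4 / c2))"
  have \<delta>: "0 < \<delta>" "\<delta> \<le> 1" using A by (auto simp: \<delta>_def)
  have "\<delta> powr (c2 / 4) \<le> ((exp (- 3) / A) powr (4 / c2)) powr (c2 / 4)"
    using \<delta> c2 by (intro powr_mono2) (auto simp: \<delta>_def)
  also have "\<dots> = exp (- 3) / A" using c2 A by (simp add: powr_powr)
  finally have A\<delta>: "A * \<delta> powr (c2 / 4) \<le> exp (- 3)" using A by (simp add: field_simps)
  define u where "u = 2 * \<Lambda> + 3 / c\<^sub>T"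
  have u: "0 < u" using \<Lambda> cT by (simp add: u_def add_pos_pos)
  \<comment> \<open>Solves the condition that relates \<open>\<eta>\<close> to
    \<open>\<delta>\<close> with equality.\<close>
  define \<eta> where "\<eta> = (\<delta> * ((1 - b) / 2) / (4 * u))\<^sup>2 * (c2 * (1 - b)) / 480"
  have \<eta>: "0 < \<eta>" using \<delta> b u c2 by (simp add: \<eta>_def)
  have "6 * (80 * \<eta> / (c2 * (1 - b))) = (\<delta> * ((1 - b) / 2) / (4 * u))\<^sup>2"
  proof -
    have "6 * (80 * (X * Y / 480) / Y) = X" if "Y \<noteq> 0" for X Y :: real using that by simp
    moreover have "c2 * (1 - b) \<noteq> 0" using b c2 by simp
    ultimately show ?thesis unfolding \<eta>_def by blast
  qed
  then have "sqrt (6 * (80 * \<eta> / (c2 * (1 - b)))) = \<delta> * ((1 - b) / 2) / (4 * u)"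
    using \<delta> b u by simp
  then have \<eta>\<delta>: "4 * sqrt (6 * (80 * \<eta> / (c2 * (1 - b)))) / ((1 - b) / 2) * u \<le> \<delta>"
    using b u by simp
  \<comment> \<open>\<open>v\<close> is the square of \<open>\<tau>\<close>. The first bound limits
    the effect of moving phases on light rows, the second excludes resonances at frequencies up to
    1.\<close>
  define v where "v = min (\<eta> / 12) (c2 * c\<^sub>T\<^sup>2 * (1 - b) / 32)"
  have v: "0 < v" "12 * v \<le> \<eta>" "16 * v < c2 * c\<^sub>T\<^sup>2 * (1 - b)"
  proof -
    have w: "0 < c2 * c\<^sub>T\<^sup>2 * (1 - b)" using c2 cT b by simp
    show "0 < v" using \<eta> w by (simp add: v_def)
    show "12 * v \<le> \<eta>" by (simp add: v_def)
    have "v \<le> c2 * c\<^sub>T\<^sup>2 * (1 - b) / 32" by (simp add: v_def)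
    then show "16 * v < c2 * c\<^sub>T\<^sup>2 * (1 - b)" using w by linarith
  qed
  define \<tau> where "\<tau> = sqrt v"
  have \<tau>: "0 < \<tau>" "\<tau>\<^sup>2 = v" using v by (auto simp: \<tau>_def)
  define r where "r = nat \<lceil>K / v\<rceil>"
  have r: "K / \<tau>\<^sup>2 \<le> r" unfolding \<tau> r_def by (rule real_nat_ceiling_ge)
  define c\<^sub>D where "c\<^sub>D = min (\<eta> / 8) (1 / (2 * (real r + 2)))"
  have cD: "0 < c\<^sub>D" "c\<^sub>D \<le> \<eta> / 8" using \<eta> by (auto simp: c\<^sub>D_def)
  have "c\<^sub>D * (real r + 2) \<le> 1 / (2 * (real r + 2)) * (real r + 2)" by (intro mult_right_mono) (auto simp: c\<^sub>D_def)
  also have "\<dots> = 1 / 2" by (simp add: add_eq_0_iff)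
  finally have cDr: "c\<^sub>D * (real r + 2) \<le> 1 / 2" .
  have cDr': "c\<^sub>D * real (r + 2) \<le> 1 / 2" using cDr by (simp add: add.commute)
  have \<tau>v: "12 * \<tau>\<^sup>2 \<le> \<eta>" "16 * \<tau>\<^sup>2 < c2 * c\<^sub>T\<^sup>2 * (1 - b)" unfolding \<tau>(2) by (fact v)+
  note \<eta>\<delta>' = \<eta>\<delta>[unfolded u_def] and A\<delta>' = A\<delta>[unfolded A_def]
  have "incompressible_constants K b \<kappa> R \<rho> c1 c\<^sub>h \<Lambda> c\<^sub>T c2 \<eta> \<delta> \<tau> c\<^sub>D r"
    unfolding incompressible_constants_def
    by (intro conjI ch(1-4) \<Lambda> cT c2 \<eta> chR \<tau>v \<eta>\<delta>' \<delta> A\<delta>' \<tau>(1) r cD cDr' c12)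
  then show ?thesis by blast
qed

lemma L2_set_few_large:
  fixes x :: "nat \<Rightarrow> real"
  assumes "L2_set x {..<n} = 1" "0 < \<Lambda>" "0 < n"
  shows "real (card {k. k < n \<and> \<Lambda> / sqrt n < \<bar>x k\<bar>}) \<le> n / \<Lambda>\<^sup>2"
proof -
  let ?S = "{k. k < n \<and> \<Lambda> / sqrt n < \<bar>x k\<bar>}"
  have "real (card ?S) * (\<Lambda>\<^sup>2 / n) = (\<Sum>k\<in>?S. \<Lambda>\<^sup>2 / n)" by simp
  also have "\<dots> \<le> (\<Sum>k\<in>?S. (x k)\<^sup>2)"
  proof (rule sum_mono)
    fix k assume "k \<in> ?S"
    then have "(\<Lambda> / sqrt n)\<^sup>2 \<le> \<bar>x k\<bar>\<^sup>2" using assms by (intro power_mono) auto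
    then show "\<Lambda>\<^sup>2 / n \<le> (x k)\<^sup>2" by (simp add: power_divide)
  qed
  also have "\<dots> \<le> (\<Sum>k<n. (x k)\<^sup>2)" by (rule sum_mono2) auto
  also have "\<dots> = (L2_set x {..<n})\<^sup>2" by (simp add: L2_set_def sum_nonneg)
  also have "\<dots> = 1" using assms by simp
  finally show ?thesis using assms by (simp add: field_simps)
qed

lemma compressible_constantsD:
  fixes K b \<mu> c q \<kappa> R t c\<^sub>h \<rho> \<zeta> c1 :: real
  assumes "compressible_constants K b \<mu> c q \<kappa> R t c\<^sub>h \<rho> \<zeta> c1"
  shows "0 < \<mu>"
    "0 < q"
    "q < 1"
    "1 < \<kappa>"
    "q * \<kappa> ^ 3 < 1"
    "0 < R"
    "0 < t"
    "0 < c\<^sub>h"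
    "c\<^sub>h \<le> 1 / 2"
    "0 < \<rho>"
    "0 < \<zeta>"
    "0 < c1"
    "exp (\<mu> * c) * (2 * (1 + exp (- (1 - b) / 576)) / (3 + exp (- (1 - b) / 576)) + (1 - 2 * (1 + exp (- (1 - b) / 576)) / (3 + exp (- (1 - b) / 576))) * exp (- \<mu> * (1 - exp (- (1 - b) / 576)))) \<le> q"
    "1 + 1 / R\<^sup>2 \<le> \<kappa>"
    "2 * (t + 2 * c\<^sub>h * R * sqrt K)\<^sup>2 \<le> c"
    "1 + \<rho> / c\<^sub>h + \<zeta> \<le> \<kappa>"
    "2 * c\<^sub>h * \<zeta> * sqrt (c1 / (2 * pi)) \<le> 1"
    "(2 * c\<^sub>h * \<zeta> * sqrt (c1 / (2 * pi))) powr (- c1) * exp (2 * c1) \<le> \<kappa>"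
  using assms unfolding compressible_constants_def Let_def by blast+

lemma incompressible_constantsD:
  fixes K b \<kappa> R \<rho> c1 c\<^sub>h \<Lambda> c\<^sub>T c2 \<eta> \<delta> \<tau> c\<^sub>D :: real and r :: nat
  assumes "incompressible_constants K b \<kappa> R \<rho> c1 c\<^sub>h \<Lambda> c\<^sub>T c2 \<eta> \<delta> \<tau> c\<^sub>D r"
  shows "0 < c\<^sub>h"
    "c\<^sub>h \<le> 1 / 2"
    "0 < \<Lambda>"
    "0 < c\<^sub>T"
    "0 < c2"
    "0 < \<eta>"
    "c\<^sub>h \<le> \<rho> / 2"
    "c\<^sub>h \<le> \<Lambda>"
    "2 * \<Lambda> * c\<^sub>T \<le> pi"
    "c\<^sub>h * R * sqrt K \<le> 1"
    "12 * \<tau>\<^sup>2 \<le> \<eta>"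
    "4 * sqrt (6 * (80 * \<eta> / (c2 * (1 - b)))) / ((1 - b) / 2) * (2 * \<Lambda> + 3 / c\<^sub>T) \<le> \<delta>"
    "0 < \<delta>"
    "\<delta> \<le> 1"
    "exp 1 * (160 / sqrt ((1 - b) * c2 * \<rho>\<^sup>2 / 192) + 40) * (2 * sqrt (2 * pi) * exp 2) * \<kappa> / (2 * c\<^sub>h) * \<delta> powr (c2 / 4) \<le> exp (- 3)"
    "0 < \<tau>"
    "16 * \<tau>\<^sup>2 < c2 * c\<^sub>T\<^sup>2 * (1 - b)"
    "K / \<tau>\<^sup>2 \<le> r"
    "0 < c\<^sub>D"
    "c\<^sub>D \<le> \<eta> / 8"
    "c\<^sub>D * (r + 2) \<le> 1 / 2"
    "c2 + 1 / \<Lambda>\<^sup>2 \<le> c1"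
  using assms unfolding incompressible_constants_def by blast+

lemma regularity_power_le:
  assumes "1 + 1 / R\<^sup>2 \<le> \<kappa>" "0 < (\<kappa>::real)"
  shows "((1 + 1 / R\<^sup>2) / \<kappa>\<^sup>2) ^ n \<le> (1 / \<kappa>) ^ n"
proof (rule power_mono)
  have "(1 + 1 / R\<^sup>2) / \<kappa>\<^sup>2 \<le> \<kappa> / \<kappa>\<^sup>2" using assms by (intro divide_right_mono) auto
  then show "(1 + 1 / R\<^sup>2) / \<kappa>\<^sup>2 \<le> 1 / \<kappa>" using assms(2) by (simp add: power2_eq_square)
qed (auto intro!: divide_nonneg_nonneg add_nonneg_nonneg)

section \<open>From distances to the smallest singular value\<close>

context anticoncentrated_matrix
begin

lemma compressible_event_bound:
  fixes \<mu> c q \<kappa> R t c\<^sub>h \<rho> \<zeta> c1 :: real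
  assumes comp: "compressible_constants K b \<mu> c q \<kappa> R t c\<^sub>h \<rho> \<zeta> c1"
    and I: "I \<subseteq> {..<n}" "n \<le> card I + 1" and n2: "2 \<le> n"
  obtains E where "E \<in> events" "prob E \<le> (1 / \<kappa>) ^ n + 2 / q * (q * \<kappa> ^ 3) ^ n"
    "\<And>\<omega> x. \<omega> \<in> space M - E \<Longrightarrow> L2_set x {..<n} = 1 \<Longrightarrow>
      real (card {k. k < n \<and> \<rho> / sqrt n < \<bar>x k\<bar>}) \<le> c1 * n \<Longrightarrow>
      L2_set (mat_vec n (\<lambda>i j. B i j \<omega>) x) I \<le> t * sqrt n \<Longrightarrow> False"
proof -
  note C = compressible_constantsD[OF comp]
  note row = C(13)[folded row_decay_def]
  have \<kappa>: "0 < \<kappa>" and t: "0 \<le> t" using C(4,7) by simp_all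
  have reg: "((1 + 1 / R\<^sup>2) / \<kappa>\<^sup>2) ^ n \<le> (1 / \<kappa>) ^ n" by (rule regularity_power_le[OF C(14) \<kappa>])
  obtain E where E: "E \<in> events" "prob E \<le> ((1 + 1 / R\<^sup>2) / \<kappa>\<^sup>2) ^ n + 2 / q * (q * \<kappa> ^ 3) ^ n"
    "\<And>\<omega> x. \<omega> \<in> space M - E \<Longrightarrow> L2_set x {..<n} = 1 \<Longrightarrow>
      real (card {k. k < n \<and> \<rho> / sqrt n < \<bar>x k\<bar>}) \<le> c1 * n \<Longrightarrow>
      L2_set (mat_vec n (\<lambda>i j. B i j \<omega>) x) I \<le> t * sqrt n \<Longrightarrow> False"
    by (rule compressible_event[OF I n2 C(6) \<kappa> C(8,9,10,12,11) t C(1,2,3) row C(15,16,17,18)]) blast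
  have "prob E \<le> (1 / \<kappa>) ^ n + 2 / q * (q * \<kappa> ^ 3) ^ n" using E(2) reg by linarith
  then show thesis using that E(1,3) by blast
qed

text \<open>Off an exceptional event, the unit normals to the other rows are incompressible and
  nonresonant for the light row \<open>k\<close>. As row \<open>k\<close> is independent of the
  others, its distance to their span has a small ball bound. Applied to the transposed matrix, the
  rows become columns.\<close>

lemma column_event:
  fixes \<mu> c q \<kappa> R t c\<^sub>h' \<rho> \<zeta> c1 c\<^sub>h \<Lambda> c\<^sub>T c2 \<eta> \<delta> \<tau> c\<^sub>D t' :: real and r :: nat
  assumes comp: "compressible_constants K b \<mu> c q \<kappa> R t c\<^sub>h' \<rho> \<zeta> c1"
    and inc: "incompressible_constants K b \<kappa> R \<rho> c1 c\<^sub>h \<Lambda> c\<^sub>T c2 \<eta> \<delta> \<tau> c\<^sub>D r"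
    and n2: "2 \<le> n" and k: "k \<in> light_rows \<tau>" and t': "0 \<le> t'"
  obtains S where "S \<in> events"
    "prob S \<le> (1 / \<kappa>) ^ n + 2 / q * (q * \<kappa> ^ 3) ^ n + 2 * n * ((1 / \<kappa>) ^ n + 6 * (real n)\<^sup>2 * exp (- 2) ^ n)
      + exp 1 * (80 / sqrt ((1 - b) * c2 * \<rho>\<^sup>2 / 192) + 40) * (t' + exp (- c\<^sub>D * n))"
    "\<And>\<omega> z. \<omega> \<in> space M \<Longrightarrow> L2_set (\<lambda>j. B k j \<omega> + (\<Sum>l\<in>{..<n} - {k}. z l * B l j \<omega>)) {..<n} < t' \<Longrightarrow> \<omega> \<in> S"
proof -
  note C = compressible_constantsD[OF comp] and D = incompressible_constantsD[OF inc]
  have kn: "k < n" using k by (simp add: light_rows_def)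
  let ?I = "{..<n} - {k}"
  have I: "?I \<subseteq> {..<n}" "n \<le> card ?I + 1" using kn by auto
  have \<kappa>: "0 < \<kappa>" using C(4) by simp
  have reg: "((1 + 1 / R\<^sup>2) / \<kappa>\<^sup>2) ^ n \<le> (1 / \<kappa>) ^ n" by (rule regularity_power_le[OF C(14) \<kappa>])
  obtain E1 where E1: "E1 \<in> events" "prob E1 \<le> (1 / \<kappa>) ^ n + 2 / q * (q * \<kappa> ^ 3) ^ n"
    "\<And>\<omega> x. \<omega> \<in> space M - E1 \<Longrightarrow> L2_set x {..<n} = 1 \<Longrightarrow>
      real (card {k. k < n \<and> \<rho> / sqrt n < \<bar>x k\<bar>}) \<le> c1 * n \<Longrightarrow>
      L2_set (mat_vec n (\<lambda>i j. B i j \<omega>) x) ?I \<le> t * sqrt n \<Longrightarrow> False"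
    by (rule compressible_event_bound[OF comp I n2]) blast
  show thesis
  proof (rule nonresonance_event[OF I C(6) \<kappa> D(1,2) C(10) D(3-6,7-11,12-14) D(15,16-18) D(19-21)])
    fix E2
    assume E2: "E2 \<in> events"
      "prob E2 \<le> 2 * n * (((1 + 1 / R\<^sup>2) / \<kappa>\<^sup>2) ^ n + 6 * (real n)\<^sup>2 * exp (- 2) ^ n)"
      "\<And>\<omega> x i s. \<omega> \<in> space M - E2 \<Longrightarrow> L2_set x {..<n} = 1 \<Longrightarrow> L2_set (mat_vec n (\<lambda>i j. B i j \<omega>) x) ?I \<le> 0 \<Longrightarrow>
        c2 * n \<le> card (spread \<rho> \<Lambda> x) \<Longrightarrow> i \<in> light_rows \<tau> \<Longrightarrow> 0 < s \<Longrightarrow> s \<le> exp (c\<^sub>D * n) \<Longrightarrow>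
        \<not> resonant \<rho> \<Lambda> c\<^sub>T c2 \<eta> i x s"
    let ?p = "exp 1 * (80 / sqrt ((1 - b) * c2 * \<rho>\<^sup>2 / 192) + 40) * (t' + exp (- c\<^sub>D * n))"
    have p0: "0 \<le> ?p"
      using t' b D(5) by (intro mult_nonneg_nonneg add_nonneg_nonneg divide_nonneg_nonneg) auto
    have E: "E1 \<union> E2 \<in> events" using E1 E2 by auto
    obtain S where S: "S \<in> events" "prob S \<le> prob (E1 \<union> E2) + ?p"
      "\<And>\<omega> z. \<omega> \<in> space M \<Longrightarrow> L2_set (\<lambda>j. B k j \<omega> + (\<Sum>l\<in>?I. z l * B l j \<omega>)) {..<n} < t' \<Longrightarrow> \<omega> \<in> S"
    proof (rule distance_event[OF kn refl E p0])
      fix \<omega> v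
      assume \<omega>: "\<omega> \<in> space M - (E1 \<union> E2)" and v: "L2_set v {..<n} = 1"
        and ker: "L2_set (mat_vec n (\<lambda>i j. B i j \<omega>) v) ?I \<le> 0"
      have "0 \<le> t * sqrt n" using C(7) by simp
      then have "\<not> real (card {k. k < n \<and> \<rho> / sqrt n < \<bar>v k\<bar>}) \<le> c1 * n"
        using E1(3)[of \<omega> v] \<omega> v ker by force
      then have large: "c1 * n < card {k. k < n \<and> \<rho> / sqrt n < \<bar>v k\<bar>}" by simp
      \<comment> \<open>More than \<open>c1 * n\<close> coordinates exceed the lower threshold and
        at most \<open>n / \<Lambda>\<^sup>2\<close> exceed the upper one, so at least
        \<open>c2 * n\<close> are spread.\<close>
      have "card {k. k < n \<and> \<rho> / sqrt n < \<bar>v k\<bar>} \<le> card (spread \<rho> \<Lambda> v \<union> {k. k < n \<and> \<Lambda> / sqrt n < \<bar>v k\<bar>})"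
        by (intro card_mono) (auto simp: spread_def)
      also have "\<dots> \<le> card (spread \<rho> \<Lambda> v) + card {k. k < n \<and> \<Lambda> / sqrt n < \<bar>v k\<bar>}" by (rule card_Un_le)
      finally have "c1 * n \<le> card (spread \<rho> \<Lambda> v) + n / \<Lambda>\<^sup>2"
        using large L2_set_few_large[OF v, of \<Lambda>] n_pos D(3) by linarith
      moreover have "(c2 + 1 / \<Lambda>\<^sup>2) * n \<le> c1 * n" using D(22) by (intro mult_right_mono) auto
      ultimately have sp: "c2 * n \<le> card (spread \<rho> \<Lambda> v)" by (simp add: distrib_right)
      show "prob {\<omega>'\<in>space M. \<bar>\<Sum>j<n. B k j \<omega>' * v j\<bar> \<le> t'} \<le> ?p"
      proof (rule nonresonant_small_ball[OF kn sp C(10) D(3) D(5) D(4) D(9) D(6) D(19,20) _ t'])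
        show "\<not> resonant \<rho> \<Lambda> c\<^sub>T c2 \<eta> k v s" if "0 < s" "s \<le> exp (c\<^sub>D * n)" for s
          using E2(3)[of \<omega> v k s] \<omega> v ker sp k that by blast
      qed
    qed blast
    have "prob (E1 \<union> E2) \<le> prob E1 + prob E2" using E1 E2 by (intro measure_Un_le) auto
    moreover have "2 * n * (((1 + 1 / R\<^sup>2) / \<kappa>\<^sup>2) ^ n + 6 * (real n)\<^sup>2 * exp (- 2) ^ n) \<le> 2 * n * ((1 / \<kappa>) ^ n + 6 * (real n)\<^sup>2 * exp (- 2) ^ n)"
      using reg by (intro mult_left_mono add_right_mono) auto
    ultimately have "prob S \<le> (1 / \<kappa>) ^ n + 2 / q * (q * \<kappa> ^ 3) ^ n + 2 * n * ((1 / \<kappa>) ^ n + 6 * (real n)\<^sup>2 * exp (- 2) ^ n) + ?p"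
      using S(2) E1(2) E2(2) reg by linarith
    then show thesis using that S by blast
  qed
qed

text \<open>The hypotheses are symmetric in rows and columns. The argument for
  \<open>sigma_min\<close> uses distances of columns, whereas the analysis so far concerns
  rows.\<close>

lemma anticoncentrated_transpose: "anticoncentrated_matrix M n (\<lambda>i j. B j i) K b"
proof unfold_locales
  have "indep_vars (\<lambda>_. borel :: real measure) (\<lambda>p \<omega>. (\<lambda>f. f (snd p, fst p)) (\<lambda>p\<in>{(snd p, fst p)}. B (fst p) (snd p) \<omega>)) ({..<n} \<times> {..<n})"
    by (rule block_indep) (auto simp: disjoint_family_on_def intro!: measurable_component_singleton)
  then show "indep_vars (\<lambda>_. borel) (\<lambda>(i, j). B j i) ({..<n} \<times> {..<n})"
    by (simp add: case_prod_beta')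
  show "(\<Sum>i<n. \<Sum>j<n. expectation (\<lambda>\<omega>. (B j i \<omega>)\<^sup>2)) \<le> K * (real n)\<^sup>2"
    using hilbert_schmidt by (subst sum.swap)
qed (use n_pos K_pos square_integrable b levy in auto)

text \<open>If \<open>A v\<close> is short for an incompressible unit vector \<open>v\<close>, then
  at least \<open>c1 * n / 2\<close> light columns lie close to the span of the others, at distance
  at most the norm of \<open>A v\<close> over \<open>\<bar>v k\<bar>\<close>. Markov's inequality
  for the number of such columns loses the constant \<open>2 / c1\<close>, where a union bound would
  lose a factor \<open>n\<close>.\<close>

lemma sigma_min_bound:
  fixes \<mu> c q \<kappa> R t c\<^sub>h' \<rho> \<zeta> c1 c\<^sub>h \<Lambda> c\<^sub>T c2 \<eta> \<delta> \<tau> c\<^sub>D \<epsilon> :: real and r :: nat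
  assumes comp: "compressible_constants K b \<mu> c q \<kappa> R t c\<^sub>h' \<rho> \<zeta> c1"
    and inc: "incompressible_constants K b \<kappa> R \<rho> c1 c\<^sub>h \<Lambda> c\<^sub>T c2 \<eta> \<delta> \<tau> c\<^sub>D r"
    and n2: "2 \<le> n" "2 * r \<le> c1 * n" and \<epsilon>: "0 < \<epsilon>" "2 * \<epsilon> \<le> t * n"
  defines "u \<equiv> (1 / \<kappa>) ^ n + 2 / q * (q * \<kappa> ^ 3) ^ n"
  shows "prob {\<omega>\<in>space M. sigma_min n (\<lambda>i j. B i j \<omega>) \<le> \<epsilon> / sqrt n}
    \<le> u + 2 / c1 * (u + 2 * n * ((1 / \<kappa>) ^ n + 6 * (real n)\<^sup>2 * exp (- 2) ^ n)
      + exp 1 * (80 / sqrt ((1 - b) * c2 * \<rho>\<^sup>2 / 192) + 40) * (2 * \<epsilon> / \<rho> + exp (- c\<^sub>D * n)))"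
    (is "_ \<le> u + 2 / c1 * ?p")
proof -
  note C = compressible_constantsD[OF comp] and D = incompressible_constantsD[OF inc]
  note fmm = finite_measure_mono and emm = emeasure_eq_measure and np = n_pos
  have sn: "0 < sqrt n" using n_pos by simp
  obtain E where E: "E \<in> events" "prob E \<le> u"
    "\<And>\<omega> x. \<omega> \<in> space M - E \<Longrightarrow> L2_set x {..<n} = 1 \<Longrightarrow>
      real (card {k. k < n \<and> \<rho> / sqrt n < \<bar>x k\<bar>}) \<le> c1 * n \<Longrightarrow>
      L2_set (mat_vec n (\<lambda>i j. B i j \<omega>) x) {..<n} \<le> t * sqrt n \<Longrightarrow> False"
    unfolding u_def by (rule compressible_event_bound[OF comp, of "{..<n}", OF _ _ n2(1)]) auto
  interpret T: anticoncentrated_matrix M n "\<lambda>i j. B j i" K b by (rule anticoncentrated_transpose)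
  let ?G = "T.light_rows \<tau>"
  have fG: "finite ?G" using T.light_rows_subset finite_subset by blast
  have cG: "real (card ({..<n} - ?G)) \<le> r" using T.card_heavy_rows_le[of \<tau>] D(16,18) by linarith
  have \<rho>: "0 < \<rho>" and c1: "0 < c1" by (fact C(10), fact C(12))
  have "\<forall>k\<in>?G. \<exists>S. S \<in> sets M \<and> measure M S \<le> ?p \<and>
    (\<forall>\<omega>\<in>space M. \<forall>z. L2_set (\<lambda>j. B j k \<omega> + (\<Sum>l\<in>{..<n} - {k}. z l * B j l \<omega>)) {..<n} < 2 * \<epsilon> / \<rho> \<longrightarrow> \<omega> \<in> S)"
  proof
    fix k assume k: "k \<in> ?G"
    have "0 \<le> 2 * \<epsilon> / \<rho>" using \<epsilon> \<rho> by simp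
    from T.column_event[OF comp inc n2(1) k this] obtain S where "S \<in> sets M" "measure M S \<le> ?p"
      "\<And>\<omega> z. \<omega> \<in> space M \<Longrightarrow> L2_set (\<lambda>j. B j k \<omega> + (\<Sum>l\<in>{..<n} - {k}. z l * B j l \<omega>)) {..<n} < 2 * \<epsilon> / \<rho> \<Longrightarrow> \<omega> \<in> S"
      unfolding u_def by blast
    then show "\<exists>S. S \<in> sets M \<and> measure M S \<le> ?p \<and>
      (\<forall>\<omega>\<in>space M. \<forall>z. L2_set (\<lambda>j. B j k \<omega> + (\<Sum>l\<in>{..<n} - {k}. z l * B j l \<omega>)) {..<n} < 2 * \<epsilon> / \<rho> \<longrightarrow> \<omega> \<in> S)"
      by blast
  qed
  from bchoice[OF this] obtain S where S0: "\<forall>k\<in>?G. S k \<in> sets M \<and> measure M (S k) \<le> ?p \<and>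
    (\<forall>\<omega>\<in>space M. \<forall>z. L2_set (\<lambda>j. B j k \<omega> + (\<Sum>l\<in>{..<n} - {k}. z l * B j l \<omega>)) {..<n} < 2 * \<epsilon> / \<rho> \<longrightarrow> \<omega> \<in> S k)"
    by (rule exE)
  then have S: "k \<in> ?G \<Longrightarrow> S k \<in> sets M" "k \<in> ?G \<Longrightarrow> measure M (S k) \<le> ?p" for k by blast+
  define N where "N \<omega> = (\<Sum>k\<in>?G. indicator (S k) \<omega> :: real)" for \<omega>
  have Ni: "integrable M N"
    unfolding N_def using S by (intro Bochner_Integration.integrable_sum) (simp add: emm)
  define F where "F = {\<omega>\<in>space M. c1 * n / 2 \<le> N \<omega>}"
  have F: "F \<in> sets M" unfolding F_def using borel_measurable_integrable[OF Ni] by measurable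
  have "c1 * n / 2 * measure M F = (\<integral>\<omega>. c1 * n / 2 * indicator F \<omega> \<partial>M)" using F by simp
  also have "\<dots> \<le> (\<integral>\<omega>. N \<omega> \<partial>M)"
  proof (rule Bochner_Integration.integral_mono[OF _ Ni])
    show "integrable M (\<lambda>\<omega>. c1 * n / 2 * indicator F \<omega>)" using F by (intro integrable_mult_right) (simp add: emm)
    show "c1 * n / 2 * indicator F \<omega> \<le> N \<omega>" for \<omega>
      by (cases "\<omega> \<in> F") (auto simp: F_def N_def intro!: sum_nonneg)
  qed
  also have "\<dots> = (\<Sum>k\<in>?G. measure M (S k))"
    unfolding N_def using S by (subst Bochner_Integration.integral_sum) (auto simp: emm)
  also have "\<dots> \<le> (\<Sum>k\<in>?G. ?p)" using S by (intro sum_mono) auto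
  also have "\<dots> = card ?G * ?p" by simp
  also have "\<dots> \<le> n * ?p"
  proof (cases "?G = {}")
    case True
    have "0 \<le> ?p" unfolding u_def
      using C(2,4,10) D(5) b \<epsilon> by (intro add_nonneg_nonneg mult_nonneg_nonneg divide_nonneg_nonneg zero_le_power) auto
    then show ?thesis using True by simp
  next
    case False
    then obtain k where "k \<in> ?G" by blast
    then have "0 \<le> ?p" using S(2)[of k] measure_nonneg[of M "S k"] by linarith
    moreover have "card ?G \<le> n" using card_mono[OF _ T.light_rows_subset] by auto
    ultimately show ?thesis by (intro mult_right_mono) auto
  qed
  finally have le: "c1 * n / 2 * measure M F \<le> n * ?p" .
  have "x \<le> 2 / c1 * p" if "c1 * n / 2 * x \<le> n * p" for x p :: real
  proof -
    have "n * (c1 / 2 * x) \<le> n * p" using that by (simp add: mult_ac)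
    then have "c1 / 2 * x \<le> p" using np by (simp add: mult_le_cancel_left_pos)
    then show ?thesis using c1 by (simp add: field_simps)
  qed
  from this[OF le] have "measure M F \<le> 2 / c1 * ?p" .
  moreover have "measure M {\<omega>\<in>space M. sigma_min n (\<lambda>i j. B i j \<omega>) \<le> \<epsilon> / sqrt n} \<le> measure M (E \<union> F)"
  proof (rule fmm)
    show "E \<union> F \<in> sets M" using E(1) F by auto
    show "{\<omega>\<in>space M. sigma_min n (\<lambda>i j. B i j \<omega>) \<le> \<epsilon> / sqrt n} \<subseteq> E \<union> F"
    proof safe
      fix \<omega> assume \<omega>: "\<omega> \<in> space M" and sm: "sigma_min n (\<lambda>i j. B i j \<omega>) \<le> \<epsilon> / sqrt n" and nF: "\<omega> \<notin> F"
      show "\<omega> \<in> E"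
      proof (rule ccontr)
        assume nE: "\<omega> \<notin> E"
        let ?A = "\<lambda>i j. B i j \<omega>"
        \<comment> \<open>Doubling opens a strict gap, so that some vector lies below the bound
          although \<open>sigma_min\<close> is an infimum compared by \<open>\<le>\<close>. This
          uses \<open>\<epsilon> > 0\<close>.\<close>
        have "\<epsilon> / sqrt n < 2 * \<epsilon> / sqrt n" using \<epsilon> sn by (simp add: divide_strict_right_mono)
        then have "sigma_min n ?A < 2 * \<epsilon> / sqrt n" using sm by linarith
        then obtain x where x: "L2_set x {..<n} \<noteq> 0" "L2_set (mat_vec n ?A x) {..<n} < 2 * \<epsilon> / sqrt n * L2_set x {..<n}"
          using sigma_min_less_iff[OF np] by blast
        have xp: "0 < L2_set x {..<n}" using x(1) L2_set_nonneg[of x "{..<n}"] by linarith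
        let ?c = "1 / L2_set x {..<n}"
        define v where "v = (\<lambda>i. ?c * x i)"
        have v1: "L2_set v {..<n} = 1" unfolding v_def using xp by (subst L2_set_scale) simp
        have Av: "L2_set (mat_vec n ?A v) {..<n} < 2 * \<epsilon> / sqrt n"
          unfolding v_def mat_vec_scale L2_set_scale using xp x(2) by (simp add: pos_divide_less_eq)
        have "2 * \<epsilon> / sqrt n \<le> t * n / sqrt n" using \<epsilon>(2) sn by (intro divide_right_mono) auto
        also have "t * n / sqrt n = t * sqrt n" using real_div_sqrt[of "real n"] by (simp add: times_divide_eq_right[symmetric] del: times_divide_eq_right)
        finally have "L2_set (mat_vec n ?A v) {..<n} \<le> t * sqrt n" using Av by linarith
        then have "\<not> real (card {k. k < n \<and> \<rho> / sqrt n < \<bar>v k\<bar>}) \<le> c1 * n"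
          using E(3)[of \<omega> v] \<omega> nE v1 by blast
        then have large: "c1 * n < card {k. k < n \<and> \<rho> / sqrt n < \<bar>v k\<bar>}" by simp
        let ?P = "{k. k < n \<and> \<rho> / sqrt n < \<bar>v k\<bar>}"
        \<comment> \<open>At most \<open>r\<close> columns are heavy, and
          \<open>2 * r \<le> c1 * n\<close> leaves half of the large coordinates.\<close>
        have "card ?P \<le> card ((?P \<inter> ?G) \<union> ({..<n} - ?G))" by (intro card_mono) auto
        also have "\<dots> \<le> card (?P \<inter> ?G) + card ({..<n} - ?G)" by (rule card_Un_le)
        finally have PG: "c1 * n / 2 \<le> card (?P \<inter> ?G)" using large cG n2(2) by linarith
        have inS: "\<omega> \<in> S k" if k: "k \<in> ?P \<inter> ?G" for k
        proof -
          have kn: "k < n" and vk: "\<rho> / sqrt n < \<bar>v k\<bar>" and kG: "k \<in> ?G" using k by auto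
          have \<rho>n: "0 < \<rho> / sqrt n" using \<rho> sn by (rule divide_pos_pos)
          then have vk0: "v k \<noteq> 0" using vk by auto
          have eq: "B j k \<omega> + (\<Sum>l\<in>{..<n} - {k}. (v l / v k) * B j l \<omega>) = (1 / v k) * mat_vec n ?A v j" for j
          proof -
            have "mat_vec n ?A v j = B j k \<omega> * v k + (\<Sum>l\<in>{..<n} - {k}. B j l \<omega> * v l)"
              unfolding mat_vec_def using kn by (subst sum.remove[of _ k]) auto
            then show ?thesis using vk0 by (simp add: distrib_left sum_distrib_left mult_ac)
          qed
          have "L2_set (\<lambda>j. B j k \<omega> + (\<Sum>l\<in>{..<n} - {k}. (v l / v k) * B j l \<omega>)) {..<n} = \<bar>1 / v k\<bar> * L2_set (mat_vec n ?A v) {..<n}"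
            unfolding eq by (rule L2_set_scale)
          also have "\<dots> = L2_set (mat_vec n ?A v) {..<n} / \<bar>v k\<bar>" by simp
          also have "\<dots> \<le> L2_set (mat_vec n ?A v) {..<n} / (\<rho> / sqrt n)"
            using vk \<rho>n vk0 by (intro divide_left_mono mult_pos_pos) auto
          also have "\<dots> < 2 * \<epsilon> / sqrt n / (\<rho> / sqrt n)" using Av \<rho>n by (rule divide_strict_right_mono)
          also have "\<dots> = 2 * \<epsilon> / \<rho>" using sn by simp
          finally have "L2_set (\<lambda>j. B j k \<omega> + (\<Sum>l\<in>{..<n} - {k}. (v l / v k) * B j l \<omega>)) {..<n} < 2 * \<epsilon> / \<rho>" .
          with spec[OF bspec[OF conjunct2[OF conjunct2[OF bspec[OF S0 kG]]] \<omega>], of "\<lambda>l. v l / v k"]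
          show ?thesis by (rule mp)
        qed
        have "real (card (?P \<inter> ?G)) = (\<Sum>k\<in>?P \<inter> ?G. indicator (S k) \<omega>)" using inS by simp
        also have "\<dots> \<le> N \<omega>" unfolding N_def using fG by (intro sum_mono2) auto
        finally have "\<omega> \<in> F" unfolding F_def using PG \<omega> by simp
        then show False using nF by simp
      qed
    qed
  qed
  moreover have "measure M (E \<union> F) \<le> measure M E + measure M F" using E(1) F by (rule measure_Un_le)
  ultimately show ?thesis using E(2) by linarith
qed

end

text \<open>Half of the exponential rate absorbs the polynomial factor; the other half becomes
  \<open>c\<close>.\<close>

lemma eventually_exp_dominates:
  fixes \<theta> C :: real
  assumes "0 < \<theta>" "\<theta> < 1"
  shows "\<exists>c>0. \<exists>n0. \<forall>n\<ge>n0. C * real n ^ 3 * \<theta> ^ n \<le> 2 * exp (- c * real n)"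
proof -
  define c where "c = - ln \<theta> / 2"
  have c: "0 < c" using assms by (simp add: c_def)
  have "\<theta> = exp (- 2 * c)" using assms by (simp add: c_def)
  then have \<theta>n: "\<theta> ^ n = exp (- c * n) * exp (- c * n)" for n
    by (simp add: exp_of_nat_mult[symmetric] exp_add[symmetric] algebra_simps)
  have "((\<lambda>n. C * real n ^ 3 * exp (- c * real n)) \<longlongrightarrow> 0) sequentially" using c by real_asymp
  then have "eventually (\<lambda>n. C * real n ^ 3 * exp (- c * real n) < 2) sequentially" by (rule order_tendstoD) simp
  then obtain n0 where n0: "\<And>n. n \<ge> n0 \<Longrightarrow> C * real n ^ 3 * exp (- c * real n) < 2"
    by (auto simp: eventually_sequentially)
  have "C * real n ^ 3 * \<theta> ^ n \<le> 2 * exp (- c * real n)" if "n \<ge> n0" for n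
    unfolding \<theta>n using mult_right_mono[OF less_imp_le[OF n0[OF that]], of "exp (- c * real n)"] by (simp add: mult.assoc)
  then show ?thesis using c by blast
qed

theorem theorem1p1:
  fixes K b :: real
  assumes "K > 0" and "0 < b" and "b < 1"
  shows "\<exists>C>0. \<exists>c>0. \<forall>n>0. \<forall>(M :: 'w measure) (A :: nat \<Rightarrow> nat \<Rightarrow> 'w \<Rightarrow> real).
    prob_space M \<longrightarrow>
    prob_space.indep_vars M (\<lambda>_. borel) (\<lambda>(i, j). A i j) ({..<n} \<times> {..<n}) \<longrightarrow>
    (\<forall>i<n. \<forall>j<n. integrable M (\<lambda>\<omega>. (A i j \<omega>)\<^sup>2)) \<longrightarrow>
    (\<Sum>i<n. \<Sum>j<n. \<integral>\<omega>. (A i j \<omega>)\<^sup>2 \<partial>M) \<le> K * (real n)\<^sup>2 \<longrightarrow>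
    (\<forall>i<n. \<forall>j<n. levy_concentration M (A i j) 1 \<le> b) \<longrightarrow>
    (\<forall>\<epsilon>\<ge>0. measure M {\<omega> \<in> space M. sigma_min n (\<lambda>i j. A i j \<omega>) \<le> \<epsilon> / sqrt (real n)}
      \<le> C * \<epsilon> + 2 * exp (- c * real n))"
proof -
  obtain \<mu> c q \<kappa> R t c\<^sub>h' \<rho> \<zeta> c1 where comp: "compressible_constants K b \<mu> c q \<kappa> R t c\<^sub>h' \<rho> \<zeta> c1"
    using exists_compressible_constants[OF assms] by blast
  note CC = compressible_constantsD[OF comp]
  have pos: "1 < \<kappa>" "0 < R" "0 < \<rho>" "0 < c1" "0 < t" "0 < q" "q * \<kappa> ^ 3 < 1"
    by (fact CC)+
  obtain c\<^sub>h \<Lambda> c\<^sub>T c2 \<eta> \<delta> \<tau> c\<^sub>D r where inc: "incompressible_constants K b \<kappa> R \<rho> c1 c\<^sub>h \<Lambda> c\<^sub>T c2 \<eta> \<delta> \<tau> c\<^sub>D r"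
    using exists_incompressible_constants[OF assms pos(1-4)] by blast
  have cD: "0 < c\<^sub>D" and c2: "0 < c2" by (fact incompressible_constantsD[OF inc])+
  define Cs where "Cs = exp 1 * (80 / sqrt ((1 - b) * c2 * \<rho>\<^sup>2 / 192) + 40)"
  have Cs: "0 < Cs" unfolding Cs_def using assms c2 pos by (intro mult_pos_pos add_nonneg_pos) auto
  define \<theta> where "\<theta> = Max {1 / \<kappa>, q * \<kappa> ^ 3, exp (- 2), exp (- c\<^sub>D)}"
  have \<theta>: "1 / \<kappa> \<le> \<theta>" "q * \<kappa> ^ 3 \<le> \<theta>" "exp (- 2) \<le> \<theta>" "exp (- c\<^sub>D) \<le> \<theta>" unfolding \<theta>_def by auto
  have \<theta>1: "0 < \<theta>" "\<theta> < 1"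
  proof -
    show "0 < \<theta>" using \<theta>(3) exp_gt_zero[of "-2 :: real"] by linarith
    show "\<theta> < 1" unfolding \<theta>_def using pos cD by auto
  qed
  \<comment> \<open>Collects the coefficients of all terms bounded by
    \<open>n ^ 3 * \<theta> ^ n\<close>; \<open>14 = 2 * (1 + 6)\<close> comes from the dyadic
    levels.\<close>
  define C0 where "C0 = (1 + 2 / q) * (1 + 2 / c1) + 2 / c1 * (14 + Cs)"
  obtain c' n0 where c': "0 < c'" and n0: "\<And>n. n \<ge> n0 \<Longrightarrow> C0 * real n ^ 3 * \<theta> ^ n \<le> 2 * exp (- c' * real n)"
    using eventually_exp_dominates[OF \<theta>1, of C0] by blast
  define n1 where "n1 = Max {n0, 2, nat \<lceil>2 * r / c1\<rceil>}"
  have n1: "n0 \<le> n1" "2 \<le> n1" "nat \<lceil>2 * r / c1\<rceil> \<le> n1"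
    unfolding n1_def by (rule Max_ge; blast)+
  \<comment> \<open>The summand \<open>2 / t\<close> makes the bound trivial when
    \<open>2 * \<epsilon> > t * n\<close>, a range beyond the estimate for compressible
    vectors.\<close>
  define C where "C = 2 / t + 2 / c1 * Cs * (2 / \<rho>)"
  \<comment> \<open>The cap \<open>ln 2 / n1\<close> makes \<open>2 * exp (- cc * n)\<close> at
    least 1 for \<open>n < n1\<close>, so that small dimensions are trivial.\<close>
  define cc where "cc = min c' (ln 2 / n1)"
  have C: "0 < C" unfolding C_def using pos Cs by (intro add_pos_pos mult_pos_pos divide_pos_pos) auto
  have cc: "0 < cc" unfolding cc_def using c' n1 by simp
  have main: "measure M {\<omega> \<in> space M. sigma_min n (\<lambda>i j. A i j \<omega>) \<le> \<epsilon> / sqrt (real n)} \<le> C * \<epsilon> + 2 * exp (- cc * real n)"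
    if n: "n > 0" and M: "prob_space M"
      and ind: "prob_space.indep_vars M (\<lambda>_. borel) (\<lambda>(i, j). A i j) ({..<n} \<times> {..<n})"
      and int: "\<forall>i<n. \<forall>j<n. integrable M (\<lambda>\<omega>. (A i j \<omega>)\<^sup>2)"
      and hs: "(\<Sum>i<n. \<Sum>j<n. \<integral>\<omega>. (A i j \<omega>)\<^sup>2 \<partial>M) \<le> K * (real n)\<^sup>2"
      and levy: "\<forall>i<n. \<forall>j<n. levy_concentration M (A i j) 1 \<le> b" and \<epsilon>: "\<epsilon> \<ge> 0"
    for n \<epsilon> and M :: "'w measure" and A :: "nat \<Rightarrow> nat \<Rightarrow> 'w \<Rightarrow> real"
  proof -
    interpret prob_space M by (rule M)
    interpret anticoncentrated_matrix M n A K b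
      by unfold_locales (use n ind int hs levy assms in auto)
    let ?E = "\<lambda>\<epsilon>. {\<omega> \<in> space M. sigma_min n (\<lambda>i j. A i j \<omega>) \<le> \<epsilon> / sqrt (real n)}"
    have Em: "?E \<epsilon> \<in> events" for \<epsilon>
      using sigma_min_measurable[OF n entry_measurable] by measurable
    have pos_case: "prob (?E \<epsilon>) \<le> C * \<epsilon> + 2 * exp (- cc * real n)" if \<epsilon>: "0 < \<epsilon>" for \<epsilon>
    proof (cases "n < n1")
      case True
      have "cc * n \<le> ln 2 / n1 * n1" unfolding cc_def using True n by (intro mult_mono) (auto simp: n1_def)
      then have "cc * n \<le> ln 2" using n1 by simp
      then have "exp (- ln 2) \<le> exp (- cc * n)" by simp
      then have "1 \<le> 2 * exp (- cc * n)" by (simp add: exp_minus)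
      moreover have "0 \<le> C * \<epsilon>" using C \<epsilon> by simp
      ultimately show ?thesis using prob_le_1[of "?E \<epsilon>"] by linarith
    next
      case False
      then have nn1: "n1 \<le> n" by simp
      show ?thesis
      proof (cases "2 * \<epsilon> \<le> t * n")
        case False
        have "t * 1 \<le> t * n" using pos n by (intro mult_left_mono) auto
        then have "t \<le> 2 * \<epsilon>" using False by linarith
        then have "t / t \<le> 2 * \<epsilon> / t" using pos(5) by (intro divide_right_mono) auto
        then have "1 \<le> 2 / t * \<epsilon>" using pos by simp
        also have "\<dots> \<le> C * \<epsilon>" unfolding C_def using pos Cs \<epsilon> by (intro mult_right_mono) auto
        finally show ?thesis using prob_le_1[of "?E \<epsilon>"] exp_ge_zero[of "- cc * real n"] by linarith
      next
        case True
        have n2: "2 \<le> n" using n1(2) nn1 by simp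
        have "2 * r / c1 \<le> real n1" using n1(3) real_nat_ceiling_ge[of "2 * r / c1"] by linarith
        then have "2 * r / c1 \<le> n" using nn1 by linarith
        then have rn: "2 * real r \<le> c1 * n" using pos by (simp add: pos_divide_le_eq mult.commute)
        then have rn': "real (2 * r) \<le> c1 * n" by simp
        define T where "T = real n ^ 3 * \<theta> ^ n"
        have n3: "1 \<le> real n ^ 3" using n by simp
        have \<theta>n: "0 < \<theta> ^ n" using \<theta>1 by simp
        have p1: "(1 / \<kappa>) ^ n \<le> \<theta> ^ n" "(q * \<kappa> ^ 3) ^ n \<le> \<theta> ^ n" "exp (- 2) ^ n \<le> \<theta> ^ n"
          using \<theta> pos by (auto intro!: power_mono)
        have p2: "exp (- c\<^sub>D * n) \<le> \<theta> ^ n"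
        proof -
          have "exp (- c\<^sub>D * n) = exp (- c\<^sub>D) ^ n" by (simp add: exp_of_nat_mult[symmetric] mult.commute)
          then show ?thesis using \<theta>(4) by (simp add: power_mono)
        qed
        have T1: "\<theta> ^ n \<le> T" unfolding T_def using mult_right_mono[OF n3, of "\<theta> ^ n"] \<theta>n by simp
        define u where "u = (1 / \<kappa>) ^ n + 2 / q * (q * \<kappa> ^ 3) ^ n"
        have "u \<le> \<theta> ^ n + 2 / q * \<theta> ^ n" unfolding u_def using p1 pos by (intro add_mono mult_left_mono) auto
        also have "\<dots> = (1 + 2 / q) * \<theta> ^ n" by (simp add: distrib_right)
        also have "\<dots> \<le> (1 + 2 / q) * T" using T1 pos by (intro mult_left_mono) auto
        finally have u: "u \<le> (1 + 2 / q) * T" .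
        have w: "2 * n * ((1 / \<kappa>) ^ n + 6 * (real n)\<^sup>2 * exp (- 2) ^ n) \<le> 14 * T"
        proof -
          have "1 * \<theta> ^ n \<le> (real n)\<^sup>2 * \<theta> ^ n" using n \<theta>n by (intro mult_right_mono) auto
          then have "(1 / \<kappa>) ^ n \<le> (real n)\<^sup>2 * \<theta> ^ n" using p1(1) by linarith
          moreover have "6 * (real n)\<^sup>2 * exp (- 2) ^ n \<le> 6 * (real n)\<^sup>2 * \<theta> ^ n" using p1(3) by (intro mult_left_mono) auto
          ultimately have "2 * n * ((1 / \<kappa>) ^ n + 6 * (real n)\<^sup>2 * exp (- 2) ^ n) \<le> 2 * n * (7 * (real n)\<^sup>2 * \<theta> ^ n)"
            by (intro mult_left_mono) auto
          then show ?thesis by (simp add: T_def power3_eq_cube power2_eq_square mult_ac)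
        qed
        have "prob (?E \<epsilon>) \<le> u + 2 / c1 * (u + 2 * n * ((1 / \<kappa>) ^ n + 6 * (real n)\<^sup>2 * exp (- 2) ^ n)
            + Cs * (2 * \<epsilon> / \<rho> + exp (- c\<^sub>D * n)))"
          using sigma_min_bound[OF comp inc n2 rn' \<epsilon> True] unfolding u_def Cs_def .
        also have "\<dots> \<le> (1 + 2 / q) * T + 2 / c1 * ((1 + 2 / q) * T + 14 * T + Cs * (2 * \<epsilon> / \<rho> + T))"
          using u w p2 T1 pos Cs by (intro add_mono mult_left_mono) auto
        also have "\<dots> = 2 / c1 * Cs * (2 / \<rho>) * \<epsilon> + C0 * T"
          unfolding C0_def by (simp add: algebra_simps)
        also have "\<dots> \<le> C * \<epsilon> + 2 * exp (- cc * n)"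
        proof (rule add_mono)
          show "2 / c1 * Cs * (2 / \<rho>) * \<epsilon> \<le> C * \<epsilon>" unfolding C_def using pos \<epsilon> by (intro mult_right_mono) auto
          have "C0 * T \<le> 2 * exp (- c' * real n)" unfolding T_def using n0[of n] n1(1) nn1 by (simp add: mult.assoc)
          moreover have "cc * n \<le> c' * n" unfolding cc_def by (intro mult_right_mono) auto
          ultimately show "C0 * T \<le> 2 * exp (- cc * n)" by (smt (verit) exp_le_cancel_iff mult_minus_left)
        qed
        finally show ?thesis .
      qed
    qed
    show ?thesis
    proof (cases "\<epsilon> = 0")
      case False
      then show ?thesis using pos_case \<epsilon> by simp
    next
      case True
      \<comment> \<open>The case of radius 0 follows from positive radii \<open>e / C\<close> by
        letting \<open>e\<close> tend to 0.\<close>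
      have "prob (?E 0) \<le> 2 * exp (- cc * real n)"
      proof (rule field_le_epsilon)
        fix e :: real assume e: "0 < e"
        have "prob (?E 0) \<le> prob (?E (e / C))"
        proof (rule finite_measure_mono[OF _ Em])
          have "0 \<le> e / C / sqrt n" using e C by simp
          then show "?E 0 \<subseteq> ?E (e / C)" by auto
        qed
        also have "\<dots> \<le> C * (e / C) + 2 * exp (- cc * real n)" using e C by (intro pos_case) simp
        finally show "prob (?E 0) \<le> 2 * exp (- cc * real n) + e" using C by simp
      qed
      then show ?thesis using True by simp
    qed
  qed
  show ?thesis
    by (rule exI[of _ C], rule conjI[OF C], rule exI[of _ cc], rule conjI[OF cc], intro allI impI, rule main)
qed

end
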